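(* Let $\beta,\gamma\in\mathbb R$, let $\mathcal W,\varepsilon_0$ be as in the context, let $0<\varepsilon\le\varepsilon_0$, let $u$ be the global small-data solution with $\|u(1)\|_\Sigma\le\varepsilon$, and let $A$ be its modified scattering profile. Set $\zeta_0=-\gamma/2$, $A_0=A(-\gamma)$, $\alpha=\beta|A_0|^2$, $M_0=\int_{\mathbb R}\mathcal W(x)\,dx$, and assume $M_0A_0\ne0$. Then, as $T\to\infty$, the rescaled tails $$\eta\longmapsto T^{3/2}e^{i\alpha\log T}\big[\mathcal P_{u,+}-\mathcal P_u(T)\big]\Big(\zeta_0+\frac{\eta}{\sqrt T}\Big)$$ converge in $C^0_{\mathrm{loc}}(\mathbb R)$ to a nonzero profile in $C^{2,1}_{\mathrm{loc}}(\mathbb R)$, whose third derivative does not extend continuously to $\eta=0$.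
   Context: Notation: $\langle x\rangle=(1+x^2)^{1/2}$; $\|\cdot\|_q$ is the $L^q(\mathbb R)$ norm; $C_0(\mathbb R)$ is the space of continuous functions vanishing at infinity; $C^{2,1}_{\mathrm{loc}}(\mathbb R)$ denotes the $C^2$ functions with locally Lipschitz second derivative; $\Sigma=\{f\in H^1(\mathbb R):xf\in L^2(\mathbb R)\}$ with $\|f\|_\Sigma=\|f\|_{H^1}+\|xf\|_2$; Fourier transform $\widehat f(\zeta)=\int_{\mathbb R}e^{-i\zeta y}f(y)\,dy$. Assumption on $\mathcal W$: $\mathcal W:\mathbb R\to\mathbb R$ is smooth and there exist $p>2$ and constants $C_{\mathcal W,j}>0$ such that $|\partial_x^j\mathcal W(x)|\le C_{\mathcal W,j}\langle x\rangle^{-p-j}$ for all $x\in\mathbb R$ and all integers $j\ge0$. Equation: $i\partial_tu+\partial_y^2u-\beta|u|^2u+\mathcal W(y+\gamma t)|u|^4u=0$, $t\ge1$, $y\in\mathbb R$ (mild solutions). Small-data solution and profile: $\varepsilon_0=\varepsilon_0(\beta,\mathcal W)>0$ is a sufficiently small threshold, independent of $\gamma$, and $C_\delta,C>0$ are constants such that whenever $\|u_1\|_\Sigma\le\varepsilon\le\varepsilon_0$ there is a unique global solution $u\in C([1,\infty);\Sigma)\cap C^1([1,\infty);H^{-1})$ with $u(1)=u_1$; with $\delta=C_\delta|\beta|\varepsilon^2<1/16$ it satisfies $\|u(t)\|_\infty\le C\varepsilon t^{-1/2}$, $\|u(t)\|_{H^1}+\|(y+2it\partial_y)u(t)\|_2\le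 C\varepsilon t^\delta$ for $t\ge1$, and there is a unique $A\in L^2\cap L^\infty$ (the modified scattering profile) with $\|A\|_2+\|A\|_\infty\le C\varepsilon$ and $$\Big\|u(t,y)-t^{-1/2}e^{iy^2/(4t)}A(y/t)e^{-i\beta|A(y/t)|^2\log t}\Big\|_{L^q_y}\le C\varepsilon t^{-b_q+2\delta},\quad t\ge1,\ q\in\{2,\infty\},\quad b_2=\tfrac12,\ b_\infty=\tfrac34 .$$ Moreover $A\in H^\varsigma(\mathbb R)$ for every $\varsigma<1-2\delta$; $A$ denotes its continuous representative, so $A(-\gamma)$ makes sense. Cubic-renormalized profile: $$\mathcal P_u(t,\zeta)=e^{it\zeta^2}\widehat u(t,\zeta)+i\beta\int_1^te^{is\zeta^2}\,\widehat{|u(s)|^2u(s)}(\zeta)\,ds,\qquad t\ge1;$$ as $t\to\infty$, $\mathcal P_u(t)$ converges in $L^2_\zeta$ and uniformly to a limit $\mathcal P_{u,+}\in L^2(\mathbb R)\cap C_0(\mathbb R)$. *)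

theory Defs
  imports "HOL-Analysis.Analysis" "HOL-Probability.Essential_Supremum"
begin

section \<open>Function spaces on the real line\<close>

text \<open>
  Elements of Lebesgue and Sobolev spaces are Borel functions; two of them represent the same
  element iff they agree almost everywhere.  All norms are real-valued and only meaningful on
  the accompanying set of functions, so membership is stated next to every norm bound.
\<close>

definition jbr :: "real \<Rightarrow> real" where
  "jbr x = (1 + x\<^sup>2) powr (1/2)"

definition L2 :: "(real \<Rightarrow> complex) set" where
  "L2 = {f. f \<in> borel_measurable lborel \<and> integrable lborel (\<lambda>x. (cmod (f x))\<^sup>2)}"

definition L2_norm :: "(real \<Rightarrow> complex) \<Rightarrow> real" where
  "L2_norm f = sqrt (LINT x|lborel. (cmod (f x))\<^sup>2)"

definition Linf :: "(real \<Rightarrow> complex) set" where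
  "Linf = {f. f \<in> borel_measurable lborel \<and> esssup lborel (\<lambda>x. ereal (cmod (f x))) < \<infinity>}"

definition Linf_norm :: "(real \<Rightarrow> complex) \<Rightarrow> real" where
  "Linf_norm f = real_of_ereal (esssup lborel (\<lambda>x. ereal (cmod (f x))))"

definition C0 :: "(real \<Rightarrow> complex) set" where
  "C0 = {f. continuous_on UNIV f \<and> (f \<longlongrightarrow> 0) at_infinity}"

definition smooth :: "(real \<Rightarrow> real) \<Rightarrow> bool" where
  "smooth f \<longleftrightarrow> (\<forall>n x. ((deriv ^^ n) f) field_differentiable (at x))"

definition test_function :: "(real \<Rightarrow> real) \<Rightarrow> bool" where
  "test_function \<phi> \<longleftrightarrow> smooth \<phi> \<and> (\<exists>R. \<forall>x. \<bar>x\<bar> > R \<longrightarrow> \<phi> x = 0)"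

definition has_weak_deriv :: "(real \<Rightarrow> complex) \<Rightarrow> (real \<Rightarrow> complex) \<Rightarrow> bool" where
  "has_weak_deriv f g \<longleftrightarrow> (\<forall>\<phi>. test_function \<phi> \<longrightarrow>
     (LINT x|lborel. f x * complex_of_real (deriv \<phi> x))
       = - (LINT x|lborel. g x * complex_of_real (\<phi> x)))"

definition H1 :: "(real \<Rightarrow> complex) set" where
  "H1 = {f \<in> L2. \<exists>g\<in>L2. has_weak_deriv f g}"

text \<open>On \<^const>\<open>H1\<close> this is the weak derivative, which is determined almost everywhere.\<close>

definition weak_deriv :: "(real \<Rightarrow> complex) \<Rightarrow> real \<Rightarrow> complex" where
  "weak_deriv f = (SOME g. g \<in> L2 \<and> has_weak_deriv f g)"

definition H1_norm :: "(real \<Rightarrow> complex) \<Rightarrow> real" where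
  "H1_norm f = sqrt ((L2_norm f)\<^sup>2 + (L2_norm (weak_deriv f))\<^sup>2)"

definition Sigma_space :: "(real \<Rightarrow> complex) set" where
  "Sigma_space = {f \<in> H1. (\<lambda>x. complex_of_real x * f x) \<in> L2}"

definition Sigma_norm :: "(real \<Rightarrow> complex) \<Rightarrow> real" where
  "Sigma_norm f = H1_norm f + L2_norm (\<lambda>x. complex_of_real x * f x)"

section \<open>Fourier transform and Sobolev spaces of real order\<close>

text \<open>
  The integral is only used for integrable functions; note that every function in
  \<^const>\<open>Sigma_space\<close> is integrable.
\<close>

definition fourier :: "(real \<Rightarrow> complex) \<Rightarrow> real \<Rightarrow> complex" where
  "fourier f \<zeta> = (LINT y|lborel. cis (- (\<zeta> * y)) * f y)"

text \<open>\<open>g\<close> is the Fourier--Plancherel transform of the square integrable function \<open>f\<close>.\<close>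

definition plancherel_transform :: "(real \<Rightarrow> complex) \<Rightarrow> (real \<Rightarrow> complex) \<Rightarrow> bool" where
  "plancherel_transform f g \<longleftrightarrow> f \<in> L2 \<and> g \<in> L2 \<and>
     ((\<lambda>R. L2_norm (\<lambda>\<zeta>. fourier (\<lambda>y. indicat_real {-R..R} y *\<^sub>R f y) \<zeta> - g \<zeta>)) \<longlongrightarrow> 0) at_top"

text \<open>
  The image of \<open>H\<^sup>s\<close> under the Fourier transform, a weighted \<open>L\<^sup>2\<close> space, with the norm
  transported from \<open>H\<^sup>s\<close>.
\<close>

definition Hs_hat :: "real \<Rightarrow> (real \<Rightarrow> complex) set" where
  "Hs_hat s = {g. g \<in> borel_measurable lborel \<and>
     integrable lborel (\<lambda>\<zeta>. jbr \<zeta> powr (2 * s) * (cmod (g \<zeta>))\<^sup>2)}"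

definition Hs_hat_norm :: "real \<Rightarrow> (real \<Rightarrow> complex) \<Rightarrow> real" where
  "Hs_hat_norm s g = sqrt (1 / (2 * pi) * (LINT \<zeta>|lborel. jbr \<zeta> powr (2 * s) * (cmod (g \<zeta>))\<^sup>2))"

definition L2_Hs :: "real \<Rightarrow> (real \<Rightarrow> complex) set" where
  "L2_Hs s = {f \<in> L2. \<exists>g. plancherel_transform f g \<and> g \<in> Hs_hat s}"

section \<open>The equation and its solutions\<close>

definition localized_potential :: "(real \<Rightarrow> real) \<Rightarrow> bool" where
  "localized_potential W \<longleftrightarrow> smooth W \<and>
     (\<exists>p>2. \<exists>K :: nat \<Rightarrow> real. \<forall>j. K j > 0 \<and>
        (\<forall>x. \<bar>(deriv ^^ j) W x\<bar> \<le> K j * jbr x powr (- p - real j)))"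

definition cubic :: "(real \<Rightarrow> complex) \<Rightarrow> real \<Rightarrow> complex" where
  "cubic f y = complex_of_real ((cmod (f y))\<^sup>2) * f y"

definition nonlinearity ::
    "real \<Rightarrow> real \<Rightarrow> (real \<Rightarrow> real) \<Rightarrow> (real \<Rightarrow> real \<Rightarrow> complex) \<Rightarrow> real \<Rightarrow> real \<Rightarrow> complex" where
  "nonlinearity \<beta> \<gamma> W u t y =
     complex_of_real \<beta> * cubic (u t) y
     - complex_of_real (W (y + \<gamma> * t) * (cmod (u t y)) ^ 4) * u t y"

definition continuous_in_Sigma :: "(real \<Rightarrow> real \<Rightarrow> complex) \<Rightarrow> bool" where
  "continuous_in_Sigma u \<longleftrightarrow> (\<forall>t\<ge>1. u t \<in> Sigma_space \<and>
     ((\<lambda>s. Sigma_norm (\<lambda>y. u s y - u t y)) \<longlongrightarrow> 0) (at t within {1..}))"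

text \<open>
  \<open>C\<^sup>1\<close> in time with values in \<open>H\<^sup>-\<^sup>1\<close>, where \<open>H\<^sup>-\<^sup>1\<close> is identified isometrically with
  \<open>Hs_hat (-1)\<close> by the Fourier transform; \<open>w t\<close> is the Fourier transform of the time derivative.
\<close>

definition C1_in_Hminus1 :: "(real \<Rightarrow> real \<Rightarrow> complex) \<Rightarrow> bool" where
  "C1_in_Hminus1 u \<longleftrightarrow> (\<exists>w. \<forall>t\<ge>1. fourier (u t) \<in> Hs_hat (-1) \<and> w t \<in> Hs_hat (-1) \<and>
     ((\<lambda>s. Hs_hat_norm (-1) (\<lambda>\<zeta>.
        (fourier (u s) \<zeta> - fourier (u t) \<zeta>) / complex_of_real (s - t) - w t \<zeta>)) \<longlongrightarrow> 0)
       (at t within {1..}) \<and>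
     ((\<lambda>s. Hs_hat_norm (-1) (\<lambda>\<zeta>. w s \<zeta> - w t \<zeta>)) \<longlongrightarrow> 0) (at t within {1..}))"

text \<open>
  The Duhamel formula
  \[ u(t) = e^{i(t-1)\partial_y^2} u(1)
       - i \int_1^t e^{i(t-s)\partial_y^2} \bigl(\beta |u|^2 u - W(\cdot+\gamma s) |u|^4 u\bigr)(s)\, ds. \]
  The free propagator is by definition the Fourier multiplier with symbol
  \<open>cis (- (t * \<zeta>\<^sup>2))\<close>, and the Duhamel integral is an \<open>L\<^sup>2\<close>-valued one; the formula is
  written after applying the Fourier transform, where this integral can be taken
  pointwise in the frequency.
\<close>

definition mild_solution ::
    "real \<Rightarrow> real \<Rightarrow> (real \<Rightarrow> real) \<Rightarrow> (real \<Rightarrow> real \<Rightarrow> complex) \<Rightarrow> bool" where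
  "mild_solution \<beta> \<gamma> W u \<longleftrightarrow> (\<forall>t\<ge>1. \<forall>\<zeta>.
     fourier (u t) \<zeta> = cis (- ((t - 1) * \<zeta>\<^sup>2)) * fourier (u 1) \<zeta>
       - \<i> * (LINT s:{1..t}|lborel.
                cis (- ((t - s) * \<zeta>\<^sup>2)) * fourier (nonlinearity \<beta> \<gamma> W u s) \<zeta>))"

definition global_solution ::
    "real \<Rightarrow> real \<Rightarrow> (real \<Rightarrow> real) \<Rightarrow> (real \<Rightarrow> real \<Rightarrow> complex) \<Rightarrow> bool" where
  "global_solution \<beta> \<gamma> W u \<longleftrightarrow>
     continuous_in_Sigma u \<and> C1_in_Hminus1 u \<and> mild_solution \<beta> \<gamma> W u"

section \<open>Small-data theory and the modified scattering profile\<close>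

definition galilean :: "real \<Rightarrow> (real \<Rightarrow> complex) \<Rightarrow> real \<Rightarrow> complex" where
  "galilean t f y = complex_of_real y * f y + 2 * \<i> * complex_of_real t * weak_deriv f y"

definition solution_bounds ::
    "real \<Rightarrow> real \<Rightarrow> real \<Rightarrow> (real \<Rightarrow> real \<Rightarrow> complex) \<Rightarrow> bool" where
  "solution_bounds C \<delta> \<epsilon> u \<longleftrightarrow> (\<forall>t\<ge>1.
     u t \<in> Linf \<and> Linf_norm (u t) \<le> C * \<epsilon> * t powr (- 1/2) \<and>
     u t \<in> H1 \<and> galilean t (u t) \<in> L2 \<and>
     H1_norm (u t) + L2_norm (galilean t (u t)) \<le> C * \<epsilon> * t powr \<delta>)"

definition modified_free_wave ::
    "real \<Rightarrow> (real \<Rightarrow> complex) \<Rightarrow> real \<Rightarrow> real \<Rightarrow> complex" where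
  "modified_free_wave \<beta> A t y =
     complex_of_real (t powr (- 1/2)) * cis (y\<^sup>2 / (4 * t)) * A (y / t)
       * cis (- (\<beta> * (cmod (A (y / t)))\<^sup>2 * ln t))"

definition modified_scattering_profile ::
    "real \<Rightarrow> real \<Rightarrow> real \<Rightarrow> real \<Rightarrow> (real \<Rightarrow> real \<Rightarrow> complex) \<Rightarrow> (real \<Rightarrow> complex) \<Rightarrow> bool" where
  "modified_scattering_profile \<beta> C \<delta> \<epsilon> u A \<longleftrightarrow>
     A \<in> L2 \<inter> Linf \<and> L2_norm A + Linf_norm A \<le> C * \<epsilon> \<and>
     (\<forall>t\<ge>1. (\<lambda>y. u t y - modified_free_wave \<beta> A t y) \<in> L2 \<inter> Linf \<and>
        L2_norm (\<lambda>y. u t y - modified_free_wave \<beta> A t y) \<le> C * \<epsilon> * t powr (- 1/2 + 2 * \<delta>) \<and>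
        Linf_norm (\<lambda>y. u t y - modified_free_wave \<beta> A t y) \<le> C * \<epsilon> * t powr (- 3/4 + 2 * \<delta>))"

text \<open>
  \<open>\<epsilon>0\<close> is a smallness threshold, and \<open>C\<delta>\<close>, \<open>C\<close> are constants, for which the small-data
  theory of the equation holds; none of them depends on the velocity \<open>\<gamma>\<close>.
  Uniqueness is up to equality almost everywhere.
\<close>

definition small_data_theory ::
    "real \<Rightarrow> (real \<Rightarrow> real) \<Rightarrow> real \<Rightarrow> real \<Rightarrow> real \<Rightarrow> bool" where
  "small_data_theory \<beta> W \<epsilon>0 C\<delta> C \<longleftrightarrow>
     0 < \<epsilon>0 \<and> 0 < C\<delta> \<and> 0 < C \<and> C\<delta> * \<bar>\<beta>\<bar> * \<epsilon>0\<^sup>2 < 1/16 \<and>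
     (\<forall>\<gamma> \<epsilon> u1. 0 < \<epsilon> \<and> \<epsilon> \<le> \<epsilon>0 \<and> u1 \<in> Sigma_space \<and> Sigma_norm u1 \<le> \<epsilon> \<longrightarrow>
       (let \<delta> = C\<delta> * \<bar>\<beta>\<bar> * \<epsilon>\<^sup>2;
            solves = (\<lambda>u. global_solution \<beta> \<gamma> W u \<and> (AE y in lborel. u 1 y = u1 y));
            profile = modified_scattering_profile \<beta> C \<delta> \<epsilon>
        in (\<exists>u. solves u) \<and>
           (\<forall>u v. solves u \<and> solves v \<longrightarrow> (\<forall>t\<ge>1. AE y in lborel. u t y = v t y)) \<and>
           (\<forall>u. solves u \<longrightarrow>
              solution_bounds C \<delta> \<epsilon> u \<and>
              (\<exists>A. profile u A \<and> continuous_on UNIV A) \<and>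
              (\<forall>A B. profile u A \<and> profile u B \<longrightarrow> (AE x in lborel. A x = B x)) \<and>
              (\<forall>A s. profile u A \<and> s < 1 - 2 * \<delta> \<longrightarrow> A \<in> L2_Hs s))))"

section \<open>Cubic-renormalized profile\<close>

definition cubic_profile ::
    "real \<Rightarrow> (real \<Rightarrow> real \<Rightarrow> complex) \<Rightarrow> real \<Rightarrow> real \<Rightarrow> complex" where
  "cubic_profile \<beta> u t \<zeta> = cis (t * \<zeta>\<^sup>2) * fourier (u t) \<zeta>
     + \<i> * complex_of_real \<beta> *
         (LINT s:{1..t}|lborel. cis (s * \<zeta>\<^sup>2) * fourier (cubic (u s)) \<zeta>)"

definition cubic_profile_limit ::
    "real \<Rightarrow> (real \<Rightarrow> real \<Rightarrow> complex) \<Rightarrow> (real \<Rightarrow> complex) \<Rightarrow> bool" where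
  "cubic_profile_limit \<beta> u P \<longleftrightarrow> P \<in> L2 \<inter> C0 \<and>
     (\<forall>t\<ge>1. (\<lambda>\<zeta>. cubic_profile \<beta> u t \<zeta> - P \<zeta>) \<in> L2) \<and>
     ((\<lambda>t. L2_norm (\<lambda>\<zeta>. cubic_profile \<beta> u t \<zeta> - P \<zeta>)) \<longlongrightarrow> 0) at_top \<and>
     uniform_limit UNIV (cubic_profile \<beta> u) P at_top"

section \<open>Regularity of the limiting tail\<close>

definition nderiv :: "nat \<Rightarrow> (real \<Rightarrow> complex) \<Rightarrow> real \<Rightarrow> complex" where
  "nderiv n f = ((\<lambda>g x. vector_derivative g (at x)) ^^ n) f"

definition C21_loc :: "(real \<Rightarrow> complex) set" where
  "C21_loc = {f. (\<forall>x. f differentiable (at x)) \<and> (\<forall>x. nderiv 1 f differentiable (at x)) \<and>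
     (\<forall>K. compact K \<longrightarrow> (\<exists>L. L-lipschitz_on K (nderiv 2 f)))}"

text \<open>The third derivative exists and is continuous off the origin, but has no limit there.\<close>

definition third_deriv_not_extendable_at_0 :: "(real \<Rightarrow> complex) \<Rightarrow> bool" where
  "third_deriv_not_extendable_at_0 f \<longleftrightarrow>
     (\<forall>x. x \<noteq> 0 \<longrightarrow> nderiv 2 f differentiable (at x)) \<and>
     continuous_on (- {0}) (nderiv 3 f) \<and>
     \<not> (\<exists>l. (nderiv 3 f \<longlongrightarrow> l) (at 0))"

end

theory Submission
  imports Defs "HOL-Complex_Analysis.Complex_Analysis" "HOL-Probability.Characteristic_Functions"
    "HOL-Real_Asymp.Real_Asymp"
begin

text \<open>
  The cubic term drops out of the renormalized profile. Inserting the Duhamel formula into its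
  definition leaves \<open>P_u(t) = const + i \<integral>\<^sub>1\<^sup>t Q(s) ds\<close> with
  \<open>Q(s, \<zeta>) = cis (s \<zeta>\<^sup>2) F[W(\<cdot> + \<gamma> s) |u|\<^sup>4 u](\<zeta>)\<close> (lemma \<open>cubic_profile_duhamel\<close>), and
  \<open>Q(s) = O(s\<^sup>-\<^sup>5\<^sup>/\<^sup>2)\<close>, so the tail is \<open>i \<integral>\<^sub>T\<^sup>\<infinity> Q(s) ds\<close> (lemma \<open>cubic_profile_tail\<close>).

  The potential lives near \<open>y = - \<gamma> s\<close>, where the modified free wave is a plane wave with
  amplitude \<open>s\<^sup>-\<^sup>1\<^sup>/\<^sup>2 A\<^sub>0\<close> and frequency \<open>\<zeta>\<^sub>0 = - \<gamma> / 2\<close>. After the shift \<open>y = x - \<gamma> s\<close> the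
  quadratic phases complete to a square, and only the integral \<open>M\<^sub>0\<close> of the potential and the
  value \<open>A\<^sub>0\<close> survive:
  \[ Q(s, \<zeta>) \approx s^{-5/2} e^{i s (\<zeta> - \<zeta>_0)^2} M_0 |A_0|^4 A_0 e^{- i \<alpha> \log s}. \]
  Lemma \<open>source_asymptotics\<close> gives this with relative error \<open>|\<zeta> - \<zeta>\<^sub>0| + s\<^sup>-\<^sup>1\<^sup>/\<^sup>8\<close>. Freezing \<open>A\<close> at
  \<open>- \<gamma>\<close> inside the logarithmically growing phase requires a modulus of continuity that
  beats \<open>log s\<close>; it comes from \<open>A \<in> H\<^sup>7\<^sup>/\<^sup>8\<close>, which embeds into the Hoelder functions
  (lemma \<open>Sobolev_Hoelder\<close>). The substitution \<open>s = T \<tau>\<close>, \<open>\<zeta> = \<zeta>\<^sub>0 + \<eta> / \<surd>T\<close> then turns the tail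
  into \<open>T\<^sup>-\<^sup>3\<^sup>/\<^sup>2 cis (- \<alpha> log T) \<Phi>(\<eta>)\<close> up to a relative error \<open>T\<^sup>-\<^sup>1\<^sup>/\<^sup>8\<close>, locally uniformly
  in \<open>\<eta>\<close>, where
  \[ \<Phi>(\<eta>) = i M_0 |A_0|^4 A_0 \int_1^\infty \<tau>^{-5/2 - i \<alpha>} e^{i \<eta>^2 \<tau>} d\<tau>. \]

  The integral is an incomplete Gamma function on the imaginary axis. With \<open>k = 3/2 + i \<alpha>\<close> it
  equals a multiple of \<open>\<Gamma>(2 - k) z\<^sup>k\<close> plus an entire function of \<open>z = - i \<eta>\<^sup>2\<close>
  (lemma \<open>tail_laplace_expansion\<close>). Hence \<open>\<Phi>(\<eta>) = c |\<eta>|\<^sup>3\<^sup>+\<^sup>2\<^sup>i\<^sup>\<alpha> + F(\<eta>)\<close> with \<open>F\<close> entire, and \<open>c \<noteq> 0\<close>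
  because the Gamma function has no zeros. The first two derivatives of \<open>|\<eta>|\<^sup>3\<^sup>+\<^sup>2\<^sup>i\<^sup>\<alpha>\<close> are locally Lipschitz,
  while the third is a nonzero multiple of \<open>sgn \<eta> |\<eta>|\<^sup>2\<^sup>i\<^sup>\<alpha>\<close>: it is odd and has constant modulus,
  so it has no limit at the origin (lemma \<open>abs_powr_plus_entire_regularity\<close>).
\<close>

section \<open>Laplace transforms and the Gamma function\<close>

text \<open>
  The second order Taylor remainder of \<open>exp (- h t)\<close> is at most \<open>|h|\<^sup>2 t\<^sup>2 exp (|h| t)\<close>. For small \<open>h\<close>
  the last two factors cost only a small part of the decay that is still available to the
  right of the abscissa \<open>a\<close>, so the difference quotient converges with an error \<open>O(|h|)\<close>.
\<close>

lemma laplace_transform_holomorphic: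
  fixes w :: "real \<Rightarrow> complex" and a :: real
  assumes meas: "w \<in> borel_measurable lborel"
    and supp: "\<And>t. t < 0 \<Longrightarrow> w t = 0"
    and int: "\<And>x. a < x \<Longrightarrow> integrable lborel (\<lambda>t. norm (w t) * exp (- (x * t)))"
  shows "(\<lambda>z. LINT t|lborel. w t * exp (- (z * of_real t))) holomorphic_on {z. a < Re z}"
proof -
  have ex: "\<exists>D. ((\<lambda>z. LINT t|lborel. w t * exp (- (z * of_real t))) has_field_derivative D) (at z)"
    if z: "a < Re z" for z
  proof -
    \<comment> \<open>One third of the room goes to \<open>t\<^sup>2\<close>, one to \<open>exp (|h| t)\<close>, one keeps \<open>x0\<close> above \<open>a\<close>.\<close>
    define r where "r = (Re z - a) / 3"
    have r: "r > 0" using z by (simp add: r_def)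
    define x0 where "x0 = Re z - 2 * r"
    have x0: "a < x0" using z unfolding x0_def r_def by (simp add: field_simps)
    define G where "G t = norm (w t) * exp (- (x0 * t))" for t
    have intG: "integrable lborel G" unfolding G_def by (rule int[OF x0])
    have sq: "t\<^sup>2 \<le> 2 / r\<^sup>2 * exp (r * t)" if "t \<ge> 0" for t
    proof -
      have "1 + r*t + (r*t)\<^sup>2/2 \<le> exp (r*t)"
        by (rule exp_lower_Taylor_quadratic) (use that r in auto)
      moreover have "0 \<le> r * t" using that r by simp
      ultimately have "(r*t)\<^sup>2/2 \<le> exp (r*t)" by linarith
      then show ?thesis using r by (simp add: field_simps power_mult_distrib)
    qed
    have lin: "t \<le> (1/r) * exp (r*t)" if "t \<ge> 0" for t
    proof -
      have "1 + r*t \<le> exp (r*t)" by (rule exp_ge_add_one_self)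
      then have "r * t \<le> exp (r*t)" by linarith
      then show ?thesis using r by (simp add: field_simps)
    qed
    have nexp: "norm (exp (- (v * of_real t))) = exp (- (Re v * t))" for v :: complex and t
      by (simp add: norm_exp_eq_Re)
    have intz: "integrable lborel (\<lambda>t. w t * exp (- (v * of_real t)))" if "a < Re v" for v
      by (rule Bochner_Integration.integrable_bound[OF int[OF that]])
         (use meas in \<open>auto simp: norm_mult nexp\<close>)
    have int1: "integrable lborel (\<lambda>t. - (of_real t * w t * exp (- (z * of_real t))))"
    proof (rule Bochner_Integration.integrable_bound[OF integrable_mult_right[OF intG, of "1/r"]])
      show "(\<lambda>t. - (of_real t * w t * exp (- (z * of_real t)))) \<in> borel_measurable lborel"
        using meas by measurable
      show "AE t in lborel. norm (- (of_real t * w t * exp (- (z * of_real t)))) \<le> norm (1/r * G t)"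
      proof (rule AE_I2)
        fix t
        show "norm (- (of_real t * w t * exp (- (z * of_real t)))) \<le> norm (1/r * G t)"
        proof (cases "t < 0")
          case False
          have "\<bar>t\<bar> * exp (- (Re z * t)) \<le> (1/r) * exp (r*t) * exp (- (Re z * t))"
            using lin[of t] False by (intro mult_right_mono) auto
          also have "\<dots> \<le> (1/r) * (exp (2*r*t) * exp (- (Re z * t)))"
            using r False by (simp add: divide_right_mono mult_right_mono)
          also have "exp (2*r*t) * exp (- (Re z * t)) = exp (- (x0 * t))"
            by (simp add: x0_def mult_exp_exp algebra_simps)
          finally have *: "\<bar>t\<bar> * exp (- (Re z * t)) \<le> (1/r) * exp (- (x0 * t))" .
          have "norm (w t) * (\<bar>t\<bar> * exp (- (Re z * t))) \<le> norm (w t) * ((1/r) * exp (- (x0 * t)))"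
            by (rule mult_left_mono[OF *]) simp
          then show ?thesis using r unfolding G_def
            by (simp add: norm_mult nexp abs_mult field_simps)
        qed (simp add: supp)
      qed
    qed
    define D where "D = (LINT t|lborel. - (of_real t * w t * exp (- (z * of_real t))))"
    define J where "J v = (LINT t|lborel. w t * exp (- (v * of_real t)))" for v
    define C where "C = (LINT t|lborel. 2 / r\<^sup>2 * G t)"
    have bound: "norm (J (z + h) - J z - h * D) \<le> (norm h)\<^sup>2 * C" if h: "norm h < r" for h
    proof -
      have "Re h > - r" using h abs_Re_le_cmod[of h] by linarith
      then have zh: "a < Re (z + h)" using z r unfolding r_def by (simp add: field_simps)
      have "J (z + h) - J z - h * D =
        (LINT t|lborel. w t * exp (- ((z + h) * of_real t)) - w t * exp (- (z * of_real t))
           - h * (- (of_real t * w t * exp (- (z * of_real t)))))"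
        unfolding J_def D_def using intz[OF zh] intz[OF z] int1 by simp
      also have "norm \<dots> \<le> (LINT t|lborel. (norm h)\<^sup>2 * (2 / r\<^sup>2 * G t))"
      proof (rule Bochner_Integration.integral_norm_bound_integral)
        show "integrable lborel (\<lambda>t. w t * exp (- ((z + h) * of_real t)) - w t * exp (- (z * of_real t))
           - h * (- (of_real t * w t * exp (- (z * of_real t)))))"
          by (intro Bochner_Integration.integrable_diff integrable_mult_right intz zh z int1)
        show "integrable lborel (\<lambda>t. (norm h)\<^sup>2 * (2 / r\<^sup>2 * G t))"
          by (intro integrable_mult_right intG)
        fix t :: real
        show "norm (w t * exp (- ((z + h) * of_real t)) - w t * exp (- (z * of_real t))
           - h * (- (of_real t * w t * exp (- (z * of_real t))))) \<le> (norm h)\<^sup>2 * (2 / r\<^sup>2 * G t)"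
        proof (cases "t < 0")
          case False
          then have t: "t \<ge> 0" by simp
          let ?x = "- (h * of_real t)"
          have eq: "w t * exp (- ((z + h) * of_real t)) - w t * exp (- (z * of_real t))
             - h * (- (of_real t * w t * exp (- (z * of_real t))))
             = w t * exp (- (z * of_real t)) * (exp ?x - (1 + ?x))"
          proof -
            have "exp (- ((z + h) * of_real t)) = exp (- (z * of_real t)) * exp ?x"
              unfolding exp_add[symmetric] by (simp add: algebra_simps)
            then show ?thesis by (simp only:) (simp add: algebra_simps)
          qed
          have "norm (exp ?x - (\<Sum>k\<le>1. ?x ^ k / fact k)) \<le> exp \<bar>Re ?x\<bar> * norm ?x ^ Suc 1 / fact 1"
            by (rule Taylor_exp)
          then have T: "norm (exp ?x - (1 + ?x)) \<le> exp \<bar>Re ?x\<bar> * (norm h * t)\<^sup>2"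
            using t by (simp add: norm_mult power2_eq_square)
          have "\<bar>Re ?x\<bar> \<le> r * t"
            using abs_Re_le_cmod[of h] h t by (simp add: abs_mult mult_right_mono)
          then have "exp \<bar>Re ?x\<bar> * (norm h * t)\<^sup>2 \<le> exp (r*t) * (norm h * t)\<^sup>2"
            by (intro mult_right_mono) auto
          also have "\<dots> = (norm h)\<^sup>2 * (exp (r*t) * t\<^sup>2)" by (simp add: power_mult_distrib)
          also have "\<dots> \<le> (norm h)\<^sup>2 * (exp (r*t) * (2 / r\<^sup>2 * exp (r * t)))"
            by (intro mult_left_mono sq t) auto
          finally have T2: "norm (exp ?x - (1 + ?x)) \<le> (norm h)\<^sup>2 * (2 / r\<^sup>2 * exp (2*r*t))"
            using T by (simp add: mult_exp_exp algebra_simps)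
          have "norm (w t * exp (- (z * of_real t)) * (exp ?x - (1 + ?x)))
             \<le> norm (w t) * exp (- (Re z * t)) * ((norm h)\<^sup>2 * (2 / r\<^sup>2 * exp (2*r*t)))"
            unfolding norm_mult nexp by (intro mult_left_mono T2) auto
          also have "\<dots> = (norm h)\<^sup>2 * (2 / r\<^sup>2 * (norm (w t) * (exp (- (Re z * t)) * exp (2*r*t))))"
            by simp
          also have "exp (- (Re z * t)) * exp (2*r*t) = exp (- (x0 * t))"
            by (simp add: x0_def mult_exp_exp algebra_simps)
          finally show ?thesis unfolding eq G_def .
        qed (simp add: supp G_def)
      qed
      also have "\<dots> = (norm h)\<^sup>2 * C" unfolding C_def by simp
      finally show ?thesis .
    qed
    have "(J has_field_derivative D) (at z)"
      unfolding DERIV_def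
    proof (rule LIM_zero_cancel, rule Lim_null_comparison)
      show "\<forall>\<^sub>F h in at 0. norm ((J (z + h) - J z) / h - D) \<le> norm h * C"
        unfolding eventually_at
      proof (intro exI[of _ r] conjI r ballI impI)
        fix h :: complex assume h: "h \<noteq> 0 \<and> dist h 0 < r"
        have "(J (z + h) - J z) / h - D = (J (z + h) - J z - h * D) / h"
          using h by (simp add: field_simps)
        then have "norm ((J (z + h) - J z) / h - D) = norm (J (z + h) - J z - h * D) / norm h"
          by (simp add: norm_divide)
        also have "\<dots> \<le> (norm h)\<^sup>2 * C / norm h"
          using bound[of h] h by (intro divide_right_mono) auto
        finally show "norm ((J (z + h) - J z) / h - D) \<le> norm h * C"
          using h by (simp add: power2_eq_square)
      qed
      show "((\<lambda>h. norm h * C) \<longlongrightarrow> 0) (at (0::complex))"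
        by (intro tendsto_mult_left_zero tendsto_norm_zero tendsto_ident_at)
    qed
    then show ?thesis unfolding J_def by blast
  qed
  show ?thesis
  proof (rule holomorphic_onI)
    fix z assume "z \<in> {z. a < Re z}"
    then have "a < Re z" by simp
    from ex[OF this] show "(\<lambda>z. LINT t|lborel. w t * exp (- (z * of_real t))) field_differentiable (at z within {z. a < Re z})"
      unfolding field_differentiable_def using has_field_derivative_at_within by blast
  qed
qed

text \<open>
  Cut off at the origin, so that Mellin transforms become integrals over the whole line to
  which the Laplace transform lemma applies.
\<close>

definition mellin_weight :: "complex \<Rightarrow> real \<Rightarrow> complex" where
  "mellin_weight s t = (if 0 < t then of_real t powr (s - 1) else 0)"

lemma mellin_weight_measurable [measurable]: "mellin_weight s \<in> borel_measurable borel"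
  unfolding mellin_weight_def by measurable

lemma norm_mellin_weight: "norm (mellin_weight s t) = (if 0 < t then t powr (Re s - 1) else 0)"
  by (simp add: mellin_weight_def norm_powr_real_powr)

lemma integrable_mellin_weight_exp:
  assumes "0 < Re s" "0 < x"
  shows "integrable lborel (\<lambda>t. norm (mellin_weight s t) * exp (- (x * t)))"
proof -
  have "(\<lambda>t. complex_of_real t powr (s - 1) / of_real (exp (x * t))) absolutely_integrable_on {0<..}"
    by (rule absolutely_integrable_Gamma_integral) fact+
  then have "integrable lebesgue (\<lambda>t. norm (indicator {0<..} t *\<^sub>R (complex_of_real t powr (s - 1) / of_real (exp (x * t)))))"
    unfolding set_integrable_def by (rule integrable_norm)
  also have "(\<lambda>t. norm (indicator {0<..} t *\<^sub>R (complex_of_real t powr (s - 1) / of_real (exp (x * t)))))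
    = (\<lambda>t. norm (mellin_weight s t) * exp (- (x * t)))"
    by (auto simp: fun_eq_iff indicator_def mellin_weight_def norm_divide exp_minus divide_inverse norm_mult norm_inverse)
  finally show ?thesis by (subst (asm) integrable_completion) auto
qed

lemma integral_mellin_weight_exp_1:
  assumes "0 < Re s"
  shows "(LINT t|lborel. mellin_weight s t * exp (- complex_of_real t)) = Gamma s"
proof -
  let ?f = "\<lambda>t. mellin_weight s t * exp (- complex_of_real t)"
  have "integrable lborel ?f"
    by (rule Bochner_Integration.integrable_bound[OF integrable_mellin_weight_exp[OF assms, of 1]])
       (auto simp: norm_mult)
  then have "(?f has_integral (LINT t|lborel. ?f t)) UNIV"
    using has_integral_integral_lborel by fastforce
  moreover have "(?f has_integral Gamma s) UNIV"
  proof -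
    have "((\<lambda>t. complex_of_real t powr (s - 1) / of_real (exp t)) has_integral Gamma s) {0<..}"
      by (rule Gamma_integral_complex') fact
    then have "((\<lambda>t. if t \<in> {0<..} then complex_of_real t powr (s - 1) / of_real (exp t) else 0) has_integral Gamma s) UNIV"
      by (simp only: has_integral_restrict_UNIV)
    also have "(\<lambda>t. if t \<in> {0<..} then complex_of_real t powr (s - 1) / of_real (exp t) else 0) = ?f"
      by (auto simp: fun_eq_iff mellin_weight_def exp_minus divide_inverse exp_of_real)
    finally show ?thesis .
  qed
  ultimately show ?thesis by (rule has_integral_unique)
qed

lemma integral_mellin_weight_exp_real:
  assumes "0 < Re s" "0 < x"
  shows "(LINT t|lborel. mellin_weight s t * exp (- (complex_of_real x * of_real t)))
     = Gamma s * of_real x powr (- s)"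
proof -
  have w: "mellin_weight s t = of_real x powr (1 - s) * mellin_weight s (x * t)" for t
  proof (cases "0 < t")
    case True
    have "of_real (x * t) powr (s - 1) = of_real x powr (s - 1) * complex_of_real t powr (s - 1)"
      using True assms by (simp add: powr_times_real)
    moreover have "complex_of_real x powr (1 - s) * of_real x powr (s - 1) = 1"
      using assms by (simp flip: powr_add)
    ultimately show ?thesis
      using True assms by (simp add: mellin_weight_def)
  next
    case False
    then show ?thesis using assms by (simp add: mellin_weight_def zero_less_mult_iff)
  qed
  have "(\<lambda>t. mellin_weight s t * exp (- (complex_of_real x * of_real t)))
     = (\<lambda>t. of_real x powr (1 - s) * (mellin_weight s (0 + x * t) * exp (- complex_of_real (0 + x * t))))"
    by (rule ext, subst w) simp
  then have "(LINT t|lborel. mellin_weight s t * exp (- (complex_of_real x * of_real t)))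
     = of_real x powr (1 - s) * (LINT t|lborel. mellin_weight s (0 + x * t) * exp (- complex_of_real (0 + x * t)))"
    by (simp only: integral_mult_right_zero)
  also have "(LINT t|lborel. mellin_weight s (0 + x * t) * exp (- complex_of_real (0 + x * t)))
     = Gamma s /\<^sub>R x"
    using lborel_integral_real_affine[of x "\<lambda>t. mellin_weight s t * exp (- complex_of_real t)" 0] assms(2)
    unfolding integral_mellin_weight_exp_1[OF assms(1)] by (simp only: scaleR_scaleR) simp
  also have "of_real x powr (1 - s) * (Gamma s /\<^sub>R x) = Gamma s * of_real x powr (- s)"
  proof -
    have "complex_of_real x powr (1 - s) = of_real x * of_real x powr (- s)"
      using assms powr_add[of "complex_of_real x" 1 "- s"] by simp
    then show ?thesis using assms by (simp add: scaleR_conv_of_real)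
  qed
  finally show ?thesis .
qed

text \<open>
  For real \<open>z > 0\<close> this is Euler's integral after scaling. Both sides are holomorphic in the
  right half plane, so analytic continuation replaces a rotation of the contour.
\<close>

lemma integral_mellin_weight_exp:
  assumes s: "0 < Re s" and z: "0 < Re z"
  shows "(LINT t|lborel. mellin_weight s t * exp (- (z * of_real t))) = Gamma s * z powr (- s)"
proof -
  let ?S = "{z. 0 < Re z}"
  define f where "f z = (LINT t|lborel. mellin_weight s t * exp (- (z * of_real t))) - Gamma s * z powr (- s)" for z
  have "f holomorphic_on ?S"
    unfolding f_def
    by (intro holomorphic_intros laplace_transform_holomorphic integrable_mellin_weight_exp)
       (use s in \<open>auto simp: mellin_weight_def complex_nonpos_Reals_iff\<close>)
  moreover have "open ?S" by (rule open_halfspace_Re_gt)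
  moreover have "connected ?S" by (intro convex_connected convex_halfspace_Re_gt)
  moreover have "1 islimpt (complex_of_real ` {0<..})"
  proof -
    have "(1::real) islimpt {0<..}" by (rule open_imp_islimpt) auto
    then show ?thesis
      using islimpt_isCont_image[of "1::real" "{0<..}" complex_of_real]
      by (auto simp: eventually_at_filter)
  qed
  moreover have "f z = 0" if "z \<in> complex_of_real ` {0<..}" for z
    using that integral_mellin_weight_exp_real[OF s] unfolding f_def by auto
  ultimately have "f z = 0"
    by (intro analytic_continuation[of f ?S "complex_of_real ` {0<..}" 1 z]) (use z in auto)
  then show ?thesis by (simp add: f_def)
qed

section \<open>Expansion of the incomplete Gamma integral\<close>

lemma powr_tail_integral:
  fixes a q :: real
  assumes "1 < q" "0 < a"
  shows set_integrable_powr_tail: "set_integrable lborel {a<..} (\<lambda>t. t powr (- q))"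
    and set_integral_powr_tail: "(LINT t:{a<..}|lborel. t powr (- q)) = a powr (1 - q) / (q - 1)"
proof -
  have hi: "((\<lambda>t. t powr (- q)) has_integral (a powr (1 - q) / (q - 1))) {a..}"
    using has_integral_powr_to_inf[of "- q" a] assms by (simp add: field_simps minus_divide_right)
  have hi': "((\<lambda>t. t powr (- q)) has_integral (a powr (1 - q) / (q - 1))) {a<..}"
  proof -
    have "negligible {x \<in> {a..} - {a<..}. x powr (- q) \<noteq> 0}"
         "negligible {x \<in> {a<..} - {a..}. x powr (- q) \<noteq> 0}"
      by (rule negligible_subset[of "{a}"], auto)+
    from has_integral_spike_set_eq[OF this] hi show ?thesis by blast
  qed
  then have "(\<lambda>t. t powr (- q)) absolutely_integrable_on {a<..}"
    by (intro nonnegative_absolutely_integrable_1) auto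
  then show si: "set_integrable lborel {a<..} (\<lambda>t. t powr (- q))"
    unfolding set_integrable_def by (subst (asm) integrable_completion) auto
  show "(LINT t:{a<..}|lborel. t powr (- q)) = a powr (1 - q) / (q - 1)"
    using set_borel_integral_eq_integral(2)[OF si] hi' by (simp add: integral_unique)
qed

text \<open>
  This is \<open>z\<^sup>p\<^sup>-\<^sup>1 \<Gamma>(1 - p, z)\<close> for the upper incomplete Gamma function. It converges for
  \<open>Re z > 0\<close>, and on the closed half plane if \<open>Re p > 1\<close>; the tail profile is the latter case
  with \<open>z\<close> imaginary.
\<close>

definition tail_laplace :: "complex \<Rightarrow> complex \<Rightarrow> complex" where
  "tail_laplace p z = (LINT t:{1<..}|lborel. of_real t powr (- p) * exp (- (z * of_real t)))"

lemma norm_tail_laplace_integrand: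
  assumes "0 < t"
  shows "norm (of_real t powr (- p) * exp (- (z * of_real t))) = t powr (- Re p) * exp (- (Re z * t))"
  using assms by (simp add: norm_mult norm_powr_real_powr)

lemma tail_laplace_integrable:
  assumes "0 < Re z"
  shows "set_integrable lborel {1<..} (\<lambda>t. of_real t powr (- p) * exp (- (z * of_real t)))"
  unfolding set_integrable_def
proof (rule Bochner_Integration.integrable_bound)
  show "integrable lborel (\<lambda>t. norm (mellin_weight (of_real (1 + \<bar>Re p\<bar>)) t) * exp (- (Re z * t)))"
    by (rule integrable_mellin_weight_exp) (use assms in auto)
  show "AE t in lborel. norm (indicat_real {1<..} t *\<^sub>R (of_real t powr (- p) * exp (- (z * of_real t))))
    \<le> norm (norm (mellin_weight (of_real (1 + \<bar>Re p\<bar>)) t) * exp (- (Re z * t)))"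
  proof (rule AE_I2)
    fix t :: real
    show "norm (indicat_real {1<..} t *\<^sub>R (of_real t powr (- p) * exp (- (z * of_real t))))
    \<le> norm (norm (mellin_weight (of_real (1 + \<bar>Re p\<bar>)) t) * exp (- (Re z * t)))"
    proof (cases "1 < t")
      case True
      then have "t powr (- Re p) \<le> t powr \<bar>Re p\<bar>" by (intro powr_mono) auto
      then have "t powr (- Re p) * exp (- (Re z * t)) \<le> t powr \<bar>Re p\<bar> * exp (- (Re z * t))"
        by (intro mult_right_mono) auto
      then show ?thesis
        using True norm_tail_laplace_integrand[of t p z] by (simp add: norm_mellin_weight)
    qed simp
  qed
qed simp

text \<open>
  Lowering \<open>p\<close> until \<open>Re p < 1\<close> makes the integrand integrable at the origin as well, where it
  can be compared with the complete Gamma integral.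
\<close>

lemma tail_laplace_by_parts:
  assumes z: "0 < Re z"
  shows "(p - 1) * tail_laplace p z = exp (- z) - z * tail_laplace (p - 1) z"
proof -
  define F where "F t = of_real t powr (1 - p) * exp (- (z * of_real t))" for t :: real
  define f where "f t = (1 - p) * (of_real t powr (- p) * exp (- (z * of_real t)))
      - z * (of_real t powr (- (p - 1)) * exp (- (z * of_real t)))" for t :: real
  have si: "set_integrable lborel {1<..} f"
    unfolding f_def
    by (intro set_integral_diff set_integrable_mult_right tail_laplace_integrable z)
  have ei: "einterval 1 \<infinity> = {1<..}"
    by (auto simp: einterval_def)
  have "(LBINT t=1..\<infinity>. f t) = 0 - exp (- z)"
  proof (rule interval_integral_FTC_integrable[where F=F])
    fix x :: real assume "1 < ereal x"
    then have x: "x > 1" by simp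
    have "((\<lambda>t. t powr (1 - p) * exp (- (z * t))) has_field_derivative
       (1 - p) * (of_real x powr (- p) * exp (- (z * of_real x)))
      - z * (of_real x powr (- (p - 1)) * exp (- (z * of_real x)))) (at (of_real x))"
      using x by (auto intro!: derivative_eq_intros simp: complex_nonpos_Reals_iff algebra_simps)
    then show "(F has_vector_derivative f x) (at x)"
      unfolding F_def f_def by (rule has_vector_derivative_real_field)
    show "isCont f x"
      unfolding f_def using x by (intro continuous_intros) (auto simp: complex_nonpos_Reals_iff)
  next
    show "set_integrable lborel (einterval 1 \<infinity>) f" using si by (simp only: ei)
    have "isCont F 1"
      unfolding F_def by (intro continuous_intros) (auto simp: complex_nonpos_Reals_iff)
    then have "(F \<longlongrightarrow> F 1) (at_right 1)"
      by (simp add: isCont_def filterlim_at_split)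
    moreover have "F 1 = exp (- z)" by (simp add: F_def)
    ultimately show "((F \<circ> real_of_ereal) \<longlongrightarrow> exp (- z)) (at_right 1)"
      by (simp add: one_ereal_def ereal_tendsto_simps)
    have "(F \<longlongrightarrow> 0) at_top"
    proof (rule Lim_null_comparison)
      show "\<forall>\<^sub>F t in at_top. norm (F t) \<le> t powr (1 - Re p) * exp (- (Re z * t))"
        using eventually_gt_at_top[of 0]
        by eventually_elim (simp add: F_def norm_mult norm_powr_real_powr)
      show "((\<lambda>t. t powr (1 - Re p) * exp (- (Re z * t))) \<longlongrightarrow> 0) at_top"
        using z by real_asymp
    qed
    then show "((F \<circ> real_of_ereal) \<longlongrightarrow> 0) (at_left \<infinity>)"
      by (simp add: ereal_tendsto_simps)
  qed simp
  then have "(LINT t:{1<..}|lborel. f t) = - exp (- z)"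
    by (simp add: interval_lebesgue_integral_def ei)
  moreover have "(LINT t:{1<..}|lborel. f t) = (1 - p) * tail_laplace p z - z * tail_laplace (p - 1) z"
    unfolding f_def tail_laplace_def
    by (subst set_integral_diff)
       (use tail_laplace_integrable[OF z, of p] tail_laplace_integrable[OF z, of "p - 1"] in
         \<open>auto intro!: set_integrable_mult_right\<close>)
  ultimately show ?thesis by (simp add: algebra_simps)
qed

definition head_laplace :: "complex \<Rightarrow> complex \<Rightarrow> complex" where
  "head_laplace s z = (LINT t|lborel. indicator {..1} t *\<^sub>R mellin_weight s t * exp (- (z * of_real t)))"

lemma head_laplace_integrable:
  assumes "0 < Re s"
  shows "integrable lborel (\<lambda>t. norm (indicat_real {..1} t *\<^sub>R mellin_weight s t) * exp (- (x * t)))"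
proof (rule Bochner_Integration.integrable_bound)
  show "integrable lborel (\<lambda>t. exp (1 + \<bar>x\<bar>) * (norm (mellin_weight s t) * exp (- (1 * t))))"
    by (intro integrable_mult_right integrable_mellin_weight_exp assms) simp
  show "AE t in lborel. norm (norm (indicat_real {..1} t *\<^sub>R mellin_weight s t) * exp (- (x * t)))
     \<le> norm (exp (1 + \<bar>x\<bar>) * (norm (mellin_weight s t) * exp (- (1 * t))))"
  proof (rule AE_I2)
    fix t :: real
    show "norm (norm (indicat_real {..1} t *\<^sub>R mellin_weight s t) * exp (- (x * t)))
     \<le> norm (exp (1 + \<bar>x\<bar>) * (norm (mellin_weight s t) * exp (- (1 * t))))"
    proof (cases "0 < t \<and> t \<le> 1")
      case True
      have "- (x * t) \<le> \<bar>x\<bar> * t" using True by (metis abs_ge_minus_self abs_mult abs_of_pos)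
      also have "\<dots> \<le> \<bar>x\<bar>" using True by (simp add: mult_left_le)
      finally have "- (x * t) \<le> 1 + \<bar>x\<bar> + - (1 * t)" using True by linarith
      then have "exp (- (x * t)) \<le> exp (1 + \<bar>x\<bar>) * exp (- (1 * t))"
        unfolding mult_exp_exp by simp
      then have "norm (mellin_weight s t) * exp (- (x * t))
         \<le> norm (mellin_weight s t) * (exp (1 + \<bar>x\<bar>) * exp (- (1 * t)))"
        by (intro mult_left_mono) auto
      then show ?thesis using True by (simp add: abs_mult mult_ac)
    qed (auto simp: mellin_weight_def indicator_def)
  qed
qed simp

text \<open>
  Over a bounded interval the Laplace transform converges everywhere; this is the source of
  the entire part of the expansion below.
\<close>

lemma head_laplace_holomorphic:
  assumes "0 < Re s"
  shows "head_laplace s holomorphic_on UNIV"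
proof -
  have "head_laplace s holomorphic_on {z. a < Re z}" for a
    unfolding head_laplace_def
    by (rule laplace_transform_holomorphic)
       (use head_laplace_integrable[OF assms] in \<open>auto simp: mellin_weight_def\<close>)
  then have "head_laplace s field_differentiable (at z)" for z
    by (rule holomorphic_on_imp_differentiable_at[OF _ open_halfspace_Re_gt, of _ "Re z - 1"]) simp
  then show ?thesis
    by (simp add: holomorphic_on_def field_differentiable_at_within)
qed

lemma head_plus_tail_laplace:
  assumes "Re p < 1" "0 < Re z"
  shows "tail_laplace p z = Gamma (1 - p) * z powr (p - 1) - head_laplace (1 - p) z"
proof -
  have s: "0 < Re (1 - p)" using assms by simp
  have ih: "integrable lborel (\<lambda>t. indicat_real {..1} t *\<^sub>R mellin_weight (1 - p) t * exp (- (z * of_real t)))"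
    by (rule Bochner_Integration.integrable_bound[OF head_laplace_integrable[OF s, of "Re z"]])
       (auto simp: norm_mult)
  have it: "integrable lborel (\<lambda>t. indicat_real {1<..} t *\<^sub>R (of_real t powr (- p) * exp (- (z * of_real t))))"
    using tail_laplace_integrable[OF assms(2)] unfolding set_integrable_def .
  have "Gamma (1 - p) * z powr (p - 1) = (LINT t|lborel. mellin_weight (1 - p) t * exp (- (z * of_real t)))"
    using integral_mellin_weight_exp[OF s assms(2)] by simp
  also have "(\<lambda>t. mellin_weight (1 - p) t * exp (- (z * of_real t)))
    = (\<lambda>t. indicat_real {..1} t *\<^sub>R mellin_weight (1 - p) t * exp (- (z * of_real t))
      + indicat_real {1<..} t *\<^sub>R (of_real t powr (- p) * exp (- (z * of_real t))))"
    by (auto simp: fun_eq_iff indicator_def mellin_weight_def)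
  also have "integral\<^sup>L lborel \<dots> = head_laplace (1 - p) z + tail_laplace p z"
    unfolding head_laplace_def tail_laplace_def set_lebesgue_integral_def
    using ih it by simp
  finally show ?thesis by simp
qed

lemma tail_laplace_tendsto_boundary:
  assumes "0 \<le> Re z" "1 < Re p"
  shows "(\<lambda>n. tail_laplace p (z + of_real (1 / real (Suc n)))) \<longlonglongrightarrow> tail_laplace p z"
  unfolding tail_laplace_def set_lebesgue_integral_def
proof (rule integral_dominated_convergence)
  show "integrable lborel (\<lambda>t. indicat_real {1<..} t *\<^sub>R t powr (- Re p))"
    using set_integrable_powr_tail[of "Re p" 1] assms unfolding set_integrable_def by simp
  show "AE t in lborel. (\<lambda>n. indicat_real {1<..} t *\<^sub>R (of_real t powr (- p) * exp (- ((z + of_real (1 / real (Suc n))) * of_real t))))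
     \<longlonglongrightarrow> indicat_real {1<..} t *\<^sub>R (of_real t powr (- p) * exp (- (z * of_real t)))"
  proof (rule AE_I2)
    fix t :: real
    have "(\<lambda>n. z + of_real (1 / real (Suc n))) \<longlonglongrightarrow> z + of_real 0"
      using LIMSEQ_inverse_real_of_nat by (intro tendsto_intros) (simp add: inverse_eq_divide)
    then have "(\<lambda>n. z + of_real (1 / real (Suc n))) \<longlonglongrightarrow> z" by simp
    then show "(\<lambda>n. indicat_real {1<..} t *\<^sub>R (of_real t powr (- p) * exp (- ((z + of_real (1 / real (Suc n))) * of_real t))))
     \<longlonglongrightarrow> indicat_real {1<..} t *\<^sub>R (of_real t powr (- p) * exp (- (z * of_real t)))"
      by (intro tendsto_intros)
  qed
  fix n
  show "AE t in lborel. norm (indicat_real {1<..} t *\<^sub>R (of_real t powr (- p) * exp (- ((z + of_real (1 / real (Suc n))) * of_real t))))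
    \<le> indicat_real {1<..} t *\<^sub>R t powr (- Re p)"
  proof (rule AE_I2)
    fix t :: real
    have "exp (- (Re (z + of_real (1 / real (Suc n))) * t)) \<le> 1" if "1 < t"
      using that assms by (simp add: add_nonneg_nonneg)
    then show "norm (indicat_real {1<..} t *\<^sub>R (of_real t powr (- p) * exp (- ((z + of_real (1 / real (Suc n))) * of_real t))))
    \<le> indicat_real {1<..} t *\<^sub>R t powr (- Re p)"
      by (cases "1 < t") (simp_all add: norm_tail_laplace_integrand[of t p] mult_left_le del: of_real_divide)
  qed
qed simp_all

text \<open>
  For \<open>Re z > 0\<close> two integrations by parts reduce \<open>k + 1\<close> to \<open>k - 1\<close>, whose tail integral is the
  full Gamma integral \<open>\<Gamma>(2 - k) z\<^sup>k\<^sup>-\<^sup>2\<close> minus an entire function. The constant is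
  \<open>\<Gamma>(2 - k) / (k (k - 1))\<close>, which is \<open>\<Gamma>(- k)\<close>; it is nonzero since \<open>\<Gamma>\<close> has no zeros. The imaginary
  axis is reached by approaching it from the right.
\<close>

lemma tail_laplace_expansion:
  fixes k :: complex
  assumes k: "1 < Re k" "Re k < 2"
  obtains c E where "c \<noteq> 0" "E holomorphic_on UNIV"
    "\<And>z. 0 \<le> Re z \<Longrightarrow> tail_laplace (k + 1) z = c * z powr k + E z"
proof -
  define s where "s = 2 - k"
  have s: "0 < Re s" using k by (simp add: s_def)
  have k0: "k \<noteq> 0" "k - 1 \<noteq> 0" using k by auto
  define c where "c = Gamma s / (k * (k - 1))"
  define E where "E z = (exp (- z) - z / (k - 1) * (exp (- z) + z * head_laplace s z)) / k" for z
  have "c \<noteq> 0"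
  proof -
    have "s \<notin> \<int>\<^sub>\<le>\<^sub>0" using s by (auto elim!: nonpos_Ints_cases)
    then have "Gamma s \<noteq> 0" by (simp add: Gamma_eq_zero_iff)
    then show ?thesis using k0 by (simp add: c_def)
  qed
  moreover have holE: "E holomorphic_on UNIV"
    unfolding E_def using k0 by (intro holomorphic_intros head_laplace_holomorphic s) auto
  have interior: "tail_laplace (k + 1) z = c * z powr k + E z" if z: "0 < Re z" for z
  proof -
    have z0: "z \<noteq> 0" using z by auto
    have 1: "k * tail_laplace (k + 1) z = exp (- z) - z * tail_laplace k z"
      using tail_laplace_by_parts[OF z, of "k + 1"] by simp
    have 2: "(k - 1) * tail_laplace k z = exp (- z) - z * tail_laplace (k - 1) z"
      using tail_laplace_by_parts[OF z, of k] by simp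
    have 3: "tail_laplace (k - 1) z = Gamma s * z powr (k - 2) - head_laplace s z"
      using head_plus_tail_laplace[of "k - 1" z] k z by (simp add: s_def)
    have 4: "z powr k = z * z * z powr (k - 2)"
      using powr_add[of z "1 + 1" "k - 2"] powr_add[of z 1 1] z0 by simp
    have "tail_laplace k z = (exp (- z) - z * (Gamma s * z powr (k - 2) - head_laplace s z)) / (k - 1)"
      using 2 3 k0 by (simp add: field_simps)
    then have "k * tail_laplace (k + 1) z = exp (- z) - z * ((exp (- z) - z * (Gamma s * z powr (k - 2) - head_laplace s z)) / (k - 1))"
      using 1 by simp
    then have "tail_laplace (k + 1) z = (exp (- z) - z * ((exp (- z) - z * (Gamma s * z powr (k - 2) - head_laplace s z)) / (k - 1))) / k"
      using k0 by (simp add: field_simps)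
    also have "\<dots> = c * z powr k + E z"
      unfolding c_def E_def 4 using k0 by (simp add: divide_simps) (simp add: algebra_simps)
    finally show ?thesis .
  qed
  have "tail_laplace (k + 1) z = c * z powr k + E z" if z: "0 \<le> Re z" for z
  proof (cases "0 < Re z")
    case False
    then have Re0: "Re z = 0" using z by simp
    let ?z = "\<lambda>n. z + of_real (1 / real (Suc n))"
    have lim: "?z \<longlonglongrightarrow> z"
    proof -
      have "?z \<longlonglongrightarrow> z + of_real 0"
        using LIMSEQ_inverse_real_of_nat by (intro tendsto_intros) (simp add: inverse_eq_divide)
      then show ?thesis by simp
    qed
    have "isCont E z"
      using holomorphic_on_imp_continuous_on[OF holE] by (simp add: continuous_on_eq_continuous_at)
    then have limE: "(\<lambda>n. E (?z n)) \<longlonglongrightarrow> E z"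
      using lim isCont_tendsto_compose by blast
    have limp: "(\<lambda>n. ?z n powr k) \<longlonglongrightarrow> z powr k"
    proof (cases "z = 0")
      case True
      have "(\<lambda>n. (1 / real (Suc n)) powr Re k) \<longlonglongrightarrow> 0 powr Re k"
        by (rule tendsto_powr2[OF _ tendsto_const])
           (use k LIMSEQ_inverse_real_of_nat in \<open>simp_all add: inverse_eq_divide\<close>)
      then have "(\<lambda>n. norm (?z n powr k)) \<longlonglongrightarrow> 0"
        using True k by (simp add: norm_powr_real_powr del: of_real_divide)
      then show ?thesis using True tendsto_norm_zero_iff by auto
    next
      case False
      then have "z \<notin> \<real>\<^sub>\<le>\<^sub>0" using Re0 by (auto simp: complex_nonpos_Reals_iff complex_eq_iff)
      then show ?thesis by (intro tendsto_intros lim) (simp_all add: False)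
    qed
    have "(\<lambda>n. tail_laplace (k + 1) (?z n)) \<longlonglongrightarrow> c * z powr k + E z"
    proof -
      have "tail_laplace (k + 1) (?z n) = c * ?z n powr k + E (?z n)" for n
        by (rule interior) (simp add: Re0)
      then show ?thesis by (simp only:) (intro tendsto_intros limE limp)
    qed
    moreover have "(\<lambda>n. tail_laplace (k + 1) (?z n)) \<longlonglongrightarrow> tail_laplace (k + 1) z"
      using tail_laplace_tendsto_boundary[of z "k + 1"] z k by simp
    ultimately show ?thesis by (intro LIMSEQ_unique)
  qed (rule interior)
  with \<open>c \<noteq> 0\<close> holE show thesis by (rule that)
qed

section \<open>Regularity of the limiting tail\<close>

lemma has_vector_derivative_abs_powr:
  fixes m :: complex and x :: real
  assumes "x \<noteq> 0"
  shows "((\<lambda>x. of_real \<bar>x\<bar> powr m) has_vector_derivative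
           m * of_real (sgn x) * of_real \<bar>x\<bar> powr (m - 1)) (at x)"
proof -
  have "(abs has_real_derivative sgn x) (at x)"
  proof (cases "0 < x")
    case True
    show ?thesis
      by (rule has_field_derivative_transform_within_open[where S="{0<..}" and f="\<lambda>x. x"])
         (use True in auto)
  next
    case False
    show ?thesis
      by (rule has_field_derivative_transform_within_open[where S="{..<0}" and f="\<lambda>x. - x"])
         (use False assms in \<open>auto intro!: derivative_eq_intros\<close>)
  qed
  then have 1: "((\<lambda>x. complex_of_real \<bar>x\<bar>) has_vector_derivative of_real (sgn x)) (at x)"
    by (intro has_vector_derivative_of_real) (simp add: has_real_derivative_iff_has_vector_derivative)
  have 2: "((\<lambda>z. z powr m) has_field_derivative m * of_real \<bar>x\<bar> powr (m - 1)) (at (complex_of_real \<bar>x\<bar>))"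
    using assms by (auto intro!: has_field_derivative_powr simp: complex_nonpos_Reals_iff)
  from field_vector_diff_chain_at[OF 1 2] show ?thesis
    by (simp add: o_def mult_ac)
qed

lemma has_vector_derivative_sgn_abs_powr:
  fixes m :: complex and x :: real
  assumes "x \<noteq> 0"
  shows "((\<lambda>x. of_real (sgn x) * of_real \<bar>x\<bar> powr m) has_vector_derivative
           m * of_real \<bar>x\<bar> powr (m - 1)) (at x)"
proof -
  have "((\<lambda>x. complex_of_real (sgn x)) has_vector_derivative 0) (at x)"
  proof (cases "0 < x")
    case True
    show ?thesis
      by (rule has_vector_derivative_transform_within_open[where S="{0<..}" and f="\<lambda>_. 1"])
         (use True in auto)
  next
    case False
    show ?thesis
      by (rule has_vector_derivative_transform_within_open[where S="{..<0}" and f="\<lambda>_. - 1"])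
         (use False assms in auto)
  qed
  from has_vector_derivative_mult[OF this has_vector_derivative_abs_powr[OF assms, of m]]
  show ?thesis using assms
    by (simp add: sgn_if split: if_splits)
qed

text \<open>
  At the origin the derivatives of \<open>|x|\<^sup>m\<close> and \<open>sgn x |x|\<^sup>m\<close> vanish by size alone.
\<close>

lemma has_vector_derivative_zero_at_0:
  fixes f :: "real \<Rightarrow> complex"
  assumes "1 < r" "\<And>x. norm (f x) \<le> \<bar>x\<bar> powr r"
  shows "(f has_vector_derivative 0) (at 0)"
proof -
  have f0: "f 0 = 0" using assms(2)[of 0] by simp
  have "((\<lambda>h. norm (f (0 + h) - f 0 - h *\<^sub>R 0) / norm h) \<longlongrightarrow> 0) (at 0)"
  proof (rule Lim_null_comparison)
    show "\<forall>\<^sub>F h in at 0. norm (norm (f (0 + h) - f 0 - h *\<^sub>R 0) / norm h) \<le> \<bar>h\<bar> powr (r - 1)"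
      unfolding eventually_at_filter
    proof (intro always_eventually allI impI)
      fix h :: real assume h: "h \<noteq> 0"
      have "norm (f h) / \<bar>h\<bar> \<le> \<bar>h\<bar> powr r / \<bar>h\<bar>"
        by (intro divide_right_mono assms(2)) auto
      also have "\<dots> = \<bar>h\<bar> powr (r - 1)" using h by (simp add: powr_diff)
      finally show "norm (norm (f (0 + h) - f 0 - h *\<^sub>R 0) / norm h) \<le> \<bar>h\<bar> powr (r - 1)"
        by (simp add: f0)
    qed
    have "((\<lambda>h::real. \<bar>h\<bar> powr (r - 1)) \<longlongrightarrow> \<bar>0\<bar> powr (r - 1)) (at 0)"
      by (rule tendsto_powr2[OF _ tendsto_const]) (use assms in \<open>auto intro!: tendsto_rabs_zero tendsto_ident_at\<close>)
    then show "((\<lambda>h::real. \<bar>h\<bar> powr (r - 1)) \<longlongrightarrow> 0) (at 0)" by simp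
  qed
  then show ?thesis
    unfolding has_vector_derivative_def has_derivative_at by (simp add: bounded_linear_zero)
qed

lemma norm_abs_powr_le: "norm (of_real \<bar>x\<bar> powr m :: complex) \<le> \<bar>x\<bar> powr Re m"
  by (simp add: norm_powr_real_powr)

lemma has_vector_derivative_abs_powr_everywhere:
  fixes m :: complex and x :: real
  assumes "1 < Re m"
  shows "((\<lambda>x. of_real \<bar>x\<bar> powr m) has_vector_derivative
           m * of_real (sgn x) * of_real \<bar>x\<bar> powr (m - 1)) (at x)"
proof (cases "x = 0")
  case True
  then show ?thesis
    using has_vector_derivative_zero_at_0[OF assms, of "\<lambda>x. of_real \<bar>x\<bar> powr m"] norm_abs_powr_le by simp
qed (rule has_vector_derivative_abs_powr)

lemma has_vector_derivative_sgn_abs_powr_everywhere: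
  fixes m :: complex and x :: real
  assumes "1 < Re m"
  shows "((\<lambda>x. of_real (sgn x) * of_real \<bar>x\<bar> powr m) has_vector_derivative
           m * of_real \<bar>x\<bar> powr (m - 1)) (at x)"
proof (cases "x = 0")
  case True
  have "norm (of_real (sgn x) * of_real \<bar>x\<bar> powr m :: complex) \<le> \<bar>x\<bar> powr Re m" for x :: real
    using norm_abs_powr_le[of x m] by (simp add: norm_mult abs_sgn_eq)
  from has_vector_derivative_zero_at_0[OF assms this] True show ?thesis
    by simp
qed (rule has_vector_derivative_sgn_abs_powr)

text \<open>
  On the positive axis the derivative of \<open>x\<^sup>n\<close> has constant modulus \<open>|n|\<close> when \<open>Re n = 1\<close>.
\<close>

lemma abs_powr_lipschitz:
  fixes n :: complex
  assumes "Re n = 1"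
  shows "norm (of_real \<bar>x\<bar> powr n - of_real \<bar>y\<bar> powr n) \<le> norm n * \<bar>x - y\<bar>"
proof -
  have n1: "1 \<le> norm n" using assms complex_Re_le_cmod[of n] by simp
  have pos: "norm (of_real a powr n - of_real b powr n) \<le> norm n * \<bar>a - b\<bar>" if "0 < a" "0 < b" for a b :: real
  proof -
    let ?S = "complex_of_real ` {0<..}"
    have "convex ?S"
      by (rule convex_linear_image[OF bounded_linear.linear[OF bounded_linear_of_real]]) simp
    moreover have "((\<lambda>z. z powr n) has_field_derivative n * z powr (n - 1)) (at z within ?S)" if z: "z \<in> ?S" for z
    proof -
      have "z \<notin> \<real>\<^sub>\<le>\<^sub>0" using z by (auto simp: complex_nonpos_Reals_iff)
      then show ?thesis by (rule has_field_derivative_at_within[OF has_field_derivative_powr])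
    qed
    moreover have "norm (n * z powr (n - 1)) \<le> norm n" if "z \<in> ?S" for z
      using that assms by (auto simp: norm_mult norm_powr_real_powr)
    ultimately have "norm (of_real a powr n - of_real b powr n) \<le> norm n * norm (complex_of_real a - of_real b)"
      by (rule field_differentiable_bound) (use that in auto)
    then show ?thesis by (simp flip: of_real_diff)
  qed
  have zero: "norm (of_real \<bar>a\<bar> powr n) \<le> norm n * \<bar>a\<bar>" for a
    using n1 assms mult_right_mono[OF n1, of "\<bar>a\<bar>"] by (simp add: norm_powr_real_powr)
  have "norm (of_real \<bar>x\<bar> powr n - of_real \<bar>y\<bar> powr n) \<le> norm n * \<bar>\<bar>x\<bar> - \<bar>y\<bar>\<bar>"
    using pos[of "\<bar>x\<bar>" "\<bar>y\<bar>"] zero[of x] zero[of y] by (cases "x = 0"; cases "y = 0") auto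
  also have "\<dots> \<le> norm n * \<bar>x - y\<bar>"
    by (intro mult_left_mono) auto
  finally show ?thesis .
qed

lemma entire_lipschitz_on_compact:
  fixes F :: "complex \<Rightarrow> complex" and K :: "real set"
  assumes F: "F holomorphic_on UNIV" and K: "compact K"
  obtains L where "0 \<le> L" "\<And>x y. x \<in> K \<Longrightarrow> y \<in> K \<Longrightarrow> norm (F (of_real x) - F (of_real y)) \<le> L * \<bar>x - y\<bar>"
proof -
  obtain R where R: "\<And>x. x \<in> K \<Longrightarrow> \<bar>x\<bar> \<le> R"
    using compact_imp_bounded[OF K] by (auto simp: bounded_iff)
  let ?S = "cball (0::complex) R"
  have "continuous_on ?S (deriv F)"
    by (intro holomorphic_on_imp_continuous_on holomorphic_on_subset[OF holomorphic_deriv[OF F]]) auto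
  then have "compact (deriv F ` ?S)" by (intro compact_continuous_image) auto
  then obtain B where B: "\<And>z. z \<in> ?S \<Longrightarrow> norm (deriv F z) \<le> B"
    using compact_imp_bounded by (fastforce simp: bounded_iff)
  have "norm (F (of_real x) - F (of_real y)) \<le> B * norm (complex_of_real x - of_real y)" if "x \<in> K" "y \<in> K" for x y
  proof (rule field_differentiable_bound[of ?S])
    show "(F has_field_derivative deriv F z) (at z within ?S)" if "z \<in> ?S" for z
      using holomorphic_derivI[OF F] by (simp add: has_field_derivative_at_within)
  qed (use R that B in auto)
  then have "norm (F (of_real x) - F (of_real y)) \<le> B * \<bar>x - y\<bar>" if "x \<in> K" "y \<in> K" for x y
    using that by (simp flip: of_real_diff)
  moreover have "B * \<bar>x - y\<bar> \<le> max B 0 * \<bar>x - y\<bar>" for x y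
    by (intro mult_right_mono) auto
  ultimately have "norm (F (of_real x) - F (of_real y)) \<le> max B 0 * \<bar>x - y\<bar>" if "x \<in> K" "y \<in> K" for x y
    using that order_trans by blast
  then show thesis by (intro that[of "max B 0"]) auto
qed

lemma nderiv_Suc: "nderiv (Suc n) f = (\<lambda>x. vector_derivative (nderiv n f) (at x))"
  by (simp add: nderiv_def)

text \<open>
  Each differentiation turns an even power of \<open>|x|\<close> into an odd one and conversely, so the
  third derivative is \<open>c\<^sub>3 sgn x |x|\<^sup>m\<^sup>-\<^sup>3\<close> plus a continuous function. If it had a limit, the
  singular part would have a limit too, equal to its own negative by oddness, hence zero;
  but its modulus is the constant \<open>|c\<^sub>3| > 0\<close>.
\<close>

lemma abs_powr_plus_entire_regularity:
  fixes c m :: complex and F :: "complex \<Rightarrow> complex"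
  assumes c: "c \<noteq> 0" and m: "Re m = 3" and F: "F holomorphic_on UNIV"
  defines "\<Phi> \<equiv> \<lambda>x :: real. c * of_real \<bar>x\<bar> powr m + F (of_real x)"
  shows "\<Phi> \<in> C21_loc" and "third_deriv_not_extendable_at_0 \<Phi>"
proof -
  define G where "G n = (deriv ^^ n) F" for n
  have holG: "G n holomorphic_on UNIV" for n
    unfolding G_def by (induction n) (auto intro: holomorphic_deriv F)
  have dG: "((\<lambda>x. G n (of_real x)) has_vector_derivative G (Suc n) (of_real x)) (at x)" for n x
  proof -
    have "(G n has_field_derivative G (Suc n) (of_real x)) (at (of_real x))"
      using holomorphic_derivI[OF holG[of n]] by (simp add: G_def)
    then show ?thesis by (rule has_vector_derivative_real_field)
  qed
  have d1: "(\<Phi> has_vector_derivative c * m * of_real (sgn x) * of_real \<bar>x\<bar> powr (m - 1) + G 1 (of_real x)) (at x)" for x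
    unfolding \<Phi>_def using dG[of 0 x] has_vector_derivative_abs_powr_everywhere[of m x] m
    by (auto intro!: derivative_eq_intros simp: G_def mult.assoc)
  have n0: "nderiv 0 \<Phi> = \<Phi>" by (simp add: nderiv_def)
  have n1: "nderiv 1 \<Phi> = (\<lambda>x. c * m * of_real (sgn x) * of_real \<bar>x\<bar> powr (m - 1) + G 1 (of_real x))"
    using d1 by (auto simp: nderiv_Suc n0 fun_eq_iff vector_derivative_at)
  have d2: "(nderiv 1 \<Phi> has_vector_derivative c * m * (m - 1) * of_real \<bar>x\<bar> powr (m - 2) + G 2 (of_real x)) (at x)" for x
  proof -
    have "((\<lambda>x. c * m * (of_real (sgn x) * of_real \<bar>x\<bar> powr (m - 1)) + G 1 (of_real x)) has_vector_derivative
        c * m * ((m - 1) * of_real \<bar>x\<bar> powr (m - 1 - 1)) + G (Suc 1) (of_real x)) (at x)"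
      by (intro has_vector_derivative_add has_vector_derivative_mult_right dG
          has_vector_derivative_sgn_abs_powr_everywhere) (use m in auto)
    then show ?thesis unfolding n1 by (simp add: mult.assoc numeral_2_eq_2 diff_diff_eq)
  qed
  have n2: "nderiv 2 \<Phi> = (\<lambda>x. c * m * (m - 1) * of_real \<bar>x\<bar> powr (m - 2) + G 2 (of_real x))"
    using d2 nderiv_Suc[of 1 \<Phi>] by (auto simp: fun_eq_iff vector_derivative_at numeral_2_eq_2)
  have d3: "(nderiv 2 \<Phi> has_vector_derivative
      c * m * (m - 1) * (m - 2) * of_real (sgn x) * of_real \<bar>x\<bar> powr (m - 3) + G 3 (of_real x)) (at x)"
    if "x \<noteq> 0" for x
  proof -
    have "((\<lambda>x. c * m * (m - 1) * of_real \<bar>x\<bar> powr (m - 2) + G 2 (of_real x)) has_vector_derivative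
        c * m * (m - 1) * ((m - 2) * of_real (sgn x) * of_real \<bar>x\<bar> powr (m - 2 - 1)) + G (Suc 2) (of_real x)) (at x)"
      by (intro has_vector_derivative_add has_vector_derivative_mult_right dG
          has_vector_derivative_abs_powr that)
    then show ?thesis unfolding n2 by (simp add: mult.assoc numeral_3_eq_3 numeral_2_eq_2 diff_diff_eq)
  qed
  define c3 where "c3 = c * m * (m - 1) * (m - 2)"
  have n3: "nderiv 3 \<Phi> x = c3 * (of_real (sgn x) * of_real \<bar>x\<bar> powr (m - 3)) + G 3 (of_real x)"
    if "x \<noteq> 0" for x
    using d3[OF that] nderiv_Suc[of 2 \<Phi>] by (simp add: vector_derivative_at c3_def mult.assoc numeral_3_eq_3 numeral_2_eq_2)
  have c3: "c3 \<noteq> 0" using c m by (auto simp: c3_def)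

  show "\<Phi> \<in> C21_loc"
    unfolding C21_loc_def
  proof (intro CollectI conjI allI impI)
    show "\<Phi> differentiable at x" for x using d1 by (rule differentiableI_vector)
    show "nderiv 1 \<Phi> differentiable at x" for x using d2 by (rule differentiableI_vector)
    fix K :: "real set" assume "compact K"
    from entire_lipschitz_on_compact[OF holG[of 2] this] obtain L where
      L: "0 \<le> L" "\<And>x y. x \<in> K \<Longrightarrow> y \<in> K \<Longrightarrow> norm (G 2 (of_real x) - G 2 (of_real y)) \<le> L * \<bar>x - y\<bar>"
      by blast
    let ?c = "c * m * (m - 1)"
    show "\<exists>L. L-lipschitz_on K (nderiv 2 \<Phi>)"
    proof (intro exI lipschitz_onI)
      fix x y assume xy: "x \<in> K" "y \<in> K"
      have "dist (nderiv 2 \<Phi> x) (nderiv 2 \<Phi> y)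
        = norm (?c * (of_real \<bar>x\<bar> powr (m - 2) - of_real \<bar>y\<bar> powr (m - 2)) + (G 2 (of_real x) - G 2 (of_real y)))"
        unfolding n2 dist_norm by (simp add: algebra_simps)
      also have "\<dots> \<le> norm ?c * norm (of_real \<bar>x\<bar> powr (m - 2) - of_real \<bar>y\<bar> powr (m - 2)) + norm (G 2 (of_real x) - G 2 (of_real y))"
        by (metis norm_mult norm_triangle_ineq)
      also have "\<dots> \<le> norm ?c * (norm (m - 2) * \<bar>x - y\<bar>) + L * \<bar>x - y\<bar>"
        using m by (intro add_mono mult_left_mono abs_powr_lipschitz L xy) auto
      finally show "dist (nderiv 2 \<Phi> x) (nderiv 2 \<Phi> y) \<le> (norm ?c * norm (m - 2) + L) * dist x y"
        by (simp add: dist_real_def algebra_simps)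
    qed (use L in auto)
  qed

  show "third_deriv_not_extendable_at_0 \<Phi>"
    unfolding third_deriv_not_extendable_at_0_def
  proof (intro conjI allI impI notI)
    show "nderiv 2 \<Phi> differentiable at x" if "x \<noteq> 0" for x
      using d3[OF that] by (rule differentiableI_vector)
    have "isCont (\<lambda>x. c3 * (of_real (sgn x) * of_real \<bar>x\<bar> powr (m - 3)) + G 3 (of_real x)) x" if "x \<noteq> 0" for x
      by (rule continuous_add[OF continuous_mult[OF continuous_const
          has_vector_derivative_continuous[OF has_vector_derivative_sgn_abs_powr[OF that, of "m - 3"]]]
          has_vector_derivative_continuous[OF dG[of 3 x]]])
    then have "continuous_on (- {0}) (\<lambda>x. c3 * (of_real (sgn x) * of_real \<bar>x\<bar> powr (m - 3)) + G 3 (of_real x))"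
      by (intro continuous_at_imp_continuous_on) auto
    then show "continuous_on (- {0}) (nderiv 3 \<Phi>)"
      by (rule continuous_on_cong[THEN iffD1, rotated -1]) (auto simp: n3)
  next
    assume "\<exists>l. (nderiv 3 \<Phi> \<longlongrightarrow> l) (at 0)"
    then obtain l where l: "(nderiv 3 \<Phi> \<longlongrightarrow> l) (at 0)" ..
    define q where "q x = c3 * (of_real (sgn x) * of_real \<bar>x\<bar> powr (m - 3))" for x :: real
    have "((\<lambda>x. G 3 (of_real x)) \<longlongrightarrow> G 3 (of_real 0)) (at 0)"
      using has_vector_derivative_continuous[OF dG[of 3 0]] by (simp add: isCont_def)
    from tendsto_diff[OF l this] have "((\<lambda>x. nderiv 3 \<Phi> x - G 3 (of_real x)) \<longlongrightarrow> l - G 3 0) (at 0)" by simp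
    moreover have "\<forall>\<^sub>F x in at 0. nderiv 3 \<Phi> x - G 3 (of_real x) = q x"
      by (auto simp: eventually_at_filter n3 q_def)
    ultimately have q: "(q \<longlongrightarrow> l - G 3 0) (at 0)"
      by (rule Lim_transform_eventually)
    have "((\<lambda>x. q (- x)) \<longlongrightarrow> l - G 3 0) (at 0)"
    proof (rule filterlim_compose[OF q])
      show "filterlim uminus (at 0) (at (0::real))"
        by (rule filterlim_atI)
           (auto intro!: tendsto_eq_intros simp: eventually_at_filter)
    qed
    from tendsto_add[OF q this] have 0: "((\<lambda>x. 0) \<longlongrightarrow> (l - G 3 0) + (l - G 3 0)) (at (0::real))"
      by (simp add: q_def)
    have "l - G 3 0 = 0"
      using tendsto_unique[OF _ 0 tendsto_const] by simp
    with q have "((\<lambda>x. norm (q x)) \<longlongrightarrow> 0) (at 0)" by (simp add: tendsto_norm_zero)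
    moreover have "\<forall>\<^sub>F x in at 0. norm (q x) = norm c3"
      using m by (auto simp: eventually_at_filter q_def norm_mult norm_powr_real_powr abs_sgn_eq)
    ultimately have "((\<lambda>x. norm c3) \<longlongrightarrow> 0) (at (0::real))" by (rule Lim_transform_eventually)
    then show False using c3 tendsto_const_iff[of "at (0::real)" "norm c3" 0] by simp
  qed
qed

lemma third_deriv_not_extendable_imp_nonzero:
  assumes "third_deriv_not_extendable_at_0 f"
  shows "\<exists>x. f x \<noteq> 0"
proof (rule ccontr)
  assume "\<nexists>x. f x \<noteq> 0"
  then have "f = (\<lambda>x. 0)" by auto
  moreover have "nderiv n (\<lambda>x. 0) = (\<lambda>x. 0)" for n
    by (induction n) (simp_all add: nderiv_def)
  ultimately have "(nderiv 3 f \<longlongrightarrow> 0) (at 0)" by simp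
  then show False using assms by (auto simp: third_deriv_not_extendable_at_0_def)
qed

text \<open>
  For \<open>x \<noteq> 0\<close> the factor \<open>x\<^sup>2\<close> is a positive real, so it splits off from the principal branch.
\<close>

lemma minus_ii_sq_powr:
  fixes x :: real and k :: complex
  shows "(- (\<i> * of_real (x\<^sup>2))) powr k = (- \<i>) powr k * of_real \<bar>x\<bar> powr (2 * k)"
proof (cases "x = 0")
  case False
  have "Ln (- (\<i> * of_real (x\<^sup>2))) = Ln (of_real (x\<^sup>2) * (- \<i>))" by (simp add: mult.commute)
  also have "\<dots> = of_real (ln (x\<^sup>2)) + Ln (- \<i>)"
    using False by (subst Ln_times_of_real) (auto simp: Ln_of_real simp del: of_real_power)
  also have "ln (x\<^sup>2) = 2 * ln \<bar>x\<bar>"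
    using False ln_realpow[of "\<bar>x\<bar>" 2] by simp
  finally have L: "Ln (- (\<i> * of_real (x\<^sup>2))) = 2 * Ln (of_real \<bar>x\<bar>) + Ln (- \<i>)"
    using False by (simp add: Ln_of_real)
  have "(- (\<i> * of_real (x\<^sup>2))) powr k = exp (k * Ln (- (\<i> * of_real (x\<^sup>2))))"
    using False by (simp add: powr_def)
  also have "\<dots> = exp (k * Ln (- \<i>) + 2 * k * Ln (of_real \<bar>x\<bar>))"
    by (simp only: L ring_distribs mult_ac add_ac)
  also have "\<dots> = exp (k * Ln (- \<i>)) * exp (2 * k * Ln (of_real \<bar>x\<bar>))"
    by (rule exp_add)
  also have "\<dots> = (- \<i>) powr k * of_real \<bar>x\<bar> powr (2 * k)"
    using False by (simp add: powr_def)
  finally show ?thesis .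
qed simp

lemma tail_profile_regularity:
  fixes a :: complex and \<alpha> :: real
  assumes a: "a \<noteq> 0"
  defines "\<Phi> \<equiv> \<lambda>\<eta> :: real. a * tail_laplace (5/2 + \<i> * of_real \<alpha>) (- (\<i> * of_real (\<eta>\<^sup>2)))"
  shows "\<Phi> \<in> C21_loc" "third_deriv_not_extendable_at_0 \<Phi>"
proof -
  define k where "k = 3/2 + \<i> * of_real \<alpha>"
  have k: "1 < Re k" "Re k < 2" by (simp_all add: k_def)
  from tail_laplace_expansion[OF k] obtain c E where c: "c \<noteq> 0" and E: "E holomorphic_on UNIV"
    and eq: "\<And>z. 0 \<le> Re z \<Longrightarrow> tail_laplace (k + 1) z = c * z powr k + E z" by metis
  define F where "F z = a * E (- (\<i> * z\<^sup>2))" for z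
  have "(\<lambda>z. E (- (\<i> * z\<^sup>2))) holomorphic_on UNIV"
    by (rule holomorphic_on_compose_gen[OF _ E, unfolded o_def]) (auto intro!: holomorphic_intros)
  then have F: "F holomorphic_on UNIV"
    unfolding F_def by (intro holomorphic_intros)
  have k1: "5/2 + \<i> * of_real \<alpha> = k + 1" by (simp add: k_def)
  have \<Phi>: "\<Phi> = (\<lambda>x. (a * c * (- \<i>) powr k) * of_real \<bar>x\<bar> powr (2 * k) + F (of_real x))"
    unfolding \<Phi>_def k1 F_def
    by (subst eq) (simp_all add: minus_ii_sq_powr algebra_simps del: of_real_power, simp)
  have "a * c * (- \<i>) powr k \<noteq> 0" using a c by simp
  moreover have "Re (2 * k) = 3" by (simp add: k_def)
  ultimately show "\<Phi> \<in> C21_loc" "third_deriv_not_extendable_at_0 \<Phi>"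
    unfolding \<Phi> using F by (rule abs_powr_plus_entire_regularity)+
qed

section \<open>Square integrable functions and the Japanese bracket\<close>

lemma integrable_norm_mult_of_squares:
  fixes f g :: "real \<Rightarrow> complex"
  assumes [measurable]: "f \<in> borel_measurable lborel" "g \<in> borel_measurable lborel"
    and f: "integrable lborel (\<lambda>x. (cmod (f x))\<^sup>2)" and g: "integrable lborel (\<lambda>x. (cmod (g x))\<^sup>2)"
  shows "integrable lborel (\<lambda>x. cmod (f x) * cmod (g x))"
proof (rule Bochner_Integration.integrable_bound[OF Bochner_Integration.integrable_add[OF f g]])
  show "AE x in lborel. norm (cmod (f x) * cmod (g x)) \<le> norm ((cmod (f x))\<^sup>2 + (cmod (g x))\<^sup>2)"
  proof (rule AE_I2)
    fix x
    have "2 * (cmod (f x) * cmod (g x)) \<le> (cmod (f x))\<^sup>2 + (cmod (g x))\<^sup>2"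
      using sum_squares_bound[of "cmod (f x)" "cmod (g x)"] by simp
    moreover have "0 \<le> cmod (f x) * cmod (g x)" by simp
    ultimately have "cmod (f x) * cmod (g x) \<le> (cmod (f x))\<^sup>2 + (cmod (g x))\<^sup>2"
      by linarith
    then show "norm (cmod (f x) * cmod (g x)) \<le> norm ((cmod (f x))\<^sup>2 + (cmod (g x))\<^sup>2)"
      by (simp add: abs_mult)
  qed
qed simp

lemma L2_norm_nonneg [simp]: "0 \<le> L2_norm f"
  by (simp add: L2_norm_def)

lemma L2_norm_sq: "(L2_norm f)\<^sup>2 = (LINT x|lborel. (cmod (f x))\<^sup>2)"
  by (simp add: L2_norm_def)

lemma L2_D:
  assumes "f \<in> L2"
  shows "f \<in> borel_measurable lborel" "integrable lborel (\<lambda>x. (cmod (f x))\<^sup>2)"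
  using assms by (auto simp: L2_def)

text \<open>
  Young's inequality with the weight \<open>(b + d) / (a + d)\<close>, where the small \<open>d > 0\<close> avoids the
  separate treatment of vanishing norms.
\<close>

lemma L2_Cauchy_Schwarz:
  assumes f: "f \<in> L2" and g: "g \<in> L2"
  shows "(LINT x|lborel. cmod (f x) * cmod (g x)) \<le> L2_norm f * L2_norm g"
proof (rule field_le_epsilon)
  fix e :: real assume e: "0 < e"
  define a where "a = L2_norm f"
  define b where "b = L2_norm g"
  have ab: "0 \<le> a" "0 \<le> b" by (auto simp: a_def b_def)
  define d where "d = e / (a + b + 1)"
  have d: "0 < d" using e ab by (simp add: d_def)
  define l where "l = (b + d) / (a + d)"
  have l: "0 < l" using ab d by (simp add: l_def)
  have pw: "2 * (cmod (f x) * cmod (g x)) \<le> l * (cmod (f x))\<^sup>2 + 1 / l * (cmod (g x))\<^sup>2" for x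
  proof -
    have "2 * (sqrt l * cmod (f x)) * (cmod (g x) / sqrt l) \<le> (sqrt l * cmod (f x))\<^sup>2 + (cmod (g x) / sqrt l)\<^sup>2"
      by (rule sum_squares_bound)
    then show ?thesis using l by (simp add: power_mult_distrib power_divide)
  qed
  have "2 * (LINT x|lborel. cmod (f x) * cmod (g x)) = (LINT x|lborel. 2 * (cmod (f x) * cmod (g x)))"
    by simp
  also have "\<dots> \<le> (LINT x|lborel. l * (cmod (f x))\<^sup>2 + 1 / l * (cmod (g x))\<^sup>2)"
    using integrable_norm_mult_of_squares[OF L2_D(1)[OF f] L2_D(1)[OF g] L2_D(2)[OF f] L2_D(2)[OF g]]
      L2_D(2)[OF f] L2_D(2)[OF g] pw
    by (intro integral_mono Bochner_Integration.integrable_add integrable_mult_right) auto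
  also have "\<dots> = l * a\<^sup>2 + 1 / l * b\<^sup>2"
    using L2_D(2)[OF f] L2_D(2)[OF g] by (simp add: a_def b_def L2_norm_sq)
  also have "l * a\<^sup>2 \<le> (b + d) * a"
  proof -
    have "a\<^sup>2 \<le> a * (a + d)" using ab d by (simp add: power2_eq_square mult_left_mono)
    then have "l * a\<^sup>2 \<le> l * (a * (a + d))" using l by (intro mult_left_mono) auto
    also have "\<dots> = (b + d) * a" using ab d by (simp add: l_def)
    finally show ?thesis .
  qed
  also have "1 / l * b\<^sup>2 \<le> (a + d) * b"
  proof -
    have "b\<^sup>2 \<le> b * (b + d)" using ab d by (simp add: power2_eq_square mult_left_mono)
    then have "1 / l * b\<^sup>2 \<le> 1 / l * (b * (b + d))" using l by (intro mult_left_mono) auto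
    also have "\<dots> = (a + d) * b" using ab d by (simp add: l_def)
    finally show ?thesis .
  qed
  finally have "2 * (LINT x|lborel. cmod (f x) * cmod (g x)) \<le> 2 * (a * b) + d * (a + b)"
    by (simp add: algebra_simps)
  also have "d * (a + b) \<le> e" using ab e by (simp add: d_def field_simps)
  finally show "(LINT x|lborel. cmod (f x) * cmod (g x)) \<le> L2_norm f * L2_norm g + e"
    using e by (simp add: a_def b_def)
qed

lemma jbr_ge_1: "1 \<le> jbr x"
  unfolding jbr_def by (rule ge_one_powr_ge_zero) auto

lemma jbr_ge_abs: "\<bar>x\<bar> \<le> jbr x"
  unfolding jbr_def by (simp add: powr_half_sqrt real_le_rsqrt)

lemma jbr_measurable [measurable]: "jbr \<in> borel_measurable borel"
  unfolding jbr_def by measurable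

lemma integrable_jbr_powr:
  assumes "1 < q"
  shows "integrable lborel (\<lambda>x. jbr x powr (- q))"
proof (rule Bochner_Integration.integrable_bound)
  have 1: "integrable lborel (\<lambda>x. indicat_real {1<..} x * x powr (- q))"
    using set_integrable_powr_tail[OF assms, of 1] by (simp add: set_integrable_def)
  have 2: "integrable lborel (\<lambda>x. indicat_real {1<..} (- x) * (- x) powr (- q))"
    using lborel_integrable_real_affine[OF 1, of "-1" 0] by simp
  have 3: "integrable lborel (indicat_real {-1..1::real})"
    by (rule integrable_real_indicator) auto
  show "integrable lborel (\<lambda>x. indicat_real {-1..1} x + (indicat_real {1<..} x * x powr (- q)
     + indicat_real {1<..} (- x) * (- x) powr (- q)))"
    by (intro Bochner_Integration.integrable_add 1 2 3)
  show "AE x in lborel. norm (jbr x powr (- q)) \<le> norm (indicat_real {-1..1} x + (indicat_real {1<..} x * x powr (- q)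
     + indicat_real {1<..} (- x) * (- x) powr (- q)))"
  proof (rule AE_I2)
    fix x :: real
    have j1: "jbr x powr (- q) \<le> 1"
      using powr_mono2'[of "- q" 1 "jbr x"] assms jbr_ge_1[of x] by simp
    have j2: "jbr x powr (- q) \<le> \<bar>x\<bar> powr (- q)" if "x \<noteq> 0"
      using powr_mono2'[of "- q" "\<bar>x\<bar>" "jbr x"] assms jbr_ge_abs[of x] that by simp
    consider "\<bar>x\<bar> \<le> 1" | "x > 1" | "x < -1" by linarith
    then show "norm (jbr x powr (- q)) \<le> norm (indicat_real {-1..1} x + (indicat_real {1<..} x * x powr (- q)
     + indicat_real {1<..} (- x) * (- x) powr (- q)))"
      by cases (use j1 j2 in \<open>auto simp: indicator_def\<close>)
  qed
qed simp

section \<open>Fourier inversion and Hoelder continuity of the scattering profile\<close>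

text \<open>
  The Fubini hypothesis behind the multiplication formula.
\<close>

lemma integrable_fourier_kernel:
  fixes f g :: "real \<Rightarrow> complex"
  assumes f: "integrable lborel f" and g: "integrable lborel g"
  shows "integrable (lborel \<Otimes>\<^sub>M lborel) (\<lambda>(y, \<zeta>). cis (- (\<zeta> * y)) * f y * g \<zeta>)"
proof (rule lborel_pair.Fubini_integrable)
  have [measurable]: "f \<in> borel_measurable borel" "g \<in> borel_measurable borel"
    using f g by auto
  show "(\<lambda>(y, \<zeta>). cis (- (\<zeta> * y)) * f y * g \<zeta>) \<in> borel_measurable (lborel \<Otimes>\<^sub>M lborel)"
    unfolding cis_conv_exp by measurable
  show "integrable lborel (\<lambda>y. LINT \<zeta>|lborel. norm (case (y, \<zeta>) of (y, \<zeta>) \<Rightarrow> cis (- (\<zeta> * y)) * f y * g \<zeta>))"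
    using f g by (simp add: norm_mult integrable_norm)
  show "AE y in lborel. integrable lborel (\<lambda>\<zeta>. case (y, \<zeta>) of (y, \<zeta>) \<Rightarrow> cis (- (\<zeta> * y)) * f y * g \<zeta>)"
  proof (rule AE_I2)
    fix y
    show "integrable lborel (\<lambda>\<zeta>. case (y, \<zeta>) of (y, \<zeta>) \<Rightarrow> cis (- (\<zeta> * y)) * f y * g \<zeta>)"
      by (rule Bochner_Integration.integrable_bound[of _ "\<lambda>\<zeta>. f y * g \<zeta>"])
         (use g in \<open>auto simp: norm_mult cis_conv_exp\<close>)
  qed
qed

lemma fourier_multiplication_formula:
  assumes f: "integrable lborel f" and g: "integrable lborel g"
  shows "(LINT \<zeta>|lborel. fourier f \<zeta> * g \<zeta>) = (LINT y|lborel. f y * (LINT \<zeta>|lborel. cis (- (\<zeta> * y)) * g \<zeta>))"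
proof -
  have "(LINT \<zeta>|lborel. fourier f \<zeta> * g \<zeta>) = (LINT \<zeta>|lborel. (LINT y|lborel. cis (- (\<zeta> * y)) * f y * g \<zeta>))"
    by (simp add: fourier_def)
  also have "\<dots> = (LINT y|lborel. (LINT \<zeta>|lborel. cis (- (\<zeta> * y)) * f y * g \<zeta>))"
    using lborel_pair.Fubini_integral[OF integrable_fourier_kernel[OF f g]] .
  also have "\<dots> = (LINT y|lborel. f y * (LINT \<zeta>|lborel. cis (- (\<zeta> * y)) * g \<zeta>))"
    by (simp add: mult_ac flip: integral_mult_right_zero)
  finally show ?thesis .
qed

lemma fourier_measurable [measurable]:
  assumes "f \<in> borel_measurable lborel"
  shows "fourier f \<in> borel_measurable borel"
proof -
  have [measurable]: "f \<in> borel_measurable borel" using assms by simp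
  have "(\<lambda>\<zeta>. LINT y|lborel. (case (\<zeta>, y) of (\<zeta>, y) \<Rightarrow> cis (- (\<zeta> * y)) * f y)) \<in> borel_measurable lborel"
    by (rule lborel.borel_measurable_lebesgue_integral) (unfold cis_conv_exp, measurable)
  then show ?thesis by (simp add: fourier_def[abs_def])
qed

lemma norm_fourier_le:
  assumes "integrable lborel f"
  shows "norm (fourier f \<zeta>) \<le> (LINT y|lborel. norm (f y))"
proof -
  have "norm (fourier f \<zeta>) \<le> (LINT y|lborel. norm (cis (- (\<zeta> * y)) * f y))"
    unfolding fourier_def by (rule integral_norm_bound)
  then show ?thesis by (simp add: norm_mult)
qed

lemma integrable_fourier_mult:
  assumes f: "integrable lborel f" and g: "integrable lborel g"
  shows "integrable lborel (\<lambda>\<zeta>. fourier f \<zeta> * g \<zeta>)"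
proof (rule Bochner_Integration.integrable_bound)
  show "integrable lborel (\<lambda>\<zeta>. (LINT y|lborel. norm (f y)) * norm (g \<zeta>))"
    using g by (intro integrable_mult_right integrable_norm)
  have [measurable]: "fourier f \<in> borel_measurable borel" "g \<in> borel_measurable borel"
    using f g fourier_measurable by auto
  show "(\<lambda>\<zeta>. fourier f \<zeta> * g \<zeta>) \<in> borel_measurable lborel" by measurable
  have "0 \<le> (LINT y|lborel. norm (f y))" by simp
  then show "AE \<zeta> in lborel. norm (fourier f \<zeta> * g \<zeta>) \<le> norm ((LINT y|lborel. norm (f y)) * norm (g \<zeta>))"
    by (intro AE_I2) (simp add: norm_mult mult_right_mono norm_fourier_le[OF f])
qed

lemma fourier_std_normal:
  "(LINT \<zeta>|lborel. cis (a * \<zeta>) * of_real (std_normal_density \<zeta>)) = of_real (exp (- a\<^sup>2 / 2))"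
proof -
  have "complex_of_real (exp (- a\<^sup>2 / 2)) = char std_normal_distribution a"
    by (simp add: char_std_normal_distribution)
  also have "\<dots> = (LINT \<zeta>|lborel. std_normal_density \<zeta> *\<^sub>R cis (a * \<zeta>))"
    unfolding char_def cis_conv_exp by (subst integral_density) auto
  finally show ?thesis by (simp add: scaleR_conv_of_real mult.commute)
qed

text \<open>
  The transform of a Gaussian of width \<open>n\<close> is an approximate identity of width \<open>1 / n\<close>.
\<close>

lemma fourier_wide_gaussian:
  assumes n: "0 < (n::real)"
  shows "(LINT \<zeta>|lborel. cis (a * \<zeta>) * of_real (std_normal_density (\<zeta> / n)))
     = of_real (sqrt (2 * pi) * (n * std_normal_density (n * a)))"
proof -
  have "(LINT \<zeta>|lborel. cis (a * \<zeta>) * of_real (std_normal_density (\<zeta> / n)))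
     = \<bar>n\<bar> *\<^sub>R (LINT \<zeta>|lborel. cis (a * (0 + n * \<zeta>)) * of_real (std_normal_density ((0 + n * \<zeta>) / n)))"
    by (rule lborel_integral_real_affine) (use n in simp)
  also have "(LINT \<zeta>|lborel. cis (a * (0 + n * \<zeta>)) * of_real (std_normal_density ((0 + n * \<zeta>) / n)))
     = (LINT \<zeta>|lborel. cis ((n * a) * \<zeta>) * of_real (std_normal_density \<zeta>))"
    using n by (simp add: mult_ac)
  also have "\<dots> = of_real (exp (- (n * a)\<^sup>2 / 2))" by (rule fourier_std_normal)
  finally show ?thesis using n by (simp add: std_normal_density_def scaleR_conv_of_real)
qed

lemma integrable_wide_gaussian:
  assumes "0 < (n::real)"
  shows "integrable lborel (\<lambda>\<zeta>. std_normal_density (\<zeta> / n))"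
  using lborel_integrable_real_affine[of std_normal_density "1/n" 0] assms by simp

lemma integrable_modulated_wide_gaussian:
  assumes "0 < (n::real)"
  shows "integrable lborel (\<lambda>\<zeta>. cis (x * \<zeta>) * complex_of_real (std_normal_density (\<zeta> / n)))"
  by (rule Bochner_Integration.integrable_bound[OF integrable_wide_gaussian[OF assms]])
     (auto simp: norm_mult cis_conv_exp)

lemma narrow_gaussian:
  assumes "0 < (n::real)"
  shows "integrable lborel (\<lambda>y. n * std_normal_density (n * (x - y)))"
    and "(LINT y|lborel. n * std_normal_density (n * (x - y))) = 1"
proof -
  have eq: "n * std_normal_density (n * (x - y)) = normal_density x (1 / n) y" for y
  proof -
    have "(n * (x - y))\<^sup>2 = n\<^sup>2 * (y - x)\<^sup>2"
      by (simp add: power_mult_distrib power2_commute)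
    then show ?thesis
      using assms by (simp add: normal_density_def power_divide real_sqrt_divide real_sqrt_mult)
  qed
  show "integrable lborel (\<lambda>y. n * std_normal_density (n * (x - y)))"
    unfolding eq using assms by simp
  show "(LINT y|lborel. n * std_normal_density (n * (x - y))) = 1"
    unfolding eq using assms by simp
qed

lemma fourier_pairing_gaussian:
  assumes f: "integrable lborel f" and n: "0 < n"
  shows "(LINT \<zeta>|lborel. fourier f \<zeta> * (cis (x * \<zeta>) * of_real (std_normal_density (\<zeta> / n))))
    = of_real (sqrt (2 * pi)) * (LINT y|lborel. f y * of_real (n * std_normal_density (n * (x - y))))"
proof -
  have eq: "cis (- (\<zeta> * y)) * cis (x * \<zeta>) = cis ((x - y) * \<zeta>)" for \<zeta> y
    by (simp add: cis_mult algebra_simps)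
  have kernel: "(LINT \<zeta>|lborel. cis (- (\<zeta> * y)) * (cis (x * \<zeta>) * of_real (std_normal_density (\<zeta> / n))))
     = of_real (sqrt (2 * pi) * (n * std_normal_density (n * (x - y))))" for y
    using fourier_wide_gaussian[OF n, of "x - y"] by (simp only: mult.assoc[symmetric] eq)
  show ?thesis
    unfolding fourier_multiplication_formula[OF f integrable_modulated_wide_gaussian[OF n]] kernel
      integral_mult_right_zero[symmetric] of_real_mult
    by (simp only: mult_ac)
qed

text \<open>
  Half of Plancherel's theorem, for bounded functions such as truncations of \<open>A\<close>. Since
  \<^const>\<open>L2_norm\<close> of a function that is not square integrable is \<open>0\<close>, the limit in
  \<^const>\<open>plancherel_transform\<close> carries information only once square integrability is known.
  Applying the multiplication formula twice bounds the integral of \<open>|F f|\<^sup>2\<close> against wide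
  Gaussians by \<open>\<surd>(2\<pi>) M \<parallel>f\<parallel>\<^sub>1\<close> uniformly in their width; Fatou's lemma removes the Gaussian.
\<close>

lemma fourier_in_L2:
  assumes f: "integrable lborel f" and M: "\<And>y. norm (f y) \<le> M"
  shows "fourier f \<in> L2"
proof -
  have M0: "0 \<le> M" using M[of 0] norm_ge_zero order_trans by blast
  have [measurable]: "f \<in> borel_measurable borel" using f by auto
  have Fm [measurable]: "fourier f \<in> borel_measurable borel" by (rule fourier_measurable) simp
  define B where "B = sqrt (2 * pi) * M * (LINT y|lborel. norm (f y))"
  have B0: "0 \<le> B" unfolding B_def using M0 by (intro mult_nonneg_nonneg) auto
  have intF: "integrable lborel (\<lambda>\<zeta>. fourier f \<zeta> * cnj (fourier f \<zeta> * of_real (std_normal_density (\<zeta> / n))))"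
    and bd: "norm (LINT \<zeta>|lborel. fourier f \<zeta> * cnj (fourier f \<zeta> * of_real (std_normal_density (\<zeta> / n)))) \<le> B"
    if n: "0 < n" for n
  proof -
    let ?D = "\<lambda>\<zeta>. complex_of_real (std_normal_density (\<zeta> / n))"
    have D: "integrable lborel ?D" using integrable_wide_gaussian[OF n] by (simp add: of_real_def)
    have i1: "integrable lborel (\<lambda>\<zeta>. cnj (fourier f \<zeta> * ?D \<zeta>))"
      by (rule integrable_bounded_linear[OF bounded_linear_cnj integrable_fourier_mult[OF f D]])
    show "integrable lborel (\<lambda>\<zeta>. fourier f \<zeta> * cnj (fourier f \<zeta> * ?D \<zeta>))"
      by (rule integrable_fourier_mult[OF f i1])
    define P where "P y = (LINT \<zeta>|lborel. cis (- (\<zeta> * y)) * cnj (fourier f \<zeta> * ?D \<zeta>))" for y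
    have P: "norm (P y) \<le> sqrt (2 * pi) * M" for y
    proof -
      have "P y = cnj (LINT \<zeta>|lborel. fourier f \<zeta> * (cis (y * \<zeta>) * ?D \<zeta>))"
        unfolding P_def by (simp add: mult_ac cis_cnj flip: Bochner_Integration.integral_cnj)
      also have "norm \<dots> = sqrt (2 * pi) * norm (LINT z|lborel. f z * of_real (n * std_normal_density (n * (y - z))))"
        unfolding fourier_pairing_gaussian[OF f n] by (simp add: norm_mult)
      also have "norm (LINT z|lborel. f z * of_real (n * std_normal_density (n * (y - z))))
          \<le> (LINT z|lborel. M * (n * std_normal_density (n * (y - z))))"
      proof (rule Bochner_Integration.integral_norm_bound_integral)
        show i: "integrable lborel (\<lambda>z. M * (n * std_normal_density (n * (y - z))))"
          by (intro integrable_mult_right narrow_gaussian n)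
        show b: "norm (f z * of_real (n * std_normal_density (n * (y - z)))) \<le> M * (n * std_normal_density (n * (y - z)))" for z
          using n M[of z] normal_density_nonneg[of 0 1 "n * (y - z)"]
          by (simp add: norm_mult abs_mult mult_right_mono)
        show "integrable lborel (\<lambda>z. f z * of_real (n * std_normal_density (n * (y - z))))"
          by (rule Bochner_Integration.integrable_bound[OF i])
             (use b in \<open>auto intro: order_trans[OF _ abs_ge_self]\<close>)
      qed
      also have "\<dots> = M" using narrow_gaussian(2)[OF n, of y] by simp
      finally show ?thesis by (simp add: mult_left_mono)
    qed
    have "(LINT \<zeta>|lborel. fourier f \<zeta> * cnj (fourier f \<zeta> * ?D \<zeta>)) = (LINT y|lborel. f y * P y)"
      unfolding P_def by (rule fourier_multiplication_formula[OF f i1])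
    also have "norm \<dots> \<le> (LINT y|lborel. norm (f y * P y))" by (rule integral_norm_bound)
    also have "\<dots> \<le> (LINT y|lborel. norm (f y) * (sqrt (2 * pi) * M))"
    proof (rule integral_mono')
      show "integrable lborel (\<lambda>y. norm (f y) * (sqrt (2 * pi) * M))"
        by (intro integrable_mult_left integrable_norm f)
    qed (use P M0 in \<open>auto simp: norm_mult intro: mult_left_mono\<close>)
    also have "\<dots> = B" by (simp add: B_def mult_ac)
    finally show "norm (LINT \<zeta>|lborel. fourier f \<zeta> * cnj (fourier f \<zeta> * ?D \<zeta>)) \<le> B" .
  qed
  define G where "G n \<zeta> = (cmod (fourier f \<zeta>))\<^sup>2 * std_normal_density (\<zeta> / n)" for n \<zeta>
  have Geq: "fourier f \<zeta> * cnj (fourier f \<zeta> * of_real (std_normal_density (\<zeta> / n))) = of_real (G n \<zeta>)" for n \<zeta>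
  proof -
    have "fourier f \<zeta> * cnj (fourier f \<zeta>) = of_real ((cmod (fourier f \<zeta>))\<^sup>2)"
      by (rule complex_norm_square[symmetric])
    then show ?thesis by (simp only: G_def complex_cnj_mult complex_cnj_complex_of_real of_real_mult mult.assoc[symmetric])
  qed
  have Gi: "integrable lborel (G n)" and Gb: "(LINT \<zeta>|lborel. G n \<zeta>) \<le> B" if n: "0 < n" for n
  proof -
    show "integrable lborel (G n)"
      using intF[OF n] unfolding Geq by (simp add: complex_of_real_integrable_eq)
    have "norm (complex_of_real (LINT \<zeta>|lborel. G n \<zeta>)) \<le> B"
      using bd[OF n] unfolding Geq by simp
    then show "(LINT \<zeta>|lborel. G n \<zeta>) \<le> B" by simp
  qed
  have G0: "0 \<le> G n \<zeta>" for n \<zeta> unfolding G_def by simp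
  have Gm: "G n \<in> borel_measurable lborel" for n unfolding G_def by measurable
  let ?H = "\<lambda>\<zeta>. (cmod (fourier f \<zeta>))\<^sup>2 * std_normal_density 0"
  have lim: "(\<lambda>n. G (real (Suc n)) \<zeta>) \<longlonglongrightarrow> ?H \<zeta>" for \<zeta>
  proof -
    have "(\<lambda>n. \<zeta> / real (Suc n)) \<longlonglongrightarrow> 0" by real_asymp
    then have "(\<lambda>n. G (real (Suc n)) \<zeta>) \<longlonglongrightarrow> (cmod (fourier f \<zeta>))\<^sup>2 * ((1 / sqrt (2 * pi)) * exp (- 0\<^sup>2 / 2))"
      unfolding G_def std_normal_density_def by (intro tendsto_intros) auto
    then show ?thesis by (simp add: std_normal_density_def)
  qed
  have "integrable lborel ?H"
  proof (rule integrableI_nonneg)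
    show "AE x in lborel. 0 \<le> ?H x" by simp
    have "(\<integral>\<^sup>+ \<zeta>. ennreal (?H \<zeta>) \<partial>lborel) = (\<integral>\<^sup>+ \<zeta>. liminf (\<lambda>n. ennreal (G (real (Suc n)) \<zeta>)) \<partial>lborel)"
      by (intro nn_integral_cong lim_imp_Liminf[symmetric] tendsto_ennrealI lim) simp
    also have "\<dots> \<le> liminf (\<lambda>n. (\<integral>\<^sup>+ \<zeta>. ennreal (G (real (Suc n)) \<zeta>) \<partial>lborel))"
      by (rule nn_integral_liminf) (use Gm in auto)
    also have "\<dots> \<le> liminf (\<lambda>n::nat. ennreal B)"
    proof (rule Liminf_mono, rule always_eventually, rule allI)
      fix n
      have "(\<integral>\<^sup>+ \<zeta>. ennreal (G (real (Suc n)) \<zeta>) \<partial>lborel) = ennreal (LINT \<zeta>|lborel. G (real (Suc n)) \<zeta>)"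
        by (rule nn_integral_eq_integral) (auto intro: Gi G0)
      also have "\<dots> \<le> ennreal B" by (intro ennreal_leI Gb) simp
      finally show "(\<integral>\<^sup>+ \<zeta>. ennreal (G (real (Suc n)) \<zeta>) \<partial>lborel) \<le> ennreal B" .
    qed
    also have "\<dots> = ennreal B" by (simp add: Liminf_const)
    also have "\<dots> < \<infinity>" by simp
    finally show "(\<integral>\<^sup>+ \<zeta>. ennreal (?H \<zeta>) \<partial>lborel) < \<infinity>" .
  qed measurable
  from integrable_mult_right[OF this, of "sqrt (2 * pi)"]
  have "integrable lborel (\<lambda>\<zeta>. (cmod (fourier f \<zeta>))\<^sup>2)"
    by (simp add: std_normal_density_def)
  then show ?thesis using Fm by (simp add: L2_def)
qed

lemma L2_diff:
  assumes "f \<in> L2" "g \<in> L2"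
  shows "(\<lambda>x. f x - g x) \<in> L2"
proof -
  have [measurable]: "f \<in> borel_measurable borel" "g \<in> borel_measurable borel"
    using L2_D(1)[OF assms(1)] L2_D(1)[OF assms(2)] by auto
  have "integrable lborel (\<lambda>x. (cmod (f x - g x))\<^sup>2)"
  proof (rule Bochner_Integration.integrable_bound)
    show "integrable lborel (\<lambda>x. 2 * (cmod (f x))\<^sup>2 + 2 * (cmod (g x))\<^sup>2)"
      by (intro Bochner_Integration.integrable_add integrable_mult_right L2_D assms)
    show "AE x in lborel. norm ((cmod (f x - g x))\<^sup>2) \<le> norm (2 * (cmod (f x))\<^sup>2 + 2 * (cmod (g x))\<^sup>2)"
    proof (rule AE_I2)
      fix x
      have "(cmod (f x - g x))\<^sup>2 \<le> (cmod (f x) + cmod (g x))\<^sup>2"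
        by (intro power_mono norm_triangle_ineq4) auto
      also have "\<dots> \<le> 2 * (cmod (f x))\<^sup>2 + 2 * (cmod (g x))\<^sup>2"
        using sum_squares_bound[of "cmod (f x)" "cmod (g x)"] by (simp add: power2_sum)
      finally show "norm ((cmod (f x - g x))\<^sup>2) \<le> norm (2 * (cmod (f x))\<^sup>2 + 2 * (cmod (g x))\<^sup>2)"
        by simp
    qed
  qed measurable
  then show ?thesis by (simp add: L2_def)
qed

lemma std_normal_density_le_1: "std_normal_density x \<le> 1"
proof -
  have "1 \<le> sqrt (2 * pi)" using pi_gt3 by simp
  moreover have "exp (- x\<^sup>2 / 2) \<le> 1" by simp
  ultimately show ?thesis
    unfolding std_normal_density_def by (intro mult_le_one) (auto simp: divide_simps)
qed

lemma wide_gaussian_tendsto: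
  "(\<lambda>n. std_normal_density (\<zeta> / real (Suc n))) \<longlonglongrightarrow> 1 / sqrt (2 * pi)"
proof -
  have "(\<lambda>n. \<zeta> / real (Suc n)) \<longlonglongrightarrow> 0" by real_asymp
  then have "(\<lambda>n. std_normal_density (\<zeta> / real (Suc n))) \<longlonglongrightarrow> 1 / sqrt (2 * pi) * exp (- 0\<^sup>2 / 2)"
    unfolding std_normal_density_def by (intro tendsto_intros) auto
  then show ?thesis by simp
qed

text \<open>
  The formula holds for the truncations of \<open>A\<close> to \<open>[- k, k]\<close>. As \<open>k \<rightarrow> \<infinity>\<close>, the left-hand side
  converges by the Cauchy--Schwarz inequality, the right-hand side by dominated convergence.
\<close>

lemma plancherel_gaussian_pairing:
  assumes P: "plancherel_transform A g" and gi: "integrable lborel g"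
    and M: "\<And>y. norm (A y) \<le> M" and n: "0 < n"
  shows "(LINT \<zeta>|lborel. g \<zeta> * (cis (x * \<zeta>) * of_real (std_normal_density (\<zeta> / n))))
    = of_real (sqrt (2 * pi)) * (LINT y|lborel. A y * of_real (n * std_normal_density (n * (x - y))))"
proof -
  have A2: "A \<in> L2" and g2: "g \<in> L2"
    and lim: "((\<lambda>R. L2_norm (\<lambda>\<zeta>. fourier (\<lambda>y. indicat_real {-R..R} y *\<^sub>R A y) \<zeta> - g \<zeta>)) \<longlongrightarrow> 0) at_top"
    using P by (auto simp: plancherel_transform_def)
  have [measurable]: "A \<in> borel_measurable borel" "g \<in> borel_measurable borel"
    using L2_D(1)[OF A2] L2_D(1)[OF g2] by auto
  have M0: "0 \<le> M" using M[of 0] norm_ge_zero order_trans by blast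
  define f where "f k y = indicat_real {- real k..real k} y *\<^sub>R A y" for k :: nat and y
  define p where "p \<zeta> = cis (x * \<zeta>) * complex_of_real (std_normal_density (\<zeta> / n))" for \<zeta>
  have pm [measurable]: "p \<in> borel_measurable borel" unfolding p_def cis_conv_exp by measurable
  have np: "norm (p \<zeta>) = std_normal_density (\<zeta> / n)" for \<zeta> by (simp add: p_def norm_mult)
  have p1: "norm (p \<zeta>) \<le> 1" for \<zeta> unfolding np by (rule std_normal_density_le_1)
  have pi: "integrable lborel p" unfolding p_def by (rule integrable_modulated_wide_gaussian[OF n])
  have p2: "p \<in> L2"
  proof -
    have "integrable lborel (\<lambda>\<zeta>. (cmod (p \<zeta>))\<^sup>2)"
    proof (rule Bochner_Integration.integrable_bound[OF integrable_norm[OF pi]])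
      show "AE \<zeta> in lborel. norm ((cmod (p \<zeta>))\<^sup>2) \<le> norm (norm (p \<zeta>))"
        using p1 by (intro AE_I2) (simp add: power2_eq_square mult_left_le)
    qed measurable
    then show ?thesis by (simp add: L2_def)
  qed
  have fi: "integrable lborel (f k)" for k
  proof (rule Bochner_Integration.integrable_bound)
    show "integrable lborel (\<lambda>y. M * indicat_real {- real k..real k} y)"
      by (intro integrable_mult_right integrable_real_indicator) auto
    show "AE y in lborel. norm (f k y) \<le> norm (M * indicat_real {- real k..real k} y)"
      using M M0 by (intro AE_I2) (auto simp: f_def indicator_def)
  qed (simp add: f_def[abs_def])
  have fM: "norm (f k y) \<le> M" for k y using M[of y] M0 by (auto simp: f_def indicator_def)
  have F2: "fourier (f k) \<in> L2" for k by (rule fourier_in_L2[OF fi fM])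
  have gp: "integrable lborel (\<lambda>\<zeta>. g \<zeta> * p \<zeta>)"
    by (rule Bochner_Integration.integrable_bound[OF gi])
       (use p1 in \<open>auto simp: norm_mult intro!: AE_I2 mult_left_le\<close>)
  have bound: "norm ((LINT \<zeta>|lborel. fourier (f k) \<zeta> * p \<zeta>) - (LINT \<zeta>|lborel. g \<zeta> * p \<zeta>))
      \<le> L2_norm (\<lambda>\<zeta>. fourier (f k) \<zeta> - g \<zeta>) * L2_norm p" for k
  proof -
    have "(LINT \<zeta>|lborel. fourier (f k) \<zeta> * p \<zeta>) - (LINT \<zeta>|lborel. g \<zeta> * p \<zeta>)
       = (LINT \<zeta>|lborel. (fourier (f k) \<zeta> - g \<zeta>) * p \<zeta>)"
      using Bochner_Integration.integral_diff[OF integrable_fourier_mult[OF fi[of k] pi] gp]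
      by (simp add: left_diff_distrib)
    also have "norm \<dots> \<le> (LINT \<zeta>|lborel. cmod (fourier (f k) \<zeta> - g \<zeta>) * cmod (p \<zeta>))"
      using integral_norm_bound[of lborel "\<lambda>\<zeta>. (fourier (f k) \<zeta> - g \<zeta>) * p \<zeta>"] by (simp add: norm_mult)
    also have "\<dots> \<le> L2_norm (\<lambda>\<zeta>. fourier (f k) \<zeta> - g \<zeta>) * L2_norm p"
      by (rule L2_Cauchy_Schwarz[OF L2_diff[OF F2 g2] p2])
    finally show ?thesis .
  qed
  have lim': "(\<lambda>k. L2_norm (\<lambda>\<zeta>. fourier (f k) \<zeta> - g \<zeta>)) \<longlonglongrightarrow> 0"
    using filterlim_compose[OF lim filterlim_real_sequentially] by (simp add: f_def[abs_def])
  have "(\<lambda>k. (LINT \<zeta>|lborel. fourier (f k) \<zeta> * p \<zeta>)) \<longlonglongrightarrow> (LINT \<zeta>|lborel. g \<zeta> * p \<zeta>)"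
  proof (rule LIM_zero_cancel, rule Lim_null_comparison)
    show "\<forall>\<^sub>F k in sequentially. norm ((LINT \<zeta>|lborel. fourier (f k) \<zeta> * p \<zeta>) - (LINT \<zeta>|lborel. g \<zeta> * p \<zeta>))
      \<le> L2_norm (\<lambda>\<zeta>. fourier (f k) \<zeta> - g \<zeta>) * L2_norm p"
      using bound by (intro always_eventually allI)
    show "(\<lambda>k. L2_norm (\<lambda>\<zeta>. fourier (f k) \<zeta> - g \<zeta>) * L2_norm p) \<longlonglongrightarrow> 0"
      using lim' by (rule tendsto_mult_left_zero)
  qed
  moreover have "(\<lambda>k. (LINT \<zeta>|lborel. fourier (f k) \<zeta> * p \<zeta>)) \<longlonglongrightarrow>
     of_real (sqrt (2 * pi)) * (LINT y|lborel. A y * of_real (n * std_normal_density (n * (x - y))))"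
    unfolding p_def fourier_pairing_gaussian[OF fi n]
  proof (rule tendsto_mult_left, rule integral_dominated_convergence)
    show "integrable lborel (\<lambda>y. M * (n * std_normal_density (n * (x - y))))"
      by (intro integrable_mult_right narrow_gaussian n)
    show "AE y in lborel. (\<lambda>k. f k y * of_real (n * std_normal_density (n * (x - y))))
        \<longlonglongrightarrow> A y * of_real (n * std_normal_density (n * (x - y)))"
    proof (rule AE_I2)
      fix y
      have "\<forall>\<^sub>F k in sequentially. A y = f k y"
        using eventually_ge_at_top[of "nat \<lceil>\<bar>y\<bar>\<rceil>"]
      proof eventually_elim
        case (elim k)
        then have "\<bar>y\<bar> \<le> real k" by linarith
        then show ?case by (auto simp: f_def indicator_def)
      qed
      then have "(\<lambda>k. f k y) \<longlonglongrightarrow> A y" by (rule Lim_transform_eventually[OF tendsto_const])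
      then show "(\<lambda>k. f k y * of_real (n * std_normal_density (n * (x - y))))
        \<longlonglongrightarrow> A y * of_real (n * std_normal_density (n * (x - y)))"
        by (intro tendsto_intros)
    qed
    show "AE y in lborel. norm (f k y * of_real (n * std_normal_density (n * (x - y)))) \<le> M * (n * std_normal_density (n * (x - y)))" for k
      using fM n by (intro AE_I2) (auto simp: norm_mult abs_mult intro!: mult_right_mono)
  qed (simp_all add: f_def[abs_def])
  ultimately show ?thesis unfolding p_def by (rule LIMSEQ_unique)
qed

text \<open>
  The wide Gaussian on the frequency side flattens to a constant, while its transform
  concentrates at \<open>x\<close>, where the continuous function \<open>A\<close> can be evaluated.
\<close>

lemma fourier_inversion:
  assumes P: "plancherel_transform A g" and gi: "integrable lborel g"
    and M: "\<And>y. norm (A y) \<le> M" and cont: "continuous_on UNIV A"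
  shows "A x = of_real (1 / (2 * pi)) * (LINT \<zeta>|lborel. cis (x * \<zeta>) * g \<zeta>)"
proof -
  have A2: "A \<in> L2" and g2: "g \<in> L2"
    using P by (auto simp: plancherel_transform_def)
  have [measurable]: "A \<in> borel_measurable borel" "g \<in> borel_measurable borel"
    using L2_D(1)[OF A2] L2_D(1)[OF g2] by auto
  let ?n = "\<lambda>k::nat. real (Suc k)"
  have "(\<lambda>k. (LINT \<zeta>|lborel. g \<zeta> * (cis (x * \<zeta>) * of_real (std_normal_density (\<zeta> / ?n k)))))
     \<longlonglongrightarrow> (LINT \<zeta>|lborel. g \<zeta> * (cis (x * \<zeta>) * of_real (1 / sqrt (2 * pi))))"
  proof (rule integral_dominated_convergence)
    show "integrable lborel (\<lambda>\<zeta>. norm (g \<zeta>))" using gi by (rule integrable_norm)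
    show "AE \<zeta> in lborel. (\<lambda>k. g \<zeta> * (cis (x * \<zeta>) * of_real (std_normal_density (\<zeta> / ?n k))))
       \<longlonglongrightarrow> g \<zeta> * (cis (x * \<zeta>) * of_real (1 / sqrt (2 * pi)))"
      by (intro AE_I2 tendsto_intros wide_gaussian_tendsto)
    show "AE \<zeta> in lborel. norm (g \<zeta> * (cis (x * \<zeta>) * of_real (std_normal_density (\<zeta> / ?n k)))) \<le> norm (g \<zeta>)" for k
      using std_normal_density_le_1 by (intro AE_I2) (simp add: norm_mult mult_left_le)
  qed (simp_all add: cis_conv_exp)
  moreover have "(\<lambda>k. (LINT \<zeta>|lborel. g \<zeta> * (cis (x * \<zeta>) * of_real (std_normal_density (\<zeta> / ?n k)))))
     \<longlonglongrightarrow> of_real (sqrt (2 * pi)) * (LINT v|lborel. A x * of_real (std_normal_density v))"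
  proof -
    have "(LINT y|lborel. A y * of_real (?n k * std_normal_density (?n k * (x - y))))
       = (LINT v|lborel. A (x - v / ?n k) * of_real (std_normal_density v))" for k
    proof -
      have "(LINT y|lborel. A y * of_real (?n k * std_normal_density (?n k * (x - y))))
        = \<bar>- 1 / ?n k\<bar> *\<^sub>R (LINT v|lborel. A (x + (- 1 / ?n k) * v) * of_real (?n k * std_normal_density (?n k * (x - (x + (- 1 / ?n k) * v)))))"
        by (rule lborel_integral_real_affine) simp
      also have "\<dots> = (LINT v|lborel. \<bar>- 1 / ?n k\<bar> *\<^sub>R (A (x + (- 1 / ?n k) * v) * of_real (?n k * std_normal_density (?n k * (x - (x + (- 1 / ?n k) * v))))))"
        by (rule integral_scaleR_right[symmetric])
      also have "\<dots> = (LINT v|lborel. A (x - v / ?n k) * of_real (std_normal_density v))"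
      proof (intro Bochner_Integration.integral_cong refl)
        fix v
        have 1: "x + (- 1 / ?n k) * v = x - v / ?n k" by simp
        have 2: "?n k * (x - (x - v / ?n k)) = v" by simp
        have 3: "\<bar>- 1 / ?n k\<bar> *\<^sub>R (w * of_real (?n k * d)) = w * of_real d" for w :: complex and d
          by (simp add: scaleR_conv_of_real del: of_nat_Suc)
        show "\<bar>- 1 / ?n k\<bar> *\<^sub>R (A (x + (- 1 / ?n k) * v) * of_real (?n k * std_normal_density (?n k * (x - (x + (- 1 / ?n k) * v)))))
          = A (x - v / ?n k) * of_real (std_normal_density v)"
          unfolding 1 2 3 ..
      qed
      finally show ?thesis .
    qed
    then have "(LINT \<zeta>|lborel. g \<zeta> * (cis (x * \<zeta>) * of_real (std_normal_density (\<zeta> / ?n k))))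
      = of_real (sqrt (2 * pi)) * (LINT v|lborel. A (x - v / ?n k) * of_real (std_normal_density v))" for k
      using plancherel_gaussian_pairing[OF P gi M, of "?n k" x] by simp
    moreover have "(\<lambda>k. of_real (sqrt (2 * pi)) * (LINT v|lborel. A (x - v / ?n k) * of_real (std_normal_density v)))
      \<longlonglongrightarrow> of_real (sqrt (2 * pi)) * (LINT v|lborel. A x * of_real (std_normal_density v))"
    proof (rule tendsto_mult_left, rule integral_dominated_convergence)
      show "integrable lborel (\<lambda>v. M * std_normal_density v)" by (intro integrable_mult_right) simp
      show "AE v in lborel. (\<lambda>k. A (x - v / ?n k) * of_real (std_normal_density v)) \<longlonglongrightarrow> A x * of_real (std_normal_density v)"
      proof (rule AE_I2)
        fix v
        have "(\<lambda>k. v / ?n k) \<longlonglongrightarrow> 0" by real_asymp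
        then have "(\<lambda>k. x - v / ?n k) \<longlonglongrightarrow> x - 0" by (intro tendsto_intros)
        moreover have "isCont A x" using cont by (simp add: continuous_on_eq_continuous_at)
        ultimately have "(\<lambda>k. A (x - v / ?n k)) \<longlonglongrightarrow> A x"
          by (intro isCont_tendsto_compose[of x A]) auto
        then show "(\<lambda>k. A (x - v / ?n k) * of_real (std_normal_density v)) \<longlonglongrightarrow> A x * of_real (std_normal_density v)"
          by (intro tendsto_intros)
      qed
      show "AE v in lborel. norm (A (x - v / ?n k) * of_real (std_normal_density v)) \<le> M * std_normal_density v" for k
        using M by (intro AE_I2) (auto simp: norm_mult intro!: mult_right_mono)
    qed simp_all
    ultimately show ?thesis by simp
  qed
  ultimately have "(LINT \<zeta>|lborel. g \<zeta> * (cis (x * \<zeta>) * of_real (1 / sqrt (2 * pi))))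
     = of_real (sqrt (2 * pi)) * (LINT v|lborel. A x * of_real (std_normal_density v))"
    by (rule LIMSEQ_unique)
  moreover have "(LINT v|lborel. A x * of_real (std_normal_density v)) = A x"
  proof -
    have "(LINT v|lborel. A x * of_real (std_normal_density v)) = A x * of_real (LINT v|lborel. std_normal_density v)"
      by (simp del: integral_normal_density)
    then show ?thesis by simp
  qed
  moreover have "(LINT \<zeta>|lborel. g \<zeta> * (cis (x * \<zeta>) * of_real (1 / sqrt (2 * pi))))
    = of_real (1 / sqrt (2 * pi)) * (LINT \<zeta>|lborel. cis (x * \<zeta>) * g \<zeta>)"
    unfolding integral_mult_right_zero[symmetric] by (simp only: mult_ac)
  ultimately have "of_real (1 / sqrt (2 * pi)) * (LINT \<zeta>|lborel. cis (x * \<zeta>) * g \<zeta>) = of_real (sqrt (2 * pi)) * A x"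
    by simp
  then have "of_real (1 / sqrt (2 * pi)) * (of_real (1 / sqrt (2 * pi)) * (LINT \<zeta>|lborel. cis (x * \<zeta>) * g \<zeta>))
     = of_real (1 / sqrt (2 * pi)) * (of_real (sqrt (2 * pi)) * A x)"
    by simp
  moreover have "complex_of_real (1 / sqrt (2 * pi)) * of_real (1 / sqrt (2 * pi)) = of_real (1 / (2 * pi))"
    by (simp flip: of_real_mult real_sqrt_mult)
  moreover have "complex_of_real (1 / sqrt (2 * pi)) * of_real (sqrt (2 * pi)) = 1"
    by (simp flip: of_real_mult)
  ultimately show ?thesis by (simp add: mult.assoc[symmetric] del: of_real_divide)
qed

lemma norm_cis_minus_1_le: "norm (cis a - 1) \<le> \<bar>a\<bar>"
  using iexp_approx1[of a 0] by (simp add: cis_conv_exp)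

lemma norm_cis_minus_1_le_powr: "norm (cis a - 1) \<le> 2 * \<bar>a\<bar> powr (1/4)"
proof (cases "\<bar>a\<bar> \<le> 1")
  case True
  have "\<bar>a\<bar> \<le> \<bar>a\<bar> powr (1/4)"
    using powr_mono'[of "1/4" 1 "\<bar>a\<bar>"] True by simp
  then show ?thesis using norm_cis_minus_1_le[of a] powr_ge_zero[of "\<bar>a\<bar>" "1/4"] by linarith
next
  case False
  have "norm (cis a - 1) \<le> norm (cis a) + norm (1::complex)" by (rule norm_triangle_ineq4)
  then have "norm (cis a - 1) \<le> 2" by simp
  moreover have "1 \<le> \<bar>a\<bar> powr (1/4)" using False by (intro ge_one_powr_ge_zero) auto
  ultimately show ?thesis by linarith
qed

text \<open>
  Young's inequality splits the integrand into \<open>\<langle>\<zeta>\<rangle>\<^sup>7\<^sup>/\<^sup>4 |g|\<^sup>2\<close> and \<open>\<langle>\<zeta>\<rangle>\<^sup>-\<^sup>5\<^sup>/\<^sup>4\<close>.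
\<close>

lemma Hs_hat_integrable:
  assumes "g \<in> Hs_hat (7/8)"
  shows "integrable lborel (\<lambda>\<zeta>. cmod (g \<zeta>) * jbr \<zeta> powr (1/4))"
proof (rule Bochner_Integration.integrable_bound)
  have gm [measurable]: "g \<in> borel_measurable borel" and gi: "integrable lborel (\<lambda>\<zeta>. jbr \<zeta> powr (7/4) * (cmod (g \<zeta>))\<^sup>2)"
    using assms by (auto simp: Hs_hat_def)
  show "integrable lborel (\<lambda>\<zeta>. jbr \<zeta> powr (7/4) * (cmod (g \<zeta>))\<^sup>2 + jbr \<zeta> powr (- (5/4)))"
    by (intro Bochner_Integration.integrable_add gi integrable_jbr_powr) simp
  show "AE \<zeta> in lborel. norm (cmod (g \<zeta>) * jbr \<zeta> powr (1/4)) \<le> norm (jbr \<zeta> powr (7/4) * (cmod (g \<zeta>))\<^sup>2 + jbr \<zeta> powr (- (5/4)))"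
  proof (rule AE_I2)
    fix \<zeta>
    let ?a = "cmod (g \<zeta>) * jbr \<zeta> powr (7/8)" and ?b = "jbr \<zeta> powr (- (5/8))"
    have j: "0 < jbr \<zeta>" using jbr_ge_1[of \<zeta>] by linarith
    have "2 * ?a * ?b \<le> ?a\<^sup>2 + ?b\<^sup>2" by (rule sum_squares_bound)
    moreover have "0 \<le> ?a * ?b" by simp
    ultimately have "?a * ?b \<le> ?a\<^sup>2 + ?b\<^sup>2" by linarith
    moreover have "?a * ?b = cmod (g \<zeta>) * jbr \<zeta> powr (1/4)"
      by (simp add: mult.assoc flip: powr_add)
    moreover have "?a\<^sup>2 = jbr \<zeta> powr (7/4) * (cmod (g \<zeta>))\<^sup>2" "?b\<^sup>2 = jbr \<zeta> powr (- (5/4))"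
      by (simp_all add: power2_eq_square mult_ac flip: powr_add)
    ultimately show "norm (cmod (g \<zeta>) * jbr \<zeta> powr (1/4)) \<le> norm (jbr \<zeta> powr (7/4) * (cmod (g \<zeta>))\<^sup>2 + jbr \<zeta> powr (- (5/4)))"
      by simp
  qed
  show "(\<lambda>\<zeta>. cmod (g \<zeta>) * jbr \<zeta> powr (1/4)) \<in> borel_measurable lborel" by measurable
qed

text \<open>
  By Fourier inversion the increment of \<open>A\<close> is controlled by the integral of
  \<open>|g(\<zeta>)| |cis ((x - y) \<zeta>) - 1|\<close>, and the second factor is at most \<open>2 |x - y|\<^sup>1\<^sup>/\<^sup>4 |\<zeta>|\<^sup>1\<^sup>/\<^sup>4\<close>.
\<close>

lemma Sobolev_Hoelder:
  assumes A: "A \<in> L2_Hs (7/8)" and M: "\<And>y. norm (A y) \<le> M" and cont: "continuous_on UNIV A"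
  obtains H where "0 \<le> H" "\<And>x y. norm (A x - A y) \<le> H * \<bar>x - y\<bar> powr (1/4)"
proof -
  obtain g where P: "plancherel_transform A g" and gH: "g \<in> Hs_hat (7/8)"
    using A by (auto simp: L2_Hs_def)
  have gm [measurable]: "g \<in> borel_measurable borel" using gH by (auto simp: Hs_hat_def)
  note gj = Hs_hat_integrable[OF gH]
  have j1: "1 \<le> jbr \<zeta> powr (1/4)" for \<zeta> using jbr_ge_1 by (intro ge_one_powr_ge_zero) auto
  have gi: "integrable lborel g"
  proof (rule Bochner_Integration.integrable_bound[OF gj])
    show "AE \<zeta> in lborel. norm (g \<zeta>) \<le> norm (cmod (g \<zeta>) * jbr \<zeta> powr (1/4))"
      using mult_left_mono[OF j1, of "cmod (g _)"] by (intro AE_I2) simp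
  qed simp
  define H where "H = 1 / (2 * pi) * (LINT \<zeta>|lborel. 2 * (cmod (g \<zeta>) * jbr \<zeta> powr (1/4)))"
  have "norm (A x - A y) \<le> H * \<bar>x - y\<bar> powr (1/4)" for x y
  proof -
    have ci: "integrable lborel (\<lambda>\<zeta>. cis (z * \<zeta>) * g \<zeta>)" for z
      by (rule Bochner_Integration.integrable_bound[OF gi]) (auto simp: norm_mult cis_conv_exp)
    have "A x - A y = of_real (1 / (2 * pi)) * (LINT \<zeta>|lborel. cis (x * \<zeta>) * g \<zeta> - cis (y * \<zeta>) * g \<zeta>)"
      using fourier_inversion[OF P gi M cont, of x] fourier_inversion[OF P gi M cont, of y] ci
      by (simp add: right_diff_distrib)
    then have n1: "norm (A x - A y) = 1 / (2 * pi) * norm (LINT \<zeta>|lborel. cis (x * \<zeta>) * g \<zeta> - cis (y * \<zeta>) * g \<zeta>)"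
      by (simp add: norm_mult norm_divide)
    have n2: "norm (LINT \<zeta>|lborel. cis (x * \<zeta>) * g \<zeta> - cis (y * \<zeta>) * g \<zeta>)
      \<le> (LINT \<zeta>|lborel. \<bar>x - y\<bar> powr (1/4) * (2 * (cmod (g \<zeta>) * jbr \<zeta> powr (1/4))))"
    proof (rule Bochner_Integration.integral_norm_bound_integral)
      show "integrable lborel (\<lambda>\<zeta>. cis (x * \<zeta>) * g \<zeta> - cis (y * \<zeta>) * g \<zeta>)"
        by (intro Bochner_Integration.integrable_diff ci)
      show "integrable lborel (\<lambda>\<zeta>. \<bar>x - y\<bar> powr (1/4) * (2 * (cmod (g \<zeta>) * jbr \<zeta> powr (1/4))))"
        by (intro integrable_mult_right gj)
      fix \<zeta>
      have "cis (x * \<zeta>) * g \<zeta> - cis (y * \<zeta>) * g \<zeta> = cis (y * \<zeta>) * (cis ((x - y) * \<zeta>) - 1) * g \<zeta>"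
        by (simp add: algebra_simps cis_mult)
      then have "norm (cis (x * \<zeta>) * g \<zeta> - cis (y * \<zeta>) * g \<zeta>) = norm (cis ((x - y) * \<zeta>) - 1) * norm (g \<zeta>)"
        by (simp add: norm_mult)
      also have "\<dots> \<le> (2 * \<bar>(x - y) * \<zeta>\<bar> powr (1/4)) * norm (g \<zeta>)"
        by (intro mult_right_mono norm_cis_minus_1_le_powr) simp
      also have "\<dots> = \<bar>x - y\<bar> powr (1/4) * (2 * (cmod (g \<zeta>) * \<bar>\<zeta>\<bar> powr (1/4)))"
        by (simp add: abs_mult powr_mult)
      also have "\<dots> \<le> \<bar>x - y\<bar> powr (1/4) * (2 * (cmod (g \<zeta>) * jbr \<zeta> powr (1/4)))"
        by (intro mult_left_mono powr_mono2 jbr_ge_abs) auto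
      finally show "norm (cis (x * \<zeta>) * g \<zeta> - cis (y * \<zeta>) * g \<zeta>) \<le> \<bar>x - y\<bar> powr (1/4) * (2 * (cmod (g \<zeta>) * jbr \<zeta> powr (1/4)))" .
    qed
    have n3: "1 / (2 * pi) * (LINT \<zeta>|lborel. \<bar>x - y\<bar> powr (1/4) * (2 * (cmod (g \<zeta>) * jbr \<zeta> powr (1/4))))
        = H * \<bar>x - y\<bar> powr (1/4)"
      by (simp add: H_def)
    show ?thesis unfolding n1 n3[symmetric] by (rule mult_left_mono[OF n2]) simp
  qed
  moreover have "0 \<le> H" unfolding H_def by (intro mult_nonneg_nonneg integral_nonneg_AE) auto
  ultimately show thesis by (intro that)
qed

section \<open>The quintic nonlinearity and continuity of the source in time\<close>

text \<open>
  When \<open>f\<close> is not integrable, its Bochner integral is \<open>0\<close> and the bound is the nonnegativity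
  of \<open>g\<close>.
\<close>

lemma norm_integral_le_AE:
  fixes f :: "real \<Rightarrow> complex" and g :: "real \<Rightarrow> real"
  assumes "integrable lborel g" "AE x in lborel. norm (f x) \<le> g x"
  shows "norm (LINT x|lborel. f x) \<le> (LINT x|lborel. g x)"
proof -
  have g: "AE x in lborel. 0 \<le> g x"
    using assms(2) by eventually_elim (rule order_trans[OF norm_ge_zero])
  have "norm (LINT x|lborel. f x) \<le> (LINT x|lborel. norm (f x))" by (rule integral_norm_bound)
  also have "\<dots> \<le> (LINT x|lborel. g x)"
    by (rule integral_mono_AE'[OF assms g])
  finally show ?thesis .
qed

definition quintic :: "complex \<Rightarrow> complex" where
  "quintic z = of_real (cmod z ^ 4) * z"

lemma quintic_measurable [measurable]: "quintic \<in> borel_measurable borel"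
  unfolding quintic_def by measurable

lemma norm_quintic: "norm (quintic z) = cmod z ^ 5"
  by (simp add: quintic_def norm_mult norm_power flip: power_Suc2)

lemma norm_diff_squares_le: "\<bar>(cmod a)\<^sup>2 - (cmod b)\<^sup>2\<bar> \<le> (cmod a + cmod b) * cmod (a - b)"
proof -
  have "(cmod a)\<^sup>2 - (cmod b)\<^sup>2 = (cmod a + cmod b) * (cmod a - cmod b)"
    by (simp add: power2_eq_square algebra_simps)
  then have "\<bar>(cmod a)\<^sup>2 - (cmod b)\<^sup>2\<bar> = (cmod a + cmod b) * \<bar>cmod a - cmod b\<bar>"
    by (simp add: abs_mult)
  then show ?thesis by (simp add: mult_left_mono norm_triangle_ineq3)
qed

text \<open>
  The factor \<open>|a| + |b|\<close> is kept so that, after integration, the bound involves only \<open>L\<^sup>2\<close> norms.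
\<close>

lemma cubic_lipschitz:
  assumes "cmod a \<le> M" "cmod b \<le> M"
  shows "cmod (of_real ((cmod a)\<^sup>2) * a - of_real ((cmod b)\<^sup>2) * b) \<le> 2 * M * (cmod a + cmod b) * cmod (a - b)"
proof -
  let ?d = "cmod (a - b)"
  have "of_real ((cmod a)\<^sup>2) * a - of_real ((cmod b)\<^sup>2) * b
     = of_real ((cmod a)\<^sup>2) * (a - b) + of_real ((cmod a)\<^sup>2 - (cmod b)\<^sup>2) * b"
    by (simp add: algebra_simps)
  also have "cmod \<dots> \<le> (cmod a)\<^sup>2 * ?d + \<bar>(cmod a)\<^sup>2 - (cmod b)\<^sup>2\<bar> * cmod b"
    by (rule order_trans[OF norm_triangle_ineq]) (simp add: norm_mult del: of_real_power of_real_diff)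
  also have "\<dots> \<le> (M * cmod a) * ?d + ((cmod a + cmod b) * ?d) * M"
    using assms by (intro add_mono mult_right_mono mult_mono norm_diff_squares_le)
      (auto simp: power2_eq_square intro: mult_right_mono)
  also have "\<dots> \<le> 2 * M * (cmod a + cmod b) * ?d"
  proof -
    have "0 \<le> M" using assms(1) norm_ge_zero order_trans by blast
    then have "0 \<le> M * cmod b * ?d" by simp
    then show ?thesis by (simp add: algebra_simps)
  qed
  finally show ?thesis .
qed

lemma quintic_lipschitz:
  assumes "cmod a \<le> M" "cmod b \<le> M"
  shows "cmod (quintic a - quintic b) \<le> 3 * M ^ 3 * (cmod a + cmod b) * cmod (a - b)"
proof -
  let ?d = "cmod (a - b)"
  have M: "0 \<le> M" using assms(1) norm_ge_zero order_trans by blast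
  have "quintic a - quintic b = of_real (cmod a ^ 4) * (a - b) + of_real (cmod a ^ 4 - cmod b ^ 4) * b"
    by (simp add: quintic_def algebra_simps)
  also have "cmod \<dots> \<le> cmod a ^ 4 * ?d + \<bar>cmod a ^ 4 - cmod b ^ 4\<bar> * cmod b"
    by (rule order_trans[OF norm_triangle_ineq]) (simp add: norm_mult norm_power del: of_real_diff of_real_power)
  also have "cmod a ^ 4 * ?d \<le> (M ^ 3 * cmod a) * ?d"
  proof -
    have "cmod a ^ 4 = cmod a ^ 3 * cmod a" by (simp flip: power_Suc2)
    also have "\<dots> \<le> M ^ 3 * cmod a" using assms by (intro mult_right_mono power_mono) auto
    finally show ?thesis by (rule mult_right_mono) simp
  qed
  also have "\<bar>cmod a ^ 4 - cmod b ^ 4\<bar> * cmod b \<le> (2 * M\<^sup>2 * ((cmod a + cmod b) * ?d)) * M"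
  proof (rule mult_mono)
    have "cmod a ^ 4 - cmod b ^ 4 = ((cmod a)\<^sup>2 + (cmod b)\<^sup>2) * ((cmod a)\<^sup>2 - (cmod b)\<^sup>2)"
      by (simp add: algebra_simps flip: power_add)
    then have "\<bar>cmod a ^ 4 - cmod b ^ 4\<bar> = ((cmod a)\<^sup>2 + (cmod b)\<^sup>2) * \<bar>(cmod a)\<^sup>2 - (cmod b)\<^sup>2\<bar>"
      by (simp add: abs_mult)
    also have "\<dots> \<le> (2 * M\<^sup>2) * ((cmod a + cmod b) * ?d)"
    proof (rule mult_mono)
      have "(cmod a)\<^sup>2 \<le> M\<^sup>2" "(cmod b)\<^sup>2 \<le> M\<^sup>2" using assms by (auto intro: power_mono)
      then show "(cmod a)\<^sup>2 + (cmod b)\<^sup>2 \<le> 2 * M\<^sup>2" by simp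
    qed (use norm_diff_squares_le in auto)
    finally show "\<bar>cmod a ^ 4 - cmod b ^ 4\<bar> \<le> 2 * M\<^sup>2 * ((cmod a + cmod b) * ?d)" .
  qed (use assms M in auto)
  finally have "cmod (quintic a - quintic b) \<le> M ^ 3 * cmod a * ?d + 2 * M ^ 3 * (cmod a + cmod b) * ?d"
    by (simp add: power3_eq_cube power2_eq_square mult_ac)
  also have "\<dots> \<le> 3 * M ^ 3 * (cmod a + cmod b) * ?d"
  proof -
    have "0 \<le> M ^ 3 * cmod b * ?d" using M by simp
    then show ?thesis by (simp add: algebra_simps)
  qed
  finally show ?thesis .
qed

lemma quintic_lipschitz_ball:
  assumes "cmod a \<le> M" "cmod b \<le> M"
  shows "cmod (quintic a - quintic b) \<le> 6 * M ^ 4 * cmod (a - b)"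
proof -
  have M: "0 \<le> M" using assms(1) norm_ge_zero order_trans by blast
  have "3 * M ^ 3 * (cmod a + cmod b) * cmod (a - b) \<le> 3 * M ^ 3 * (2 * M) * cmod (a - b)"
    using assms M by (intro mult_right_mono mult_left_mono) auto
  also have "\<dots> = 6 * M ^ 4 * cmod (a - b)" by (simp add: power_numeral_reduce)
  finally show ?thesis using quintic_lipschitz[OF assms] by linarith
qed

lemma Linf_AE_le:
  assumes "f \<in> Linf" "Linf_norm f \<le> b"
  shows "AE x in lborel. cmod (f x) \<le> b"
proof -
  let ?e = "esssup lborel (\<lambda>x. ereal (cmod (f x)))"
  have fin: "?e < \<infinity>" using assms by (auto simp: Linf_def)
  have "AE x in lborel. ereal (cmod (f x)) \<le> ?e" by (rule esssup_AE)
  then show ?thesis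
  proof eventually_elim
    case (elim x)
    from elim fin obtain r where r: "?e = ereal r" by (cases ?e) auto
    then show ?case using elim assms(2) by (simp add: Linf_norm_def)
  qed
qed

text \<open>
  The set where the bound fails is open, and a nonempty open set is not null.
\<close>

lemma AE_bounded_continuous:
  fixes A :: "real \<Rightarrow> complex"
  assumes "continuous_on UNIV A" "AE x in lborel. cmod (A x) \<le> b"
  shows "cmod (A x) \<le> b"
proof (rule ccontr)
  assume "\<not> cmod (A x) \<le> b"
  let ?S = "{x. b < cmod (A x)}"
  have "open ?S" using assms(1) by (intro open_Collect_less continuous_intros) auto
  moreover have "?S \<in> null_sets lborel"
  proof (rule AE_iff_null_sets[THEN iffD2])
    show "?S \<in> sets lborel" using \<open>open ?S\<close> by simp
    show "AE x in lborel. x \<notin> ?S" using assms(2) by eventually_elim auto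
  qed
  moreover have "x \<in> ?S" using \<open>\<not> cmod (A x) \<le> b\<close> by simp
  ultimately show False
    using open_not_negligible[of ?S] by (auto simp: negligible_iff_null_sets intro: null_sets_completionI)
qed

lemma L2_norm_le_Sigma_norm: "L2_norm f \<le> Sigma_norm f"
proof -
  have "L2_norm f \<le> H1_norm f"
    unfolding H1_norm_def by (rule real_le_rsqrt) simp
  then show ?thesis unfolding Sigma_norm_def using L2_norm_nonneg[of "\<lambda>x. complex_of_real x * f x"] by linarith
qed

text \<open>
  Used with \<open>V = 1\<close> for the cubic term and with the travelling potential for the quintic one.
  With \<open>d = u\<^sub>s - u\<^sub>t\<close> the \<open>L\<^sup>1\<close> distance of the two sources is at most
  \<open>K L (\<parallel>d\<parallel>\<^sup>2 + 2 \<parallel>d\<parallel> \<parallel>u\<^sub>t\<parallel>) + K L |s - t| \<parallel>u\<^sub>t\<parallel>\<^sup>2\<close>. Time continuity of the sources is what makes the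
  Duhamel integrals genuine integrals that may be split.
\<close>

lemma fourier_source:
  fixes u :: "real \<Rightarrow> real \<Rightarrow> complex" and V :: "real \<Rightarrow> real \<Rightarrow> real" and N :: "complex \<Rightarrow> complex"
  assumes u: "\<And>s. 1 \<le> s \<Longrightarrow> u s \<in> L2" "\<And>s. 1 \<le> s \<Longrightarrow> AE y in lborel. cmod (u s y) \<le> M"
    and u_cont: "\<And>t. 1 \<le> t \<Longrightarrow> ((\<lambda>s. L2_norm (\<lambda>y. u s y - u t y)) \<longlongrightarrow> 0) (at t within {1..})"
    and V: "\<And>s. V s \<in> borel_measurable borel" "\<And>s y. \<bar>V s y\<bar> \<le> K" "\<And>s t y. \<bar>V s y - V t y\<bar> \<le> K * \<bar>s - t\<bar>"
    and L: "0 \<le> L" and N: "N \<in> borel_measurable borel" "N 0 = 0"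
      "\<And>a b. cmod a \<le> M \<Longrightarrow> cmod b \<le> M \<Longrightarrow> cmod (N a - N b) \<le> L * (cmod a + cmod b) * cmod (a - b)"
  shows fourier_source_integrable: "\<And>s. 1 \<le> s \<Longrightarrow> integrable lborel (\<lambda>y. of_real (V s y) * N (u s y))"
    and fourier_source_continuous: "continuous_on {1..} (\<lambda>s. fourier (\<lambda>y. of_real (V s y) * N (u s y)) \<zeta>)"
proof -
  have K: "0 \<le> K" using V(2)[of 0 0] by simp
  have Nsq: "cmod (N a) \<le> L * (cmod a)\<^sup>2" if "cmod a \<le> M" for a
    using N(3)[OF that, of 0] N(2) order_trans[OF norm_ge_zero that] by (simp add: power2_eq_square)
  have um: "u s \<in> borel_measurable borel" if "1 \<le> s" for s using L2_D(1)[OF u(1)[OF that]] by simp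
  show int: "integrable lborel (\<lambda>y. of_real (V s y) * N (u s y))" if s: "1 \<le> s" for s
  proof (rule Bochner_Integration.integrable_bound)
    show "integrable lborel (\<lambda>y. K * (L * (cmod (u s y))\<^sup>2))"
      by (intro integrable_mult_right L2_D u s)
    note [measurable] = V(1) N(1) um[OF s]
    show "(\<lambda>y. of_real (V s y) * N (u s y)) \<in> borel_measurable lborel" by measurable
    show "AE y in lborel. norm (of_real (V s y) * N (u s y)) \<le> norm (K * (L * (cmod (u s y))\<^sup>2))"
      using u(2)[OF s]
    proof eventually_elim
      case (elim y)
      have "\<bar>V s y\<bar> * cmod (N (u s y)) \<le> K * (L * (cmod (u s y))\<^sup>2)"
        using K by (intro mult_mono V Nsq elim) auto
      then show ?case by (simp add: norm_mult)
    qed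
  qed
  have "((\<lambda>s. fourier (\<lambda>y. of_real (V s y) * N (u s y)) \<zeta>) \<longlongrightarrow> fourier (\<lambda>y. of_real (V t y) * N (u t y)) \<zeta>) (at t within {1..})"
    if t: "1 \<le> t" for t
  proof (rule LIM_zero_cancel, rule Lim_null_comparison)
    let ?F = "\<lambda>s y. complex_of_real (V s y) * N (u s y)"
    define d where "d s = L2_norm (\<lambda>y. u s y - u t y)" for s
    show "\<forall>\<^sub>F s in at t within {1..}. norm (fourier (?F s) \<zeta> - fourier (?F t) \<zeta>)
       \<le> K * L * ((d s)\<^sup>2 + 2 * (d s * L2_norm (u t))) + K * \<bar>s - t\<bar> * L * (L2_norm (u t))\<^sup>2"
      unfolding eventually_at_filter
    proof (intro always_eventually allI impI)
      fix s :: real assume "s \<in> {1..}"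
      then have s: "1 \<le> s" by simp
      note [measurable] = V(1) N(1) um[OF s] um[OF t]
      have D2: "(\<lambda>y. u s y - u t y) \<in> L2" by (intro L2_diff u s t)
      let ?g = "\<lambda>y. K * L * ((cmod (u s y - u t y))\<^sup>2 + 2 * (cmod (u s y - u t y) * cmod (u t y)))
           + K * \<bar>s - t\<bar> * L * (cmod (u t y))\<^sup>2"
      have di: "integrable lborel (\<lambda>y. cmod (u s y - u t y) * cmod (u t y))"
        using integrable_norm_mult_of_squares[OF L2_D(1)[OF D2] L2_D(1)[OF u(1)[OF t]] L2_D(2)[OF D2] L2_D(2)[OF u(1)[OF t]]] .
      have gi: "integrable lborel ?g"
        by (intro Bochner_Integration.integrable_add integrable_mult_right di L2_D u t D2)
      have diff: "fourier (?F s) \<zeta> - fourier (?F t) \<zeta> = (LINT y|lborel. cis (- (\<zeta> * y)) * (?F s y - ?F t y))"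
      proof -
        have "integrable lborel (\<lambda>y. cis (- (\<zeta> * y)) * ?F r y)" if "1 \<le> r" for r
          by (rule Bochner_Integration.integrable_bound[OF int[OF that]])
             (use um[OF that] in \<open>auto simp: norm_mult cis_conv_exp\<close>)
        then show ?thesis using s t by (simp add: fourier_def right_diff_distrib)
      qed
      have "norm (fourier (?F s) \<zeta> - fourier (?F t) \<zeta>) \<le> (LINT y|lborel. ?g y)"
        unfolding diff
      proof (rule norm_integral_le_AE)
        show "integrable lborel ?g" by (rule gi)
        show "AE y in lborel. norm (cis (- (\<zeta> * y)) * (?F s y - ?F t y)) \<le> ?g y"
          using u(2)[OF s] u(2)[OF t]
        proof eventually_elim
          case (elim y)
          let ?a = "u s y" and ?b = "u t y"
          have "?F s y - ?F t y = of_real (V s y) * (N ?a - N ?b) + of_real (V s y - V t y) * N ?b"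
            by (simp add: algebra_simps)
          then have "norm (?F s y - ?F t y) \<le> \<bar>V s y\<bar> * cmod (N ?a - N ?b) + \<bar>V s y - V t y\<bar> * cmod (N ?b)"
            by (metis norm_mult norm_of_real norm_triangle_ineq)
          also have "\<dots> \<le> K * (L * (cmod ?a + cmod ?b) * cmod (?a - ?b)) + (K * \<bar>s - t\<bar>) * (L * (cmod ?b)\<^sup>2)"
            using K by (intro add_mono mult_mono V N Nsq elim) auto
          finally have 1: "norm (?F s y - ?F t y) \<le> K * (L * (cmod ?a + cmod ?b) * cmod (?a - ?b)) + K * \<bar>s - t\<bar> * L * (cmod ?b)\<^sup>2"
            by (simp only: mult.assoc)
          have "(cmod ?a + cmod ?b) * cmod (?a - ?b) \<le> (cmod (?a - ?b) + 2 * cmod ?b) * cmod (?a - ?b)"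
            using norm_triangle_sub[of ?a ?b] by (intro mult_right_mono) auto
          then have "K * L * ((cmod ?a + cmod ?b) * cmod (?a - ?b)) \<le> K * L * ((cmod (?a - ?b) + 2 * cmod ?b) * cmod (?a - ?b))"
            using K L by (intro mult_left_mono) auto
          then have "K * (L * (cmod ?a + cmod ?b) * cmod (?a - ?b)) \<le> K * L * ((cmod (?a - ?b))\<^sup>2 + 2 * (cmod (?a - ?b) * cmod ?b))"
            by (simp add: power2_eq_square algebra_simps)
          with 1 show ?case by (simp add: norm_mult)
        qed
      qed
      also have "\<dots> = K * L * ((LINT y|lborel. (cmod (u s y - u t y))\<^sup>2) + 2 * (LINT y|lborel. cmod (u s y - u t y) * cmod (u t y)))
           + K * \<bar>s - t\<bar> * L * (LINT y|lborel. (cmod (u t y))\<^sup>2)"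
      proof -
        have i1: "integrable lborel (\<lambda>y. (cmod (u s y - u t y))\<^sup>2 + 2 * (cmod (u s y - u t y) * cmod (u t y)))"
          by (intro Bochner_Integration.integrable_add integrable_mult_right di L2_D D2)
        have "(LINT y|lborel. ?g y) = (LINT y|lborel. K * L * ((cmod (u s y - u t y))\<^sup>2 + 2 * (cmod (u s y - u t y) * cmod (u t y))))
           + (LINT y|lborel. K * \<bar>s - t\<bar> * L * (cmod (u t y))\<^sup>2)"
          by (intro Bochner_Integration.integral_add integrable_mult_right i1 L2_D u t)
        moreover have "(LINT y|lborel. (cmod (u s y - u t y))\<^sup>2 + 2 * (cmod (u s y - u t y) * cmod (u t y)))
           = (LINT y|lborel. (cmod (u s y - u t y))\<^sup>2) + (LINT y|lborel. 2 * (cmod (u s y - u t y) * cmod (u t y)))"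
          by (intro Bochner_Integration.integral_add integrable_mult_right di L2_D D2)
        ultimately show ?thesis by (simp only: integral_mult_right_zero)
      qed
      also have "\<dots> = K * L * ((d s)\<^sup>2 + 2 * (LINT y|lborel. cmod (u s y - u t y) * cmod (u t y))) + K * \<bar>s - t\<bar> * L * (L2_norm (u t))\<^sup>2"
        by (simp only: d_def L2_norm_sq)
      also have "\<dots> \<le> K * L * ((d s)\<^sup>2 + 2 * (d s * L2_norm (u t))) + K * \<bar>s - t\<bar> * L * (L2_norm (u t))\<^sup>2"
        using K L L2_Cauchy_Schwarz[OF D2 u(1)[OF t]]
        by (intro add_right_mono mult_left_mono add_left_mono) (auto simp: d_def)
      finally show "norm (fourier (?F s) \<zeta> - fourier (?F t) \<zeta>)
       \<le> K * L * ((d s)\<^sup>2 + 2 * (d s * L2_norm (u t))) + K * \<bar>s - t\<bar> * L * (L2_norm (u t))\<^sup>2" .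
    qed
    have "((\<lambda>s. K * L * ((d s)\<^sup>2 + 2 * (d s * L2_norm (u t))) + K * \<bar>s - t\<bar> * L * (L2_norm (u t))\<^sup>2)
       \<longlongrightarrow> K * L * (0\<^sup>2 + 2 * (0 * L2_norm (u t))) + K * \<bar>t - t\<bar> * L * (L2_norm (u t))\<^sup>2) (at t within {1..})"
      unfolding d_def by (intro tendsto_intros u_cont t)
    then show "((\<lambda>s. K * L * ((d s)\<^sup>2 + 2 * (d s * L2_norm (u t))) + K * \<bar>s - t\<bar> * L * (L2_norm (u t))\<^sup>2)
       \<longlongrightarrow> 0) (at t within {1..})" by simp
  qed
  then show "continuous_on {1..} (\<lambda>s. fourier (\<lambda>y. of_real (V s y) * N (u s y)) \<zeta>)"
    by (simp add: continuous_on_def)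
qed

section \<open>Asymptotics of the source on the ray of the potential\<close>

text \<open>
  Decay of order \<open>p > 2\<close> makes the first absolute moment of the potential finite.
\<close>

lemma localized_potential_bounds:
  assumes "localized_potential W"
  obtains K where "W \<in> borel_measurable borel" "\<And>x. \<bar>W x\<bar> \<le> K" "\<And>x y. \<bar>W x - W y\<bar> \<le> K * \<bar>x - y\<bar>"
    "integrable lborel (\<lambda>x. \<bar>W x\<bar> * (1 + \<bar>x\<bar>))"
proof -
  obtain p k where p: "2 < p" and sm: "smooth W"
    and k: "\<And>j. 0 < k j" "\<And>j x. \<bar>(deriv ^^ j) W x\<bar> \<le> k j * jbr x powr (- p - real j)"
    using assms unfolding localized_potential_def by blast
  have d: "W field_differentiable (at x)" for x
    using sm[unfolded smooth_def, rule_format, of 0 x] by simp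
  have cont: "continuous_on UNIV W"
    using d by (intro continuous_at_imp_continuous_on) (auto intro: field_differentiable_imp_continuous_at)
  then have Wm [measurable]: "W \<in> borel_measurable borel" by (rule borel_measurable_continuous_onI)
  have j1: "jbr x powr (- r) \<le> 1" if "0 \<le> r" for x r
    using powr_mono2'[of "- r" 1 "jbr x"] that jbr_ge_1[of x] by simp
  have W0: "\<bar>W x\<bar> \<le> k 0 * jbr x powr (- p)" for x using k(2)[of 0 x] by simp
  have b0: "\<bar>W x\<bar> \<le> k 0" for x
  proof -
    have "k 0 * jbr x powr (- p) \<le> k 0 * 1"
      using k(1)[of 0] p by (intro mult_left_mono j1) auto
    then show ?thesis using W0[of x] by linarith
  qed
  have b1: "\<bar>deriv W x\<bar> \<le> k 1" for x
  proof -
    have "k 1 * jbr x powr (- (p + 1)) \<le> k 1 * 1"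
      using k(1)[of 1] p by (intro mult_left_mono j1) auto
    then show ?thesis using k(2)[of 1 x] by simp
  qed
  have lip: "\<bar>W x - W y\<bar> \<le> k 1 * \<bar>x - y\<bar>" for x y
  proof -
    have "norm (W x - W y) \<le> k 1 * norm (x - y)"
      by (rule field_differentiable_bound[of UNIV W "deriv W"])
         (use d b1 in \<open>auto simp: DERIV_deriv_iff_field_differentiable\<close>)
    then show ?thesis by simp
  qed
  have Wi: "integrable lborel (\<lambda>x. \<bar>W x\<bar> * (1 + \<bar>x\<bar>))"
  proof (rule Bochner_Integration.integrable_bound)
    show "integrable lborel (\<lambda>x. 2 * k 0 * jbr x powr (- (p - 1)))"
      by (intro integrable_mult_right integrable_jbr_powr) (use p in simp)
    show "AE x in lborel. norm (\<bar>W x\<bar> * (1 + \<bar>x\<bar>)) \<le> norm (2 * k 0 * jbr x powr (- (p - 1)))"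
    proof (rule AE_I2)
      fix x
      have "\<bar>W x\<bar> * (1 + \<bar>x\<bar>) \<le> (k 0 * jbr x powr (- p)) * (2 * jbr x)"
        using jbr_ge_1[of x] jbr_ge_abs[of x] k(1)[of 0] by (intro mult_mono W0) auto
      also have "\<dots> = 2 * k 0 * (jbr x powr (- p) * jbr x powr 1)"
        using jbr_ge_1[of x] by simp
      also have "jbr x powr (- p) * jbr x powr 1 = jbr x powr (- (p - 1))"
        by (subst powr_add[symmetric]) simp
      finally show "norm (\<bar>W x\<bar> * (1 + \<bar>x\<bar>)) \<le> norm (2 * k 0 * jbr x powr (- (p - 1)))"
        using k(1)[of 0] by (simp add: abs_mult)
    qed
  qed simp
  show thesis
  proof (rule that[OF Wm _ _ Wi, of "max (k 0) (k 1)"])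
    show "\<bar>W x\<bar> \<le> max (k 0) (k 1)" for x using b0[of x] by linarith
    show "\<bar>W x - W y\<bar> \<le> max (k 0) (k 1) * \<bar>x - y\<bar>" for x y
      by (rule order_trans[OF lip]) (intro mult_right_mono, auto)
  qed
qed

lemma quintic_modified_free_wave:
  assumes "0 < s"
  shows "quintic (modified_free_wave \<beta> A s y)
    = of_real (s powr (- 5/2)) * (cis (y\<^sup>2 / (4 * s)) * (quintic (A (y / s)) * cis (- (\<beta> * (cmod (A (y / s)))\<^sup>2 * ln s))))"
proof -
  have "(s powr (- 1/2)) ^ 5 = s powr (- 5/2)"
    using assms by (simp add: powr_power)
  then have "complex_of_real (s powr (- 1/2)) ^ 4 * of_real (s powr (- 1/2)) = of_real (s powr (- 5/2))"
    by (metis of_real_power power_Suc2 eval_nat_numeral(3) numeral_eq_Suc pred_numeral_simps(3))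
  then show ?thesis
    unfolding quintic_def modified_free_wave_def by (simp add: norm_mult power_mult_distrib mult_ac)
qed

text \<open>
  The replacement of \<open>v\<close> by the modified free wave costs \<open>s\<^sup>-\<^sup>2 s\<^sup>-\<^sup>5\<^sup>/\<^sup>8\<close>, since the quintic term is
  Lipschitz with constant \<open>O(s\<^sup>-\<^sup>2)\<close> on the relevant ball. In the shifted variable \<open>x\<close> the remaining
  phase is \<open>s (\<zeta> + \<gamma>/2)\<^sup>2 - (\<zeta> + \<gamma>/2) x + x\<^sup>2 / (4 s)\<close>, and \<open>A\<close> is evaluated at \<open>x / s - \<gamma>\<close>. The last two
  phase terms and the displacement \<open>x / s\<close> are removed at a cost linear in \<open>1 + |x|\<close>, which the
  potential can absorb.
\<close>

lemma source_asymptotics: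
  fixes W :: "real \<Rightarrow> real" and A v :: "real \<Rightarrow> complex" and M H s \<beta> \<gamma> \<zeta> :: real
  assumes Wm: "W \<in> borel_measurable borel" and Wi: "integrable lborel (\<lambda>x. \<bar>W x\<bar> * (1 + \<bar>x\<bar>))"
    and Am: "A \<in> borel_measurable borel" and AM: "\<And>x. cmod (A x) \<le> M"
    and H: "0 \<le> H" "\<And>x y. cmod (A x - A y) \<le> H * \<bar>x - y\<bar> powr (1/4)"
    and s: "1 \<le> s" and vm: "v \<in> borel_measurable borel"
    and vM: "AE y in lborel. cmod (v y) \<le> M * s powr (- 1/2)"
    and vA: "AE y in lborel. cmod (v y - modified_free_wave \<beta> A s y) \<le> M * s powr (- 5/8)"
  shows "cmod (cis (s * \<zeta>\<^sup>2) * fourier (\<lambda>y. of_real (W (y + \<gamma> * s)) * quintic (v y)) \<zeta>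
      - of_real (s powr (- 5/2)) * (cis (s * (\<zeta> + \<gamma> / 2)\<^sup>2) * (of_real (LINT x|lborel. W x)
          * (quintic (A (- \<gamma>)) * cis (- (\<beta> * (cmod (A (- \<gamma>)))\<^sup>2 * ln s))))))
    \<le> s powr (- 5/2) * ((8 * M ^ 5 + 6 * M ^ 4 * H + 16 * M ^ 6 * \<bar>\<beta>\<bar> * H) * (LINT x|lborel. \<bar>W x\<bar> * (1 + \<bar>x\<bar>))
          * (\<bar>\<zeta> + \<gamma> / 2\<bar> + s powr (- 1/8)))"
proof -
  have s0: "0 < s" using s by simp
  have M0: "0 \<le> M" using AM[of 0] norm_ge_zero order_trans by blast
  define q where "q = \<zeta> + \<gamma> / 2"
  define N where "N = (LINT x|lborel. \<bar>W x\<bar> * (1 + \<bar>x\<bar>))"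
  define e where "e = s powr (- 1/8)"
  define r where "r = s powr (- 5/2)"
  have e0: "0 \<le> e" and r0: "0 \<le> r" by (auto simp: e_def r_def)
  define m where "m = modified_free_wave \<beta> A s"
  define G where "G z = quintic (A z) * cis (- (\<beta> * (cmod (A z))\<^sup>2 * ln s))" for z
  note [measurable] = Wm Am vm
  have mm [measurable]: "m \<in> borel_measurable borel"
    unfolding m_def modified_free_wave_def cis_conv_exp by measurable
  have Gm [measurable]: "G \<in> borel_measurable borel"
    unfolding G_def cis_conv_exp by measurable
  have W1: "integrable lborel W"
    by (rule Bochner_Integration.integrable_bound[OF Wi]) (auto intro!: AE_I2 simp: abs_mult algebra_simps)
  have WN: "(LINT x|lborel. \<bar>W x\<bar>) \<le> N"
    unfolding N_def by (rule integral_mono) (use W1 Wi in \<open>auto simp: algebra_simps\<close>)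
  have shift_int: "integrable lborel (\<lambda>y. \<bar>W (y + \<gamma> * s)\<bar>)"
    using lborel_integrable_real_affine[of "\<lambda>x. \<bar>W x\<bar>" 1 "\<gamma> * s"] W1 by (simp add: add.commute)
  have shift_eq: "(LINT y|lborel. \<bar>W (y + \<gamma> * s)\<bar>) = (LINT x|lborel. \<bar>W x\<bar>)"
    using lborel_integral_real_affine[of 1 "\<lambda>x. \<bar>W x\<bar>" "\<gamma> * s"] by (simp add: add.commute)

  \<comment> \<open>Replace the solution by the modified free wave.\<close>
  have mM: "cmod (m y) \<le> M * s powr (- 1/2)" for y
    using AM[of "y / s"] mult_right_mono[OF AM[of "y / s"], of "s powr (- 1/2)"]
    by (simp add: m_def modified_free_wave_def norm_mult mult.commute)
  have MS: "(M * s powr (- 1/2)) ^ 4 * (M * s powr (- 5/8)) = M ^ 5 * (r * e)"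
  proof -
    have "(s powr (- 1/2)) ^ 4 = s powr (- 2)" using s0 by (simp add: powr_power)
    then have "(M * s powr (- 1/2)) ^ 4 * (M * s powr (- 5/8)) = M ^ 5 * (s powr (- 2) * s powr (- 5/8))"
      by (simp add: power_mult_distrib power_numeral_reduce)
    also have "s powr (- 2) * s powr (- 5/8) = r * e"
      by (simp add: r_def e_def flip: powr_add)
    finally show ?thesis .
  qed
  have bnd_int: "integrable lborel (\<lambda>y. cis (- (\<zeta> * y)) * (of_real (W (y + \<gamma> * s)) * quintic (f y)))"
    if fm: "f \<in> borel_measurable borel" and f: "AE y in lborel. cmod (f y) \<le> M * s powr (- 1/2)" for f
  proof (rule Bochner_Integration.integrable_bound)
    show "integrable lborel (\<lambda>y. (M * s powr (- 1/2)) ^ 5 * \<bar>W (y + \<gamma> * s)\<bar>)"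
      by (intro integrable_mult_right shift_int)
    note [measurable] = fm
    show "(\<lambda>y. cis (- (\<zeta> * y)) * (of_real (W (y + \<gamma> * s)) * quintic (f y))) \<in> borel_measurable lborel"
      unfolding cis_conv_exp by measurable
    show "AE y in lborel. norm (cis (- (\<zeta> * y)) * (of_real (W (y + \<gamma> * s)) * quintic (f y)))
       \<le> norm ((M * s powr (- 1/2)) ^ 5 * \<bar>W (y + \<gamma> * s)\<bar>)"
      using f
    proof eventually_elim
      case (elim y)
      have "cmod (f y) ^ 5 \<le> (M * s powr (- 1/2)) ^ 5" by (rule power_mono[OF elim]) simp
      from mult_right_mono[OF this, of "\<bar>W (y + \<gamma> * s)\<bar>"] show ?case
        using M0 by (simp add: norm_mult norm_quintic abs_mult mult.commute)
    qed
  qed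
  define I1 where "I1 = fourier (\<lambda>y. of_real (W (y + \<gamma> * s)) * quintic (v y)) \<zeta>"
  define I2 where "I2 = fourier (\<lambda>y. of_real (W (y + \<gamma> * s)) * quintic (m y)) \<zeta>"
  have "I1 - I2 = (LINT y|lborel. cis (- (\<zeta> * y)) * (of_real (W (y + \<gamma> * s)) * quintic (v y))
       - cis (- (\<zeta> * y)) * (of_real (W (y + \<gamma> * s)) * quintic (m y)))"
    unfolding I1_def I2_def fourier_def
    using mM by (intro Bochner_Integration.integral_diff[symmetric] bnd_int vm vM mm AE_I2)
  moreover have "cmod (LINT y|lborel. cis (- (\<zeta> * y)) * (of_real (W (y + \<gamma> * s)) * quintic (v y))
       - cis (- (\<zeta> * y)) * (of_real (W (y + \<gamma> * s)) * quintic (m y)))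
     \<le> (LINT y|lborel. 6 * (M ^ 5 * (r * e)) * \<bar>W (y + \<gamma> * s)\<bar>)"
  proof (rule norm_integral_le_AE)
    show "integrable lborel (\<lambda>y. 6 * (M ^ 5 * (r * e)) * \<bar>W (y + \<gamma> * s)\<bar>)"
      by (intro integrable_mult_right shift_int)
    show "AE y in lborel. norm (cis (- (\<zeta> * y)) * (of_real (W (y + \<gamma> * s)) * quintic (v y))
       - cis (- (\<zeta> * y)) * (of_real (W (y + \<gamma> * s)) * quintic (m y))) \<le> 6 * (M ^ 5 * (r * e)) * \<bar>W (y + \<gamma> * s)\<bar>"
      using vM vA
    proof eventually_elim
      case (elim y)
      have "cmod (quintic (v y) - quintic (m y)) \<le> 6 * (M * s powr (- 1/2)) ^ 4 * cmod (v y - m y)"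
        by (rule quintic_lipschitz_ball[OF elim(1) mM])
      also have "\<dots> \<le> 6 * (M * s powr (- 1/2)) ^ 4 * (M * s powr (- 5/8))"
        using elim(2) M0 by (intro mult_left_mono) (auto simp: m_def)
      finally have *: "cmod (quintic (v y) - quintic (m y)) \<le> 6 * (M ^ 5 * (r * e))"
        using MS by (simp only: mult.assoc)
      have "cis (- (\<zeta> * y)) * (of_real (W (y + \<gamma> * s)) * quintic (v y)) - cis (- (\<zeta> * y)) * (of_real (W (y + \<gamma> * s)) * quintic (m y))
         = cis (- (\<zeta> * y)) * of_real (W (y + \<gamma> * s)) * (quintic (v y) - quintic (m y))"
        by (simp add: algebra_simps)
      then have "norm (cis (- (\<zeta> * y)) * (of_real (W (y + \<gamma> * s)) * quintic (v y)) - cis (- (\<zeta> * y)) * (of_real (W (y + \<gamma> * s)) * quintic (m y)))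
         = \<bar>W (y + \<gamma> * s)\<bar> * cmod (quintic (v y) - quintic (m y))"
        by (simp add: norm_mult)
      also have "\<dots> \<le> \<bar>W (y + \<gamma> * s)\<bar> * (6 * (M ^ 5 * (r * e)))"
        by (intro mult_left_mono *) simp
      finally show ?case by (simp only: mult.commute)
    qed
  qed
  ultimately have "cmod (I1 - I2) \<le> 6 * (M ^ 5 * (r * e)) * (LINT x|lborel. \<bar>W x\<bar>)"
    by (simp only: integral_mult_right_zero shift_eq)
  also have "\<dots> \<le> 6 * (M ^ 5 * (r * e)) * N"
    using M0 e0 r0 by (intro mult_left_mono WN) auto
  finally have step1: "cmod (I1 - I2) \<le> r * (6 * M ^ 5 * N * e)"
    by (simp add: mult_ac)

  \<comment> \<open>Shift to the frame of the potential and complete the square in the phase.\<close>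
  define J where "J = (LINT x|lborel. of_real (W x) * (cis (x\<^sup>2 / (4 * s) - q * x) * G (x / s - \<gamma>)))"
  have step2: "cis (s * \<zeta>\<^sup>2) * I2 = of_real r * (cis (s * q\<^sup>2) * J)"
  proof -
    have "I2 = (LINT x|lborel. cis (- (\<zeta> * (- (\<gamma> * s) + 1 * x))) * (of_real (W (- (\<gamma> * s) + 1 * x + \<gamma> * s)) * quintic (m (- (\<gamma> * s) + 1 * x))))"
      unfolding I2_def fourier_def
      using lborel_integral_real_affine[of 1 "\<lambda>y. cis (- (\<zeta> * y)) * (of_real (W (y + \<gamma> * s)) * quintic (m y))" "- (\<gamma> * s)"]
      by (simp only: abs_one scaleR_one)
    moreover have "- (\<gamma> * s) + 1 * x = x - \<gamma> * s" "x - \<gamma> * s + \<gamma> * s = x" for x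
      by simp_all
    ultimately have "I2 = (LINT x|lborel. cis (- (\<zeta> * (x - \<gamma> * s))) * (of_real (W x) * quintic (m (x - \<gamma> * s))))"
      by (simp only:)
    then have "cis (s * \<zeta>\<^sup>2) * I2 = (LINT x|lborel. cis (s * \<zeta>\<^sup>2) * (cis (- (\<zeta> * (x - \<gamma> * s))) * (of_real (W x) * quintic (m (x - \<gamma> * s)))))"
      by (simp only: integral_mult_right_zero)
    also have "\<dots> = (LINT x|lborel. of_real r * (cis (s * q\<^sup>2) * (of_real (W x) * (cis (x\<^sup>2 / (4 * s) - q * x) * G (x / s - \<gamma>)))))"
    proof (intro Bochner_Integration.integral_cong refl)
      fix x
      have 1: "(x - \<gamma> * s) / s = x / s - \<gamma>" using s0 by (simp add: diff_divide_distrib)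
      have "s * \<zeta>\<^sup>2 + (- (\<zeta> * (x - \<gamma> * s)) + (x - \<gamma> * s)\<^sup>2 / (4 * s)) = s * q\<^sup>2 + (x\<^sup>2 / (4 * s) - q * x)"
        using s0 by (simp add: q_def power2_eq_square field_simps)
      then have 2: "cis (s * \<zeta>\<^sup>2) * (cis (- (\<zeta> * (x - \<gamma> * s))) * cis ((x - \<gamma> * s)\<^sup>2 / (4 * s))) = cis (s * q\<^sup>2) * cis (x\<^sup>2 / (4 * s) - q * x)"
        by (simp only: cis_mult)
      have "cis (s * \<zeta>\<^sup>2) * (cis (- (\<zeta> * (x - \<gamma> * s))) * (of_real (W x) * quintic (m (x - \<gamma> * s))))
        = of_real r * of_real (W x) * G (x / s - \<gamma>) * (cis (s * \<zeta>\<^sup>2) * (cis (- (\<zeta> * (x - \<gamma> * s))) * cis ((x - \<gamma> * s)\<^sup>2 / (4 * s))))"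
        unfolding m_def quintic_modified_free_wave[OF s0] 1 G_def r_def by (simp only: mult_ac)
      also have "\<dots> = of_real r * (cis (s * q\<^sup>2) * (of_real (W x) * (cis (x\<^sup>2 / (4 * s) - q * x) * G (x / s - \<gamma>))))"
        unfolding 2 by (simp only: mult_ac)
      finally show "cis (s * \<zeta>\<^sup>2) * (cis (- (\<zeta> * (x - \<gamma> * s))) * (of_real (W x) * quintic (m (x - \<gamma> * s))))
        = of_real r * (cis (s * q\<^sup>2) * (of_real (W x) * (cis (x\<^sup>2 / (4 * s) - q * x) * G (x / s - \<gamma>))))" .
    qed
    finally show ?thesis unfolding J_def by (simp only: integral_mult_right_zero)
  qed

  \<comment> \<open>Freeze the phase and the profile at \<open>x = 0\<close>; \<open>c\<close> is the cost per unit of \<open>1 + |x|\<close>.\<close>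
  define c where "c = M ^ 5 * \<bar>q\<bar> + (M ^ 5 + 6 * M ^ 4 * H + 16 * M ^ 6 * \<bar>\<beta>\<bar> * H) * e"
  have GM: "cmod (G z) \<le> M ^ 5" for z
    using power_mono[OF AM[of z] norm_ge_zero, of 5] by (simp add: G_def norm_mult norm_quintic)
  \<comment> \<open>The logarithm loses \<open>s\<^sup>1\<^sup>/\<^sup>8\<close> of the Hoelder gain \<open>s\<^sup>-\<^sup>1\<^sup>/\<^sup>4\<close>.\<close>
  have ln: "0 \<le> ln s" "ln s \<le> 8 * s powr (1/8)"
    using s ln_powr_bound[of s "1/8"] by auto
  have se: "s powr (- 1/2) \<le> e" "s powr (- 1/4) \<le> e" "s powr (1/8) * s powr (- 1/4) = e"
    using s by (auto simp: e_def simp flip: powr_add intro: powr_mono)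
  have GH: "cmod (G (x / s - \<gamma>) - G (- \<gamma>)) \<le> (6 * M ^ 4 * H + 16 * M ^ 6 * \<bar>\<beta>\<bar> * H) * e * (1 + \<bar>x\<bar>)" for x
  proof -
    let ?a = "A (x / s - \<gamma>)" and ?b = "A (- \<gamma>)"
    define \<theta> where "\<theta> z = - (\<beta> * (cmod z)\<^sup>2 * ln s)" for z
    have x4: "\<bar>x\<bar> powr (1/4) \<le> 1 + \<bar>x\<bar>"
    proof -
      have "\<bar>x\<bar> powr (1/4) \<le> (1 + \<bar>x\<bar>) powr (1/4)" by (rule powr_mono2) auto
      also have "\<dots> \<le> (1 + \<bar>x\<bar>) powr 1" by (rule powr_mono) auto
      finally show ?thesis by simp
    qed
    have "cmod (?a - ?b) \<le> H * \<bar>x / s\<bar> powr (1/4)" using H(2)[of "x / s - \<gamma>" "- \<gamma>"] by simp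
    also have "\<bar>x / s\<bar> powr (1/4) = s powr (- 1/4) * \<bar>x\<bar> powr (1/4)"
    proof -
      have "s powr (- 1/4) = 1 / s powr (1/4)" using powr_minus_divide[of s "1/4"] by simp
      moreover have "\<bar>x / s\<bar> powr (1/4) = \<bar>x\<bar> powr (1/4) / s powr (1/4)"
        using s0 powr_divide[of "\<bar>x\<bar>" s "1/4"] by simp
      ultimately show ?thesis by simp
    qed
    also have "H * (s powr (- 1/4) * \<bar>x\<bar> powr (1/4)) \<le> H * (s powr (- 1/4) * (1 + \<bar>x\<bar>))"
      using H(1) x4 by (intro mult_left_mono) auto
    finally have d: "cmod (?a - ?b) \<le> H * (s powr (- 1/4) * (1 + \<bar>x\<bar>))" .
    have "G (x / s - \<gamma>) - G (- \<gamma>) = (quintic ?a - quintic ?b) * cis (\<theta> ?a) + quintic ?b * (cis (\<theta> ?a) - cis (\<theta> ?b))"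
      by (simp add: G_def \<theta>_def algebra_simps)
    also have "cmod \<dots> \<le> cmod (quintic ?a - quintic ?b) + cmod (quintic ?b) * cmod (cis (\<theta> ?a) - cis (\<theta> ?b))"
      by (rule order_trans[OF norm_triangle_ineq]) (simp add: norm_mult)
    also have "\<dots> \<le> 6 * M ^ 4 * cmod (?a - ?b) + M ^ 5 * (\<bar>\<beta>\<bar> * (2 * M * cmod (?a - ?b)) * ln s)"
    proof (intro add_mono mult_mono quintic_lipschitz_ball AM)
      show "cmod (quintic ?b) \<le> M ^ 5" using power_mono[OF AM norm_ge_zero, of _ 5] by (simp add: norm_quintic)
      have "cis (\<theta> ?a) - cis (\<theta> ?b) = cis (\<theta> ?b) * (cis (\<theta> ?a - \<theta> ?b) - 1)"
        by (simp add: algebra_simps cis_mult)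
      then have "cmod (cis (\<theta> ?a) - cis (\<theta> ?b)) \<le> \<bar>\<theta> ?a - \<theta> ?b\<bar>"
        using norm_cis_minus_1_le by (simp add: norm_mult)
      also have "\<theta> ?a - \<theta> ?b = - (\<beta> * ((cmod ?a)\<^sup>2 - (cmod ?b)\<^sup>2) * ln s)"
        by (simp add: \<theta>_def algebra_simps)
      also have "\<bar>\<dots>\<bar> = \<bar>\<beta>\<bar> * \<bar>(cmod ?a)\<^sup>2 - (cmod ?b)\<^sup>2\<bar> * ln s"
        using ln by (simp add: abs_mult)
      also have "\<dots> \<le> \<bar>\<beta>\<bar> * (2 * M * cmod (?a - ?b)) * ln s"
      proof (intro mult_right_mono mult_left_mono)
        have "(cmod ?a + cmod ?b) * cmod (?a - ?b) \<le> 2 * M * cmod (?a - ?b)"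
          using AM[of "x / s - \<gamma>"] AM[of "- \<gamma>"] by (intro mult_right_mono) auto
        then show "\<bar>(cmod ?a)\<^sup>2 - (cmod ?b)\<^sup>2\<bar> \<le> 2 * M * cmod (?a - ?b)"
          using norm_diff_squares_le[of ?a ?b] by linarith
      qed (use ln in auto)
      finally show "cmod (cis (\<theta> ?a) - cis (\<theta> ?b)) \<le> \<bar>\<beta>\<bar> * (2 * M * cmod (?a - ?b)) * ln s" .
    qed (use M0 in auto)
    also have "\<dots> = (6 * M ^ 4 + 2 * M ^ 6 * \<bar>\<beta>\<bar> * ln s) * cmod (?a - ?b)"
      by (simp add: algebra_simps power_numeral_reduce)
    also have "\<dots> \<le> (6 * M ^ 4 + 2 * M ^ 6 * \<bar>\<beta>\<bar> * ln s) * (H * (s powr (- 1/4) * (1 + \<bar>x\<bar>)))"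
      using ln M0 by (intro mult_left_mono d) auto
    also have "\<dots> = (6 * M ^ 4 * H * s powr (- 1/4) + 2 * M ^ 6 * \<bar>\<beta>\<bar> * H * (ln s * s powr (- 1/4))) * (1 + \<bar>x\<bar>)"
      by (simp add: algebra_simps)
    also have "\<dots> \<le> (6 * M ^ 4 * H * e + 2 * M ^ 6 * \<bar>\<beta>\<bar> * H * (8 * e)) * (1 + \<bar>x\<bar>)"
    proof (intro mult_right_mono add_mono mult_left_mono)
      have "ln s * s powr (- 1/4) \<le> 8 * s powr (1/8) * s powr (- 1/4)" by (intro mult_right_mono ln) auto
      then show "ln s * s powr (- 1/4) \<le> 8 * e" using se(3) by simp
    qed (use se M0 H in auto)
    finally show ?thesis by (simp add: algebra_simps)
  qed
  have pw: "cmod (cis (x\<^sup>2 / (4 * s) - q * x) * G (x / s - \<gamma>) - G (- \<gamma>)) \<le> c * (1 + \<bar>x\<bar>)" for x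
  proof -
    let ?a = "x\<^sup>2 / (4 * s)" and ?b = "- (q * x)"
    have ca: "cmod (cis ?a - 1) \<le> \<bar>x\<bar> * e"
    proof -
      define t where "t = \<bar>x\<bar> * s powr (- 1/2)"
      have t0: "0 \<le> t" by (simp add: t_def)
      have "(s powr (- 1/2))\<^sup>2 = s powr (- 1/2 + - 1/2)" by (simp only: power2_eq_square powr_add)
      also have "\<dots> = 1 / s" using s0 powr_minus_divide[of s 1] by simp
      finally have "(s powr (- 1/2))\<^sup>2 = 1 / s" .
      then have at: "?a = t\<^sup>2 / 4" by (simp add: t_def power_mult_distrib)
      have "cmod (cis ?a - 1) \<le> t"
      proof (cases "t \<le> 4")
        case True
        then have "t\<^sup>2 / 4 \<le> t" using t0 mult_left_mono[of t 4 t] by (simp add: power2_eq_square)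
        then show ?thesis using norm_cis_minus_1_le[of ?a] unfolding at by simp
      next
        case False
        have "cmod (cis ?a - 1) \<le> cmod (cis ?a) + cmod 1" by (rule norm_triangle_ineq4)
        then show ?thesis using False by simp
      qed
      also have "t \<le> \<bar>x\<bar> * e" unfolding t_def by (intro mult_left_mono se) auto
      finally show ?thesis .
    qed
    have cb: "cmod (cis ?b - 1) \<le> \<bar>q\<bar> * \<bar>x\<bar>" using norm_cis_minus_1_le[of ?b] by (simp add: abs_mult)
    have "cis (x\<^sup>2 / (4 * s) - q * x) - 1 = cis ?a * (cis ?b - 1) + (cis ?a - 1)"
      by (simp add: algebra_simps cis_mult)
    then have "cmod (cis (x\<^sup>2 / (4 * s) - q * x) - 1) \<le> cmod (cis ?a * (cis ?b - 1)) + cmod (cis ?a - 1)"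
      by (simp only: norm_triangle_ineq)
    also have "\<dots> \<le> \<bar>q\<bar> * \<bar>x\<bar> + \<bar>x\<bar> * e"
      using ca cb by (intro add_mono) (auto simp: norm_mult)
    also have "\<dots> \<le> (\<bar>q\<bar> + e) * (1 + \<bar>x\<bar>)" using e0 by (simp add: algebra_simps)
    finally have cc: "cmod (cis (x\<^sup>2 / (4 * s) - q * x) - 1) \<le> (\<bar>q\<bar> + e) * (1 + \<bar>x\<bar>)" .
    have "cis (x\<^sup>2 / (4 * s) - q * x) * G (x / s - \<gamma>) - G (- \<gamma>)
      = (cis (x\<^sup>2 / (4 * s) - q * x) - 1) * G (x / s - \<gamma>) + (G (x / s - \<gamma>) - G (- \<gamma>))"
      by (simp add: algebra_simps)
    also have "cmod \<dots> \<le> cmod (cis (x\<^sup>2 / (4 * s) - q * x) - 1) * cmod (G (x / s - \<gamma>)) + cmod (G (x / s - \<gamma>) - G (- \<gamma>))"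
      by (rule order_trans[OF norm_triangle_ineq]) (simp add: norm_mult)
    also have "\<dots> \<le> ((\<bar>q\<bar> + e) * (1 + \<bar>x\<bar>)) * M ^ 5 + (6 * M ^ 4 * H + 16 * M ^ 6 * \<bar>\<beta>\<bar> * H) * e * (1 + \<bar>x\<bar>)"
      using e0 by (intro add_mono mult_mono cc GM GH) auto
    also have "\<dots> = c * (1 + \<bar>x\<bar>)" by (simp add: c_def algebra_simps)
    finally show ?thesis .
  qed
  have Jint: "integrable lborel (\<lambda>x. of_real (W x) * (cis (x\<^sup>2 / (4 * s) - q * x) * G (x / s - \<gamma>)))"
    by (rule Bochner_Integration.integrable_bound[OF integrable_mult_right[OF W1, of "M ^ 5"]])
       (use GM M0 in \<open>auto simp: norm_mult cis_conv_exp mult.commute abs_mult intro!: AE_I2 mult_left_mono\<close>)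
  have W1c: "integrable lborel (\<lambda>x. complex_of_real (W x))" using W1 by (simp add: of_real_def)
  have "J - of_real (LINT x|lborel. W x) * G (- \<gamma>)
     = (LINT x|lborel. of_real (W x) * (cis (x\<^sup>2 / (4 * s) - q * x) * G (x / s - \<gamma>)) - of_real (W x) * G (- \<gamma>))"
    unfolding J_def using Bochner_Integration.integral_diff[OF Jint integrable_mult_left[OF W1c, of "G (- \<gamma>)"]]
    by (simp del: Bochner_Integration.integral_diff)
  moreover have "cmod (LINT x|lborel. of_real (W x) * (cis (x\<^sup>2 / (4 * s) - q * x) * G (x / s - \<gamma>)) - of_real (W x) * G (- \<gamma>))
     \<le> (LINT x|lborel. c * (\<bar>W x\<bar> * (1 + \<bar>x\<bar>)))"
  proof (rule norm_integral_le_AE)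
    show "integrable lborel (\<lambda>x. c * (\<bar>W x\<bar> * (1 + \<bar>x\<bar>)))" by (intro integrable_mult_right Wi)
    show "AE x in lborel. norm (of_real (W x) * (cis (x\<^sup>2 / (4 * s) - q * x) * G (x / s - \<gamma>)) - of_real (W x) * G (- \<gamma>))
      \<le> c * (\<bar>W x\<bar> * (1 + \<bar>x\<bar>))"
    proof (rule AE_I2)
      fix x
      have "norm (of_real (W x) * (cis (x\<^sup>2 / (4 * s) - q * x) * G (x / s - \<gamma>)) - of_real (W x) * G (- \<gamma>))
         = \<bar>W x\<bar> * cmod (cis (x\<^sup>2 / (4 * s) - q * x) * G (x / s - \<gamma>) - G (- \<gamma>))"
        by (simp add: norm_mult flip: right_diff_distrib)
      also have "\<dots> \<le> \<bar>W x\<bar> * (c * (1 + \<bar>x\<bar>))" by (intro mult_left_mono pw) simp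
      finally show "norm (of_real (W x) * (cis (x\<^sup>2 / (4 * s) - q * x) * G (x / s - \<gamma>)) - of_real (W x) * G (- \<gamma>))
        \<le> c * (\<bar>W x\<bar> * (1 + \<bar>x\<bar>))" by (simp only: mult_ac)
    qed
  qed
  ultimately have step3: "cmod (J - of_real (LINT x|lborel. W x) * G (- \<gamma>)) \<le> c * N"
    by (simp only: integral_mult_right_zero N_def)

  have "cis (s * \<zeta>\<^sup>2) * I1 - of_real r * (cis (s * q\<^sup>2) * (of_real (LINT x|lborel. W x) * G (- \<gamma>)))
     = cis (s * \<zeta>\<^sup>2) * (I1 - I2) + of_real r * (cis (s * q\<^sup>2) * (J - of_real (LINT x|lborel. W x) * G (- \<gamma>)))"
    using step2 by (simp add: right_diff_distrib)
  then have "cmod (cis (s * \<zeta>\<^sup>2) * I1 - of_real r * (cis (s * q\<^sup>2) * (of_real (LINT x|lborel. W x) * G (- \<gamma>))))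
     \<le> cmod (I1 - I2) + r * cmod (J - of_real (LINT x|lborel. W x) * G (- \<gamma>))"
    using norm_triangle_ineq[of "cis (s * \<zeta>\<^sup>2) * (I1 - I2)" "of_real r * (cis (s * q\<^sup>2) * (J - of_real (LINT x|lborel. W x) * G (- \<gamma>)))"] r0
    by (simp add: norm_mult)
  also have "\<dots> \<le> r * (6 * M ^ 5 * N * e) + r * (c * N)"
    using r0 by (intro add_mono step1 mult_left_mono step3)
  also have "\<dots> \<le> r * ((8 * M ^ 5 + 6 * M ^ 4 * H + 16 * M ^ 6 * \<bar>\<beta>\<bar> * H) * N * (\<bar>q\<bar> + e))"
  proof -
    have N0: "0 \<le> N" unfolding N_def by simp
    define k where "k = 6 * M ^ 4 * H + 16 * M ^ 6 * \<bar>\<beta>\<bar> * H"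
    have k0: "0 \<le> k" using M0 H(1) by (simp add: k_def)
    have "6 * M ^ 5 * e + c \<le> (8 * M ^ 5 + k) * (\<bar>q\<bar> + e)"
    proof -
      have "0 \<le> M ^ 5 * \<bar>q\<bar>" "0 \<le> M ^ 5 * e" "0 \<le> k * \<bar>q\<bar>" using M0 e0 k0 by auto
      then show ?thesis unfolding c_def k_def by (simp add: algebra_simps)
    qed
    then have "r * N * (6 * M ^ 5 * e + c) \<le> r * N * ((8 * M ^ 5 + k) * (\<bar>q\<bar> + e))"
      using r0 N0 by (intro mult_left_mono) auto
    then show ?thesis by (simp add: k_def algebra_simps)
  qed
  finally show ?thesis
    unfolding I1_def G_def q_def N_def e_def r_def by simp
qed

section \<open>Duhamel formula and rescaled tails\<close>

text \<open>
  The substitution \<open>s = T \<tau>\<close>.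
\<close>

lemma rescaled_tail_integral:
  fixes T \<alpha> \<eta> :: real and a :: complex
  assumes T: "0 < T"
  shows "(LINT s:{T<..}|lborel. of_real (s powr (- 5/2)) * (cis (s * (\<eta> / sqrt T)\<^sup>2) * (a * cis (- (\<alpha> * ln s)))))
    = of_real (T powr (- 3/2)) * cis (- (\<alpha> * ln T)) * (a * tail_laplace (5/2 + \<i> * of_real \<alpha>) (- (\<i> * of_real (\<eta>\<^sup>2))))"
proof -
  define f where "f s = indicat_real {T<..} s *\<^sub>R (complex_of_real (s powr (- 5/2)) * (cis (s * (\<eta> / sqrt T)\<^sup>2) * (a * cis (- (\<alpha> * ln s)))))" for s
  define g where "g t = indicat_real {1<..} t *\<^sub>R (complex_of_real t powr (- (5/2 + \<i> * of_real \<alpha>)) * exp (- (- (\<i> * of_real (\<eta>\<^sup>2)) * of_real t)))" for t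
  have fg: "T *\<^sub>R f (0 + T * t) = of_real (T powr (- 3/2)) * cis (- (\<alpha> * ln T)) * a * g t" for t
  proof (cases "1 < t")
    case True
    have 1: "T * (T * t) powr (- 5/2) = T powr (- 3/2) * t powr (- 5/2)"
    proof -
      have "T * T powr (- 5/2) = T powr 1 * T powr (- 5/2)" using T by simp
      also have "\<dots> = T powr (- 3/2)" by (subst powr_add[symmetric]) simp
      finally show ?thesis using T True by (simp add: powr_mult flip: mult.assoc)
    qed
    have 2: "T * t * (\<eta> / sqrt T)\<^sup>2 = \<eta>\<^sup>2 * t" using T by (simp add: power_divide)
    have 3: "cis (- (\<alpha> * ln (T * t))) = cis (- (\<alpha> * ln T)) * cis (- (\<alpha> * ln t))"
      using T True by (simp add: ln_mult cis_mult algebra_simps)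
    have 4: "complex_of_real t powr (- (5/2 + \<i> * of_real \<alpha>)) = of_real (t powr (- 5/2)) * cis (- (\<alpha> * ln t))"
    proof -
      have "complex_of_real t powr (- (5/2 + \<i> * of_real \<alpha>)) = exp (of_real (- 5/2 * ln t) + \<i> * of_real (- (\<alpha> * ln t)))"
        using True by (simp add: powr_def Ln_of_real algebra_simps)
      also have "\<dots> = exp (of_real (- 5/2 * ln t)) * exp (\<i> * of_real (- (\<alpha> * ln t)))" by (rule exp_add)
      also have "exp (complex_of_real (- 5/2 * ln t)) = of_real (t powr (- 5/2))"
        unfolding exp_of_real using True by (simp add: powr_def)
      finally show ?thesis by (simp only: cis_conv_exp)
    qed
    have 5: "exp (- (- (\<i> * of_real (\<eta>\<^sup>2)) * of_real t)) = cis (\<eta>\<^sup>2 * t)"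
      by (simp add: cis_conv_exp mult.assoc)
    have i: "indicat_real {T<..} (T * t) = 1" "indicat_real {1<..} t = 1" using True T by auto
    have "T *\<^sub>R f (0 + T * t) = of_real (T * (T * t) powr (- 5/2)) * (cis (T * t * (\<eta> / sqrt T)\<^sup>2) * (a * cis (- (\<alpha> * ln (T * t)))))"
      unfolding f_def using i by (simp add: scaleR_conv_of_real)
    also have "\<dots> = of_real (T powr (- 3/2)) * cis (- (\<alpha> * ln T)) * a * g t"
      unfolding g_def 1 2 3 4 5 i by (simp add: mult_ac)
    finally show ?thesis .
  next
    case False
    then have "\<not> T < T * t" using T by (simp add: not_less)
    then show ?thesis using False by (simp add: f_def g_def)
  qed
  have "(LINT s|lborel. f s) = \<bar>T\<bar> *\<^sub>R (LINT t|lborel. f (0 + T * t))"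
    by (rule lborel_integral_real_affine) (use T in simp)
  also have "\<dots> = (LINT t|lborel. T *\<^sub>R f (0 + T * t))"
    using T by simp
  also have "\<dots> = of_real (T powr (- 3/2)) * cis (- (\<alpha> * ln T)) * a * (LINT t|lborel. g t)"
    unfolding fg by (rule integral_mult_right_zero)
  finally show ?thesis
    unfolding f_def g_def tail_laplace_def set_lebesgue_integral_def by (simp only: mult.assoc)
qed

definition quintic_source :: "(real \<Rightarrow> real) \<Rightarrow> real \<Rightarrow> (real \<Rightarrow> real \<Rightarrow> complex) \<Rightarrow> real \<Rightarrow> real \<Rightarrow> complex" where
  "quintic_source W \<gamma> u s = fourier (\<lambda>y. of_real (W (y + \<gamma> * s)) * quintic (u s y))"

text \<open>
  The cubic part of the Duhamel integral cancels against the correction in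
  \<^const>\<open>cubic_profile\<close>.
\<close>

lemma cubic_profile_duhamel:
  assumes mild: "mild_solution \<beta> \<gamma> W u"
    and ci: "\<And>s. 1 \<le> s \<Longrightarrow> integrable lborel (cubic (u s))"
    and qi: "\<And>s. 1 \<le> s \<Longrightarrow> integrable lborel (\<lambda>y. of_real (W (y + \<gamma> * s)) * quintic (u s y))"
    and cc: "continuous_on {1..} (\<lambda>s. fourier (cubic (u s)) \<zeta>)"
    and qc: "continuous_on {1..} (\<lambda>s. quintic_source W \<gamma> u s \<zeta>)"
    and t: "1 \<le> t"
  shows "cubic_profile \<beta> u t \<zeta> = cis (\<zeta>\<^sup>2) * fourier (u 1) \<zeta>
     + \<i> * (LINT s:{1..t}|lborel. cis (s * \<zeta>\<^sup>2) * quintic_source W \<gamma> u s \<zeta>)"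
proof -
  let ?F = "\<lambda>s. fourier (cubic (u s)) \<zeta>" and ?Q = "\<lambda>s. quintic_source W \<gamma> u s \<zeta>"
  have nl: "fourier (nonlinearity \<beta> \<gamma> W u s) \<zeta> = of_real \<beta> * ?F s - ?Q s" if s: "1 \<le> s" for s
  proof -
    have i: "integrable lborel (\<lambda>y. cis (- (\<zeta> * y)) * f y)" if "integrable lborel f" for f
      by (rule Bochner_Integration.integrable_bound[OF that])
         (use that in \<open>auto simp: norm_mult cis_conv_exp\<close>)
    have "cis (- (\<zeta> * y)) * nonlinearity \<beta> \<gamma> W u s y
       = of_real \<beta> * (cis (- (\<zeta> * y)) * cubic (u s) y) - cis (- (\<zeta> * y)) * (of_real (W (y + \<gamma> * s)) * quintic (u s y))" for y
      by (simp add: nonlinearity_def quintic_def algebra_simps)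
    then show ?thesis
      unfolding quintic_source_def fourier_def
      by (simp only:) (subst Bochner_Integration.integral_diff[OF integrable_mult_right[OF i[OF ci[OF s]]] i[OF qi[OF s]]],
        simp only: integral_mult_right_zero)
  qed
  have sub: "{1..t} \<subseteq> {1..}" by auto
  have iF: "set_integrable lborel {1..t} (\<lambda>s. cis (s * \<zeta>\<^sup>2) * ?F s)"
    unfolding cis_conv_exp
    by (intro borel_integrable_atLeastAtMost' continuous_intros continuous_on_subset[OF cc sub])
  have iQ: "set_integrable lborel {1..t} (\<lambda>s. cis (s * \<zeta>\<^sup>2) * ?Q s)"
    unfolding cis_conv_exp
    by (intro borel_integrable_atLeastAtMost' continuous_intros continuous_on_subset[OF qc sub])
  have "cis (t * \<zeta>\<^sup>2) * (LINT s:{1..t}|lborel. cis (- ((t - s) * \<zeta>\<^sup>2)) * fourier (nonlinearity \<beta> \<gamma> W u s) \<zeta>)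
     = (LINT s:{1..t}|lborel. cis (t * \<zeta>\<^sup>2) * (cis (- ((t - s) * \<zeta>\<^sup>2)) * fourier (nonlinearity \<beta> \<gamma> W u s) \<zeta>))"
    by simp
  also have "\<dots> = (LINT s:{1..t}|lborel. of_real \<beta> * (cis (s * \<zeta>\<^sup>2) * ?F s) - cis (s * \<zeta>\<^sup>2) * ?Q s)"
  proof (rule set_lebesgue_integral_cong)
    show "\<forall>s. s \<in> {1..t} \<longrightarrow> cis (t * \<zeta>\<^sup>2) * (cis (- ((t - s) * \<zeta>\<^sup>2)) * fourier (nonlinearity \<beta> \<gamma> W u s) \<zeta>)
       = of_real \<beta> * (cis (s * \<zeta>\<^sup>2) * ?F s) - cis (s * \<zeta>\<^sup>2) * ?Q s"
    proof (intro allI impI)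
      fix s assume "s \<in> {1..t}"
      then have s: "1 \<le> s" by simp
      have "cis (t * \<zeta>\<^sup>2) * cis (- ((t - s) * \<zeta>\<^sup>2)) = cis (s * \<zeta>\<^sup>2)"
        by (simp add: cis_mult algebra_simps)
      then show "cis (t * \<zeta>\<^sup>2) * (cis (- ((t - s) * \<zeta>\<^sup>2)) * fourier (nonlinearity \<beta> \<gamma> W u s) \<zeta>)
       = of_real \<beta> * (cis (s * \<zeta>\<^sup>2) * ?F s) - cis (s * \<zeta>\<^sup>2) * ?Q s"
        unfolding nl[OF s] mult.assoc[symmetric] by (simp add: algebra_simps)
    qed
  qed simp
  also have "\<dots> = of_real \<beta> * (LINT s:{1..t}|lborel. cis (s * \<zeta>\<^sup>2) * ?F s) - (LINT s:{1..t}|lborel. cis (s * \<zeta>\<^sup>2) * ?Q s)"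
    using set_integral_diff(2)[OF set_integrable_mult_right[OF iF, of "of_real \<beta>"] iQ] by simp
  finally have int: "cis (t * \<zeta>\<^sup>2) * (LINT s:{1..t}|lborel. cis (- ((t - s) * \<zeta>\<^sup>2)) * fourier (nonlinearity \<beta> \<gamma> W u s) \<zeta>)
     = of_real \<beta> * (LINT s:{1..t}|lborel. cis (s * \<zeta>\<^sup>2) * ?F s) - (LINT s:{1..t}|lborel. cis (s * \<zeta>\<^sup>2) * ?Q s)" .
  have "cis (t * \<zeta>\<^sup>2) * cis (- ((t - 1) * \<zeta>\<^sup>2)) = cis (\<zeta>\<^sup>2)"
    by (simp add: cis_mult algebra_simps)
  then have "cis (t * \<zeta>\<^sup>2) * fourier (u t) \<zeta> = cis (\<zeta>\<^sup>2) * fourier (u 1) \<zeta>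
     - \<i> * (cis (t * \<zeta>\<^sup>2) * (LINT s:{1..t}|lborel. cis (- ((t - s) * \<zeta>\<^sup>2)) * fourier (nonlinearity \<beta> \<gamma> W u s) \<zeta>))"
    using mild[unfolded mild_solution_def, rule_format, OF t, of \<zeta>]
    by (simp add: right_diff_distrib mult.assoc[symmetric])
  then show ?thesis
    unfolding cubic_profile_def int by (simp add: algebra_simps)
qed

lemma set_integrable_source:
  fixes Q :: "real \<Rightarrow> complex"
  assumes cont: "continuous_on {1..} Q" and bound: "\<And>s. 1 \<le> s \<Longrightarrow> cmod (Q s) \<le> B * s powr (- 5/2)" and T: "1 \<le> T"
  shows "set_integrable lborel {T<..} Q"
  unfolding set_integrable_def
proof (rule Bochner_Integration.integrable_bound)
  show "integrable lborel (\<lambda>s. B * (indicat_real {T<..} s *\<^sub>R s powr (- 5/2)))"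
    using set_integrable_powr_tail[of "5/2" T] T unfolding set_integrable_def by (intro integrable_mult_right) simp
  have "(\<lambda>s. indicat_real {T<..} s *\<^sub>R Q s) \<in> borel_measurable borel"
    by (intro borel_measurable_continuous_on_indicator continuous_on_subset[OF cont]) (use T in auto)
  then show "(\<lambda>s. indicat_real {T<..} s *\<^sub>R Q s) \<in> borel_measurable lborel" by simp
  show "AE s in lborel. norm (indicat_real {T<..} s *\<^sub>R Q s) \<le> norm (B * (indicat_real {T<..} s *\<^sub>R s powr (- 5/2)))"
    using bound T by (intro AE_I2) (auto simp: indicator_def intro: order_trans[OF _ abs_ge_self])
qed

text \<open>
  The limit exists by hypothesis, so it can be computed along the times \<open>T + n\<close>, where
  dominated convergence applies.
\<close>

lemma cubic_profile_tail:
  assumes duhamel: "\<And>t. 1 \<le> t \<Longrightarrow> P t = p0 + \<i> * (LINT s:{1..t}|lborel. Q s)"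
    and cont: "continuous_on {1..} Q" and bound: "\<And>s. 1 \<le> s \<Longrightarrow> cmod (Q s) \<le> B * s powr (- 5/2)"
    and lim: "(P \<longlongrightarrow> p) at_top" and T: "1 \<le> (T::real)"
  shows "p - P T = \<i> * (LINT s:{T<..}|lborel. Q s)"
proof -
  note si = set_integrable_source[OF cont bound T]
  have "(\<lambda>n. (LINT s:{T<..T + real n}|lborel. Q s)) \<longlonglongrightarrow> (LINT s:{T<..}|lborel. Q s)"
    unfolding set_lebesgue_integral_def
  proof (rule integral_dominated_convergence)
    show "integrable lborel (\<lambda>s. norm (indicat_real {T<..} s *\<^sub>R Q s))"
      using si unfolding set_integrable_def by (rule integrable_norm)
    show "(\<lambda>s. indicat_real {T<..} s *\<^sub>R Q s) \<in> borel_measurable lborel"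
      using si unfolding set_integrable_def by (rule borel_measurable_integrable)
    fix n
    have "set_integrable lborel {T<..T + real n} Q"
      by (rule set_integrable_subset[OF si]) auto
    then show "(\<lambda>s. indicat_real {T<..T + real n} s *\<^sub>R Q s) \<in> borel_measurable lborel"
      unfolding set_integrable_def by (rule borel_measurable_integrable)
    show "AE s in lborel. norm (indicat_real {T<..T + real n} s *\<^sub>R Q s) \<le> norm (indicat_real {T<..} s *\<^sub>R Q s)"
      by (intro AE_I2) (auto simp: indicator_def)
  next
    show "AE s in lborel. (\<lambda>n. indicat_real {T<..T + real n} s *\<^sub>R Q s) \<longlonglongrightarrow> indicat_real {T<..} s *\<^sub>R Q s"
    proof (rule AE_I2)
      fix s
      have "\<forall>\<^sub>F n in sequentially. indicat_real {T<..} s *\<^sub>R Q s = indicat_real {T<..T + real n} s *\<^sub>R Q s"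
        using eventually_ge_at_top[of "nat \<lceil>\<bar>s\<bar> + \<bar>T\<bar>\<rceil>"]
      proof eventually_elim
        case (elim n)
        then have "s \<le> T + real n" by linarith
        then show ?case by (simp add: indicator_def)
      qed
      then show "(\<lambda>n. indicat_real {T<..T + real n} s *\<^sub>R Q s) \<longlonglongrightarrow> indicat_real {T<..} s *\<^sub>R Q s"
        by (rule Lim_transform_eventually[OF tendsto_const])
    qed
  qed
  then have "(\<lambda>n. \<i> * (LINT s:{T<..T + real n}|lborel. Q s)) \<longlonglongrightarrow> \<i> * (LINT s:{T<..}|lborel. Q s)"
    by (intro tendsto_intros)
  moreover have "\<i> * (LINT s:{T<..T + real n}|lborel. Q s) = P (T + real n) - P T" for n
  proof -
    have ii: "set_integrable lborel {1..T + real n} Q"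
      by (intro borel_integrable_atLeastAtMost' continuous_on_subset[OF cont]) auto
    have "(LINT s:{1..T} \<union> {T<..T + real n}|lborel. Q s) = (LINT s:{1..T}|lborel. Q s) + (LINT s:{T<..T + real n}|lborel. Q s)"
      by (intro set_integral_Un set_integrable_subset[OF ii]) (use T in auto)
    moreover have "{1..T} \<union> {T<..T + real n} = {1..T + real n}" using T by auto
    ultimately show ?thesis using duhamel[of T] duhamel[of "T + real n"] T by (simp add: algebra_simps)
  qed
  ultimately have "(\<lambda>n. P (T + real n) - P T) \<longlonglongrightarrow> \<i> * (LINT s:{T<..}|lborel. Q s)" by simp
  moreover have "(\<lambda>n. P (T + real n) - P T) \<longlonglongrightarrow> p - P T"
  proof (intro tendsto_intros filterlim_compose[OF lim])
    show "filterlim (\<lambda>n. T + real n) at_top sequentially"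
      by (intro filterlim_tendsto_add_at_top[OF tendsto_const] filterlim_real_sequentially)
  qed
  ultimately show ?thesis by (rule LIMSEQ_unique[symmetric])
qed

lemma quintic_source_bound:
  fixes W :: "real \<Rightarrow> real"
  assumes W: "integrable lborel W" and vm: "integrable lborel (\<lambda>y. of_real (W (y + \<gamma> * s)) * quintic (u s y))"
    and v: "AE y in lborel. cmod (u s y) \<le> M * s powr (- 1/2)" and s: "0 < s"
  shows "cmod (quintic_source W \<gamma> u s \<zeta>) \<le> M ^ 5 * (LINT x|lborel. \<bar>W x\<bar>) * s powr (- 5/2)"
proof -
  have shift_int: "integrable lborel (\<lambda>y. \<bar>W (y + \<gamma> * s)\<bar>)"
    using lborel_integrable_real_affine[of "\<lambda>x. \<bar>W x\<bar>" 1 "\<gamma> * s"] W by (simp add: add.commute)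
  have shift_eq: "(LINT y|lborel. \<bar>W (y + \<gamma> * s)\<bar>) = (LINT x|lborel. \<bar>W x\<bar>)"
    using lborel_integral_real_affine[of 1 "\<lambda>x. \<bar>W x\<bar>" "\<gamma> * s"] by (simp add: add.commute)
  have s5: "(M * s powr (- 1/2)) ^ 5 = M ^ 5 * s powr (- 5/2)"
    using s by (simp add: power_mult_distrib powr_power)
  have "cmod (quintic_source W \<gamma> u s \<zeta>) \<le> (LINT y|lborel. norm (of_real (W (y + \<gamma> * s)) * quintic (u s y)))"
    unfolding quintic_source_def by (rule norm_fourier_le[OF vm])
  also have "\<dots> \<le> (LINT y|lborel. (M * s powr (- 1/2)) ^ 5 * \<bar>W (y + \<gamma> * s)\<bar>)"
  proof (rule integral_mono_AE)
    show "integrable lborel (\<lambda>y. norm (of_real (W (y + \<gamma> * s)) * quintic (u s y)))"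
      using vm by (rule integrable_norm)
    show "integrable lborel (\<lambda>y. (M * s powr (- 1/2)) ^ 5 * \<bar>W (y + \<gamma> * s)\<bar>)"
      by (intro integrable_mult_right shift_int)
    show "AE y in lborel. norm (of_real (W (y + \<gamma> * s)) * quintic (u s y)) \<le> (M * s powr (- 1/2)) ^ 5 * \<bar>W (y + \<gamma> * s)\<bar>"
      using v
    proof eventually_elim
      case (elim y)
      have "cmod (u s y) ^ 5 \<le> (M * s powr (- 1/2)) ^ 5" by (rule power_mono[OF elim]) simp
      from mult_right_mono[OF this, of "\<bar>W (y + \<gamma> * s)\<bar>"] show ?case
        by (simp add: norm_mult norm_quintic mult.commute)
    qed
  qed
  also have "\<dots> = M ^ 5 * (LINT x|lborel. \<bar>W x\<bar>) * s powr (- 5/2)"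
    unfolding integral_mult_right_zero shift_eq s5 by (simp only: mult_ac)
  finally show ?thesis .
qed

text \<open>
  The weight \<open>s\<^sup>-\<^sup>5\<^sup>/\<^sup>2\<close> integrates over \<open>(T, \<infinity>)\<close> to \<open>(2/3) T\<^sup>-\<^sup>3\<^sup>/\<^sup>2\<close>, so the rescaling by \<open>T\<^sup>3\<^sup>/\<^sup>2\<close> preserves the
  pointwise relative error \<open>e\<close>.
\<close>

lemma rescaled_tail_estimate:
  fixes S :: "real \<Rightarrow> complex"
  assumes T: "1 \<le> T" and S: "set_integrable lborel {T<..} S"
    and tail: "tail = \<i> * (LINT s:{T<..}|lborel. S s)"
    and e: "\<And>s. T < s \<Longrightarrow> cmod (S s - of_real (s powr (- 5/2)) * (cis (s * (\<eta> / sqrt T)\<^sup>2) * (a * cis (- (\<alpha> * ln s))))) \<le> s powr (- 5/2) * e"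
    and e0: "0 \<le> e"
  shows "cmod (of_real (T powr (3/2)) * cis (\<alpha> * ln T) * tail
      - \<i> * a * tail_laplace (5/2 + \<i> * of_real \<alpha>) (- (\<i> * of_real (\<eta>\<^sup>2)))) \<le> e"
proof -
  define m where "m s = complex_of_real (s powr (- 5/2)) * (cis (s * (\<eta> / sqrt T)\<^sup>2) * (a * cis (- (\<alpha> * ln s))))" for s
  have mi: "set_integrable lborel {T<..} m"
  proof (rule set_integrable_source[OF _ _ T])
    show "continuous_on {1..} m"
      unfolding m_def cis_conv_exp by (intro continuous_intros) auto
    show "cmod (m s) \<le> cmod a * s powr (- 5/2)" for s
      by (simp add: m_def norm_mult mult.commute)
  qed
  let ?L = "tail_laplace (5/2 + \<i> * of_real \<alpha>) (- (\<i> * of_real (\<eta>\<^sup>2)))"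
  have m_eq: "(LINT s:{T<..}|lborel. m s) = of_real (T powr (- 3/2)) * cis (- (\<alpha> * ln T)) * (a * ?L)"
    unfolding m_def by (rule rescaled_tail_integral) (use T in simp)
  have unit: "of_real (T powr (3/2)) * cis (\<alpha> * ln T) * (of_real (T powr (- 3/2)) * cis (- (\<alpha> * ln T))) = 1"
  proof -
    have "of_real (T powr (3/2)) * cis (\<alpha> * ln T) * (of_real (T powr (- 3/2)) * cis (- (\<alpha> * ln T)))
       = of_real (T powr (3/2) * T powr (- 3/2)) * (cis (\<alpha> * ln T) * cis (- (\<alpha> * ln T)))"
      by (simp only: of_real_mult mult_ac)
    also have "\<dots> = 1" using T by (simp add: cis_mult flip: powr_add)
    finally show ?thesis .
  qed
  have "of_real (T powr (3/2)) * cis (\<alpha> * ln T) * tail - \<i> * a * ?L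
     = of_real (T powr (3/2)) * cis (\<alpha> * ln T) * (\<i> * ((LINT s:{T<..}|lborel. S s) - (LINT s:{T<..}|lborel. m s)))"
  proof -
    have "of_real (T powr (3/2)) * cis (\<alpha> * ln T) * (\<i> * (LINT s:{T<..}|lborel. m s))
       = (of_real (T powr (3/2)) * cis (\<alpha> * ln T) * (of_real (T powr (- 3/2)) * cis (- (\<alpha> * ln T)))) * (\<i> * a * ?L)"
      unfolding m_eq by (simp only: mult_ac)
    also have "\<dots> = \<i> * a * ?L" unfolding unit by simp
    finally show ?thesis unfolding tail by (simp add: right_diff_distrib)
  qed
  then have "cmod (of_real (T powr (3/2)) * cis (\<alpha> * ln T) * tail - \<i> * a * ?L)
     = T powr (3/2) * cmod ((LINT s:{T<..}|lborel. S s) - (LINT s:{T<..}|lborel. m s))"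
    by (simp add: norm_mult)
  also have "\<dots> \<le> T powr (3/2) * ((T powr (- 3/2) / (3/2)) * e)"
  proof (rule mult_left_mono)
    have diff: "(LINT s:{T<..}|lborel. S s) - (LINT s:{T<..}|lborel. m s) = (LINT s:{T<..}|lborel. S s - m s)"
      using set_integral_diff(2)[OF S mi] by simp
    have bound: "cmod (LINT s:{T<..}|lborel. S s - m s) \<le> (LINT s:{T<..}|lborel. s powr (- (5/2)) * e)"
      unfolding set_lebesgue_integral_def
    proof (rule norm_integral_le_AE)
      show "integrable lborel (\<lambda>s. indicat_real {T<..} s *\<^sub>R (s powr (- (5/2)) * e))"
        using set_integrable_mult_left[OF set_integrable_powr_tail[of "5/2" T], of e] T unfolding set_integrable_def by simp
      show "AE s in lborel. norm (indicat_real {T<..} s *\<^sub>R (S s - m s)) \<le> indicat_real {T<..} s *\<^sub>R (s powr (- (5/2)) * e)"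
        using e by (intro AE_I2) (auto simp: indicator_def m_def)
    qed
    have weight: "(LINT s:{T<..}|lborel. s powr (- (5/2)) * e) = (T powr (- 3/2) / (3/2)) * e"
      using set_integral_powr_tail[of "5/2" T] T by simp
    show "cmod ((LINT s:{T<..}|lborel. S s) - (LINT s:{T<..}|lborel. m s)) \<le> (T powr (- 3/2) / (3/2)) * e"
      unfolding diff weight[symmetric] by (rule bound)
  qed simp
  also have "\<dots> = (T powr (3/2) * T powr (- 3/2)) * (e * (2/3))" by simp
  also have "T powr (3/2) * T powr (- 3/2) = 1" using T by (simp flip: powr_add)
  also have "1 * (e * (2/3)) \<le> e" using e0 by simp
  finally show ?thesis .
qed

theorem corollary4p13:
  fixes \<beta> \<gamma> \<epsilon>0 C\<delta> C \<epsilon> \<zeta>0 \<alpha> M0 :: real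
    and A0 :: complex
    and W :: "real \<Rightarrow> real"
    and u :: "real \<Rightarrow> real \<Rightarrow> complex"
    and A P_plus :: "real \<Rightarrow> complex"
  assumes W: "localized_potential W"
    and theory_holds: "small_data_theory \<beta> W \<epsilon>0 C\<delta> C"
    and eps: "0 < \<epsilon>" "\<epsilon> \<le> \<epsilon>0"
    and sol: "global_solution \<beta> \<gamma> W u"
    and small: "Sigma_norm (u 1) \<le> \<epsilon>"
    and profile: "modified_scattering_profile \<beta> C (C\<delta> * \<bar>\<beta>\<bar> * \<epsilon>\<^sup>2) \<epsilon> u A"
    and A_cont: "continuous_on UNIV A"
    and limit: "cubic_profile_limit \<beta> u P_plus"
    and zeta0: "\<zeta>0 = - \<gamma> / 2"
    and A0: "A0 = A (- \<gamma>)"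
    and alpha: "\<alpha> = \<beta> * (cmod A0)\<^sup>2"
    and M0: "M0 = (LINT x|lborel. W x)"
    and nonzero: "complex_of_real M0 * A0 \<noteq> 0"
  shows "\<exists>\<Phi> :: real \<Rightarrow> complex.
     (\<forall>K. compact K \<longrightarrow>
        uniform_limit K
          (\<lambda>T \<eta>. complex_of_real (T powr (3/2)) * cis (\<alpha> * ln T)
             * (P_plus (\<zeta>0 + \<eta> / sqrt T) - cubic_profile \<beta> u T (\<zeta>0 + \<eta> / sqrt T)))
          \<Phi> at_top) \<and>
     (\<exists>\<eta>. \<Phi> \<eta> \<noteq> 0) \<and>
     \<Phi> \<in> C21_loc \<and>
     third_deriv_not_extendable_at_0 \<Phi>"
proof -
  define \<delta> where "\<delta> = C\<delta> * \<bar>\<beta>\<bar> * \<epsilon>\<^sup>2"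
  define M where "M = C * \<epsilon>"
  have pos: "0 < \<epsilon>0" "0 < C\<delta>" "0 < C" "C\<delta> * \<bar>\<beta>\<bar> * \<epsilon>0\<^sup>2 < 1/16"
    using theory_holds by (auto simp: small_data_theory_def)
  have M: "0 \<le> M" using pos eps by (simp add: M_def)
  have "\<epsilon>\<^sup>2 \<le> \<epsilon>0\<^sup>2" using eps by (intro power_mono) auto
  then have "\<delta> \<le> C\<delta> * \<bar>\<beta>\<bar> * \<epsilon>0\<^sup>2" unfolding \<delta>_def using pos by (intro mult_left_mono) auto
  then have \<delta>: "\<delta> < 1/16" using pos by linarith

  have Sigma: "u t \<in> Sigma_space"
    and Sigma_cont: "((\<lambda>s. Sigma_norm (\<lambda>y. u s y - u t y)) \<longlongrightarrow> 0) (at t within {1..})" if "1 \<le> t" for t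
    using sol that by (auto simp: global_solution_def continuous_in_Sigma_def)
  have mild: "mild_solution \<beta> \<gamma> W u" using sol by (simp add: global_solution_def)
  have "solution_bounds C \<delta> \<epsilon> u \<and>
      (\<forall>A s. modified_scattering_profile \<beta> C \<delta> \<epsilon> u A \<and> s < 1 - 2 * \<delta> \<longrightarrow> A \<in> L2_Hs s)"
  proof -
    have "global_solution \<beta> \<gamma> W u \<and> (AE y in lborel. u 1 y = u 1 y)" using sol by simp
    moreover have "0 < \<epsilon> \<and> \<epsilon> \<le> \<epsilon>0 \<and> u 1 \<in> Sigma_space \<and> Sigma_norm (u 1) \<le> \<epsilon>"
      using eps small Sigma[of 1] by simp
    ultimately show ?thesis
      using theory_holds unfolding small_data_theory_def Let_def \<delta>_def by blast
  qed
  then have bounds: "solution_bounds C \<delta> \<epsilon> u" and A_Hs: "A \<in> L2_Hs (7/8)"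
    using profile \<delta> unfolding \<delta>_def[symmetric] by auto

  have L2: "u s \<in> L2" if "1 \<le> s" for s
    using Sigma[OF that] by (simp add: Sigma_space_def H1_def)
  have um: "u s \<in> borel_measurable borel" if "1 \<le> s" for s using L2_D(1)[OF L2[OF that]] by simp
  have decay: "AE y in lborel. cmod (u s y) \<le> M * s powr (- 1/2)" if "1 \<le> s" for s
    using bounds that unfolding solution_bounds_def M_def by (intro Linf_AE_le) auto
  have uM: "AE y in lborel. cmod (u s y) \<le> M" if s: "1 \<le> s" for s
  proof -
    have "s powr (- 1/2) \<le> 1" using powr_mono[of "- 1/2" 0 s] s by simp
    then have "M * s powr (- 1/2) \<le> M" using M by (rule mult_left_le)
    then show ?thesis using decay[OF s] by (auto elim: eventually_mono)
  qed
  have L2_cont: "((\<lambda>s. L2_norm (\<lambda>y. u s y - u t y)) \<longlongrightarrow> 0) (at t within {1..})" if "1 \<le> t" for t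
    by (rule Lim_null_comparison[OF _ Sigma_cont[OF that]]) (simp add: L2_norm_le_Sigma_norm)

  have A2: "A \<in> L2" and "A \<in> Linf" and An: "L2_norm A + Linf_norm A \<le> M"
    using profile by (auto simp: modified_scattering_profile_def M_def)
  have "Linf_norm A \<le> M" using An L2_norm_nonneg[of A] by linarith
  then have AM: "cmod (A x) \<le> M" for x
    using AE_bounded_continuous[OF A_cont Linf_AE_le[OF \<open>A \<in> Linf\<close>]] by blast
  have Am: "A \<in> borel_measurable borel" using L2_D(1)[OF A2] by simp
  obtain H where H: "0 \<le> H" "\<And>x y. cmod (A x - A y) \<le> H * \<bar>x - y\<bar> powr (1/4)"
    using Sobolev_Hoelder[OF A_Hs AM A_cont] by blast
  have wave: "AE y in lborel. cmod (u s y - modified_free_wave \<beta> A s y) \<le> M * s powr (- 5/8)" if s: "1 \<le> s" for s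
  proof (rule Linf_AE_le)
    \<comment> \<open>Here the smallness \<open>\<delta> < 1/16\<close> enters: the error must beat \<open>s\<^sup>-\<^sup>1\<^sup>/\<^sup>2\<close> by a fixed power.\<close>
    have "s powr (- 3/4 + 2 * \<delta>) \<le> s powr (- 5/8)" using s \<delta> by (intro powr_mono) auto
    from mult_left_mono[OF this M]
    show "Linf_norm (\<lambda>y. u s y - modified_free_wave \<beta> A s y) \<le> M * s powr (- 5/8)"
      using profile s unfolding modified_scattering_profile_def M_def \<delta>_def by force
    show "(\<lambda>y. u s y - modified_free_wave \<beta> A s y) \<in> Linf"
      using profile s unfolding modified_scattering_profile_def by auto
  qed

  obtain K where Wm: "W \<in> borel_measurable borel" and WK: "\<And>x. \<bar>W x\<bar> \<le> K" "\<And>x y. \<bar>W x - W y\<bar> \<le> K * \<bar>x - y\<bar>"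
    and Wi: "integrable lborel (\<lambda>x. \<bar>W x\<bar> * (1 + \<bar>x\<bar>))"
    using localized_potential_bounds[OF W] by blast
  have K: "0 \<le> K" using WK(1)[of 0] by simp
  have W1: "integrable lborel W"
    by (rule Bochner_Integration.integrable_bound[OF Wi]) (use Wm in \<open>auto intro!: AE_I2 simp: abs_mult algebra_simps\<close>)

  have L2M: "0 \<le> 2 * M" using M by simp
  have one: "(\<lambda>y. 1) \<in> borel_measurable borel" "\<bar>1\<bar> \<le> (1::real)" "\<bar>1 - 1\<bar> \<le> 1 * \<bar>s - t\<bar>" for s t :: real
    by simp_all
  have Nm: "(\<lambda>z::complex. of_real ((cmod z)\<^sup>2) * z) \<in> borel_measurable borel" by measurable
  have N0: "complex_of_real ((cmod 0)\<^sup>2) * 0 = 0" by simp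
  have cubic_eq: "cubic f = (\<lambda>y. complex_of_real 1 * (of_real ((cmod (f y))\<^sup>2) * f y))" for f
    by (simp add: cubic_def[abs_def])
  have cubic_int: "integrable lborel (cubic (u s))" if "1 \<le> s" for s
    unfolding cubic_eq
    by (rule fourier_source_integrable[where V = "\<lambda>_ _. 1",
          OF L2 uM L2_cont one L2M Nm N0 cubic_lipschitz that])
  have cubic_cont: "continuous_on {1..} (\<lambda>s. fourier (cubic (u s)) \<zeta>)" for \<zeta>
    unfolding cubic_eq
    by (rule fourier_source_continuous[where V = "\<lambda>_ _. 1",
          OF L2 uM L2_cont one L2M Nm N0 cubic_lipschitz])
  define K' where "K' = K * (1 + \<bar>\<gamma>\<bar>)"
  \<comment> \<open>One constant serves as sup bound and as Lipschitz constant in time of the moving potential.\<close>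
  have V: "\<bar>W (y + \<gamma> * s)\<bar> \<le> K'" "\<bar>W (y + \<gamma> * s) - W (y + \<gamma> * t)\<bar> \<le> K' * \<bar>s - t\<bar>" for s t y
  proof -
    have "0 \<le> K * \<bar>\<gamma>\<bar>" "0 \<le> K * \<bar>s - t\<bar>" using K by auto
    then show "\<bar>W (y + \<gamma> * s)\<bar> \<le> K'" using WK(1)[of "y + \<gamma> * s"] unfolding K'_def distrib_left by linarith
    have "\<bar>(y + \<gamma> * s) - (y + \<gamma> * t)\<bar> = \<bar>\<gamma>\<bar> * \<bar>s - t\<bar>" by (simp flip: abs_mult right_diff_distrib)
    then have "\<bar>W (y + \<gamma> * s) - W (y + \<gamma> * t)\<bar> \<le> K * (\<bar>\<gamma>\<bar> * \<bar>s - t\<bar>)"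
      using WK(2)[of "y + \<gamma> * s" "y + \<gamma> * t"] by simp
    then show "\<bar>W (y + \<gamma> * s) - W (y + \<gamma> * t)\<bar> \<le> K' * \<bar>s - t\<bar>"
      using \<open>0 \<le> K * \<bar>s - t\<bar>\<close> by (simp add: K'_def algebra_simps)
  qed
  have L3: "0 \<le> 3 * M ^ 3" using M by simp
  have Vm: "(\<lambda>y. W (y + \<gamma> * s)) \<in> borel_measurable borel" for s using Wm by measurable
  have q0: "quintic 0 = 0" by (simp add: quintic_def)
  have source_int: "integrable lborel (\<lambda>y. of_real (W (y + \<gamma> * s)) * quintic (u s y))" if "1 \<le> s" for s
    by (rule fourier_source_integrable[where V = "\<lambda>s y. W (y + \<gamma> * s)",
          OF L2 uM L2_cont Vm V L3 quintic_measurable q0 quintic_lipschitz that])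
  have source_cont: "continuous_on {1..} (\<lambda>s. quintic_source W \<gamma> u s \<zeta>)" for \<zeta>
    unfolding quintic_source_def
    by (rule fourier_source_continuous[where V = "\<lambda>s y. W (y + \<gamma> * s)",
          OF L2 uM L2_cont Vm V L3 quintic_measurable q0 quintic_lipschitz])
  define B where "B = M ^ 5 * (LINT x|lborel. \<bar>W x\<bar>)"
  have source_bound: "cmod (cis (s * \<zeta>\<^sup>2) * quintic_source W \<gamma> u s \<zeta>) \<le> B * s powr (- 5/2)" if "1 \<le> s" for s \<zeta>
    using quintic_source_bound[of W \<gamma> s u M \<zeta>, OF W1 source_int[OF that] decay[OF that]] that by (simp add: norm_mult B_def)
  have phase_cont: "continuous_on {1..} (\<lambda>s. cis (s * \<zeta>\<^sup>2) * quintic_source W \<gamma> u s \<zeta>)" for \<zeta>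
    unfolding cis_conv_exp by (intro continuous_intros source_cont)
  have tail: "P_plus \<zeta> - cubic_profile \<beta> u T \<zeta> = \<i> * (LINT s:{T<..}|lborel. cis (s * \<zeta>\<^sup>2) * quintic_source W \<gamma> u s \<zeta>)"
    if "1 \<le> T" for T \<zeta>
  proof (rule cubic_profile_tail[OF _ phase_cont source_bound _ that])
    show "((\<lambda>t. cubic_profile \<beta> u t \<zeta>) \<longlongrightarrow> P_plus \<zeta>) at_top"
      using limit by (auto simp: cubic_profile_limit_def intro: tendsto_uniform_limitI)
    show "cubic_profile \<beta> u t \<zeta> = cis (\<zeta>\<^sup>2) * fourier (u 1) \<zeta> + \<i> * (LINT s:{1..t}|lborel. cis (s * \<zeta>\<^sup>2) * quintic_source W \<gamma> u s \<zeta>)"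
      if "1 \<le> t" for t
      by (rule cubic_profile_duhamel[OF mild cubic_int source_int cubic_cont source_cont that])
  qed

  define a where "a = complex_of_real M0 * quintic A0"
  define \<Phi> where "\<Phi> \<eta> = \<i> * a * tail_laplace (5/2 + \<i> * of_real \<alpha>) (- (\<i> * of_real (\<eta>\<^sup>2)))" for \<eta> :: real
  define D where "D = (8 * M ^ 5 + 6 * M ^ 4 * H + 16 * M ^ 6 * \<bar>\<beta>\<bar> * H) * (LINT x|lborel. \<bar>W x\<bar> * (1 + \<bar>x\<bar>))"
  have D: "0 \<le> D" unfolding D_def using M H by (intro mult_nonneg_nonneg add_nonneg_nonneg) auto
  have rate: "cmod (of_real (T powr (3/2)) * cis (\<alpha> * ln T)
       * (P_plus (\<zeta>0 + \<eta> / sqrt T) - cubic_profile \<beta> u T (\<zeta>0 + \<eta> / sqrt T)) - \<Phi> \<eta>)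
     \<le> D * ((\<bar>\<eta>\<bar> + 1) * T powr (- 1/8))" if T: "1 \<le> T" for T \<eta>
    unfolding \<Phi>_def
  proof (rule rescaled_tail_estimate[OF T set_integrable_source[OF phase_cont source_bound T] tail[OF T]])
    show "0 \<le> D * ((\<bar>\<eta>\<bar> + 1) * T powr (- 1/8))" using D by simp
    fix s assume s: "T < s"
    then have s1: "1 \<le> s" using T by simp
    let ?\<zeta> = "\<zeta>0 + \<eta> / sqrt T"
    have q: "?\<zeta> + \<gamma> / 2 = \<eta> / sqrt T" by (simp add: zeta0)
    have "\<bar>\<eta> / sqrt T\<bar> + s powr (- 1/8) \<le> \<bar>\<eta>\<bar> * T powr (- 1/8) + T powr (- 1/8)"
    proof (rule add_mono)
      have "1 / sqrt T = T powr (- 1/2)" using T powr_minus_divide[of T "1/2"] by (simp add: powr_half_sqrt)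
      also have "\<dots> \<le> T powr (- 1/8)" using T by (intro powr_mono) auto
      finally have "\<bar>\<eta>\<bar> * (1 / sqrt T) \<le> \<bar>\<eta>\<bar> * T powr (- 1/8)" by (rule mult_left_mono) simp
      then show "\<bar>\<eta> / sqrt T\<bar> \<le> \<bar>\<eta>\<bar> * T powr (- 1/8)" using T by (simp add: abs_divide)
      show "s powr (- 1/8) \<le> T powr (- 1/8)" using s T by (intro powr_mono2') auto
    qed
    then have "D * (\<bar>\<eta> / sqrt T\<bar> + s powr (- 1/8)) \<le> D * ((\<bar>\<eta>\<bar> + 1) * T powr (- 1/8))"
      using D by (intro mult_left_mono) (auto simp: algebra_simps)
    then have "s powr (- 5/2) * (D * (\<bar>\<eta> / sqrt T\<bar> + s powr (- 1/8))) \<le> s powr (- 5/2) * (D * ((\<bar>\<eta>\<bar> + 1) * T powr (- 1/8)))"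
      by (rule mult_left_mono) simp
    moreover have "cmod (cis (s * ?\<zeta>\<^sup>2) * quintic_source W \<gamma> u s ?\<zeta>
        - of_real (s powr (- 5/2)) * (cis (s * (\<eta> / sqrt T)\<^sup>2) * (a * cis (- (\<alpha> * ln s)))))
       \<le> s powr (- 5/2) * (D * (\<bar>\<eta> / sqrt T\<bar> + s powr (- 1/8)))"
      using source_asymptotics[OF Wm Wi Am AM H s1 um[OF s1] decay[OF s1] wave[OF s1], of ?\<zeta> \<gamma>]
      unfolding q quintic_source_def a_def D_def M0 alpha A0 by (simp only: mult.assoc)
    ultimately show "cmod (cis (s * ?\<zeta>\<^sup>2) * quintic_source W \<gamma> u s ?\<zeta>
        - of_real (s powr (- 5/2)) * (cis (s * (\<eta> / sqrt T)\<^sup>2) * (a * cis (- (\<alpha> * ln s)))))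
       \<le> s powr (- 5/2) * (D * ((\<bar>\<eta>\<bar> + 1) * T powr (- 1/8)))"
      by linarith
  qed

  have a0: "\<i> * a \<noteq> 0" using nonzero by (simp add: a_def quintic_def)
  note regular = tail_profile_regularity[OF a0, of \<alpha>, folded \<Phi>_def]
  have "uniform_limit K (\<lambda>T \<eta>. of_real (T powr (3/2)) * cis (\<alpha> * ln T)
       * (P_plus (\<zeta>0 + \<eta> / sqrt T) - cubic_profile \<beta> u T (\<zeta>0 + \<eta> / sqrt T))) \<Phi> at_top"
    if cK: "compact K" for K :: "real set"
  proof (rule uniform_limitI)
    obtain R where R: "\<And>\<eta>. \<eta> \<in> K \<Longrightarrow> \<bar>\<eta>\<bar> \<le> R"
      using compact_imp_bounded[OF cK] by (auto simp: bounded_iff)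
    fix e :: real assume e: "0 < e"
    have "((\<lambda>T. D * ((R + 1) * T powr (- 1/8))) \<longlongrightarrow> 0) at_top" by real_asymp
    from order_tendstoD(2)[OF this e] eventually_ge_at_top[of 1]
    show "\<forall>\<^sub>F T in at_top. \<forall>\<eta>\<in>K. dist (of_real (T powr (3/2)) * cis (\<alpha> * ln T)
       * (P_plus (\<zeta>0 + \<eta> / sqrt T) - cubic_profile \<beta> u T (\<zeta>0 + \<eta> / sqrt T))) (\<Phi> \<eta>) < e"
    proof eventually_elim
      case (elim T)
      show ?case
      proof
        fix \<eta> assume "\<eta> \<in> K"
        then have "D * ((\<bar>\<eta>\<bar> + 1) * T powr (- 1/8)) \<le> D * ((R + 1) * T powr (- 1/8))"
          using R D by (intro mult_left_mono mult_right_mono) auto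
        then show "dist (of_real (T powr (3/2)) * cis (\<alpha> * ln T)
       * (P_plus (\<zeta>0 + \<eta> / sqrt T) - cubic_profile \<beta> u T (\<zeta>0 + \<eta> / sqrt T))) (\<Phi> \<eta>) < e"
          unfolding dist_norm using rate[OF elim(2), of \<eta>] elim(1) by linarith
      qed
    qed
  qed
  then show ?thesis
    using third_deriv_not_extendable_imp_nonzero[OF regular(2)] regular by blast
qed

end
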